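(* Let $|q|<1$, $\alpha>0$ and let $\mathbf{Y}=(Y_t)_{t\in\mathbb{R}}$ be an $(\alpha,q)$-OU process with transition operators $\{P^\tau\}_{\tau>0}$. Then: (i) $\operatorname{var}(Y_t)=1$ for all $t$, and $\operatorname{var}(Y_{t+s}|Y_t)=1-e^{-2\alpha s}$ for all $t\in\mathbb{R}$, $s\ge 0$; in particular $\mathbf{Y}$ has (up to modification) càdlàg trajectories with values in $S(q)$. (ii) For every $\tau>0$ the transition operator $P^\tau$ acts on $B(q)$ by $$f(x)=\sum_{j\ge0}\frac{b_j}{\sqrt{[j]_q!}}H_j(x|q)\ \longmapsto\ P^\tau(f)(x)=\sum_{j\ge0}e^{-\alpha\tau j}\frac{b_j}{\sqrt{[j]_q!}}H_j(x|q).$$ (iii) The family $\{P^\tau\}_{\tau>0}$ is Feller-continuous (each $P^\tau$ maps continuous functions on $S(q)$ to continuous functions on $S(q)$). In particular $\mathbf{Y}$ has the strong Markov property. (iv) The family $\{P^\tau\}_{\tau>0}$ is right continuous, i.e. $\lim_{\tau\to0^+}\sup_{x\in S(q)}|f(x)-P^\tau(f)(x)|=0$ for every continuous $f$ on $S(q)$; consequently $\mathbf{Y}$ is a Feller process. Moreover its infinitesimal operator $A$ exists and is defined on $B^0(q)$ by $$f(x)=\sum_{j\ge0}\frac{b_j}{\sqrt{[j]_q!}}H_j(x|q)\in B^0(q)\ \longmapsto\ A(f)(x)=-\alpha\sum_{j\ge1}\frac{j\,b_j}{\sqrt{[j]_q!}}H_j(x|q)\in B(q),$$ where $A(f)=\lim_{h\to0^+}\frac1h(P^hf-f)$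 in $B(q)$.
   Context: Let $|q|<1$, $S(q)=[-2/\sqrt{1-q},2/\sqrt{1-q}]$, $(a)_\infty=\prod_{i\ge0}(1-aq^i)$, $(a,b)_\infty=(a)_\infty(b)_\infty$, $0^0=1$, $I_A$ the indicator function of $A$. Define, for $|\rho|<1$, $y\in S(q)$, $$f_N(x|q)=\frac{\sqrt{1-q}\,(q)_\infty}{2\pi\sqrt{4-(1-q)x^2}}\prod_{k=0}^\infty\left((1+q^k)^2-(1-q)x^2q^k\right)I_{S(q)}(x),$$ $$f_{CN}(x|y,\rho,q)=\frac{\sqrt{1-q}\,(\rho^2,q)_\infty}{2\pi\sqrt{4-(1-q)x^2}}\prod_{k=0}^\infty\frac{(1+q^k)^2-(1-q)x^2q^k}{(1-\rho^2q^{2k})^2-(1-q)\rho q^k(1+\rho^2q^{2k})xy+(1-q)\rho^2(x^2+y^2)q^{2k}}\,I_{S(q)}(x).$$ An $(\alpha,q)$-OU (Ornstein–Uhlenbeck) process is a stationary Markov process $(Y_t)_{t\in\mathbb{R}}$ with state space $S(q)$, one-dimensional marginal density $f_N(x|q)$, and such that for $s>t$ the conditional distribution of $Y_s$ given $Y_t=y$ has density $f_{CN}(x|y,e^{-\alpha(s-t)},q)$. Its transition operators are $P^\tau(f)(y)=\int_{S(q)}f(x)f_{CN}(x|y,e^{-\alpha\tau},q)\,dx$, $\tau>0$. $[0]_q=0$, $[n]_q=1+q+\dots+q^{n-1}$, $[n]_q!=\prod_{i=1}^n[i]_q$, $[0]_q!=1$. The $q$-Hermite polynomials are given by $H_{-1}=0$,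 $H_0=1$, $xH_n(x|q)=H_{n+1}(x|q)+[n]_qH_{n-1}(x|q)$; they are orthogonal with respect to $f_N(x|q)dx$ with squared norms $[n]_q!$. $B(q)=L_2(S(q),f_N(x|q)dx)$ (real-valued functions), i.e. the set of $f=\sum_{j\ge0}\frac{b_j}{\sqrt{[j]_q!}}H_j(\cdot|q)$ with $\sum_j|b_j|^2<\infty$; $B^0(q)\subset B(q)$ is the subset of those $f$ with $\sum_{j\ge0} j^2|b_j|^2<\infty$. *)

theory Defs
  imports "HOL-Probability.Probability"
begin

section \<open>The densities and the \<open>q\<close>-Hermite polynomials\<close>

definition state_space :: "real \<Rightarrow> real set" where
  "state_space q = {- 2 / sqrt (1 - q) .. 2 / sqrt (1 - q)}"

definition qpoch :: "real \<Rightarrow> real \<Rightarrow> real" where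
  "qpoch a q = (\<Prod>i. 1 - a * q ^ i)"

text \<open>At the two endpoints of \<open>state_space q\<close> the factor with index 0 vanishes together with the square root in
  the denominator; with \<open>x / 0 = 0\<close> both densities get the value 0 there, which is also their limit.\<close>

definition f_N :: "real \<Rightarrow> real \<Rightarrow> real" where
  "f_N x q = sqrt (1 - q) * qpoch q q / (2 * pi * sqrt (4 - (1 - q) * x\<^sup>2))
     * (\<Prod>k. (1 + q ^ k)\<^sup>2 - (1 - q) * x\<^sup>2 * q ^ k) * indicator (state_space q) x"

definition f_CN :: "real \<Rightarrow> real \<Rightarrow> real \<Rightarrow> real \<Rightarrow> real" where
  "f_CN x y \<rho> q = sqrt (1 - q) * (qpoch (\<rho>\<^sup>2) q * qpoch q q) / (2 * pi * sqrt (4 - (1 - q) * x\<^sup>2))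
     * (\<Prod>k. ((1 + q ^ k)\<^sup>2 - (1 - q) * x\<^sup>2 * q ^ k) /
           ((1 - \<rho>\<^sup>2 * q ^ (2 * k))\<^sup>2 - (1 - q) * \<rho> * q ^ k * (1 + \<rho>\<^sup>2 * q ^ (2 * k)) * x * y
             + (1 - q) * \<rho>\<^sup>2 * (x\<^sup>2 + y\<^sup>2) * q ^ (2 * k)))
     * indicator (state_space q) x"

definition qint :: "real \<Rightarrow> nat \<Rightarrow> real" where
  "qint q n = (\<Sum>i<n. q ^ i)"

definition qfact :: "real \<Rightarrow> nat \<Rightarrow> real" where
  "qfact q n = (\<Prod>i=1..n. qint q i)"

text \<open>The second equation is the recurrence at \<open>n = 0\<close> with \<open>H\<^sub>-\<^sub>1 = 0\<close>.\<close>

fun qHermite :: "real \<Rightarrow> nat \<Rightarrow> real \<Rightarrow> real" where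
  "qHermite q 0 x = 1"
| "qHermite q (Suc 0) x = x"
| "qHermite q (Suc (Suc n)) x = x * qHermite q (Suc n) x - qint q (Suc n) * qHermite q n x"


section \<open>Square-integrable functions and Hermite expansions\<close>

text \<open>Elements of \<open>L\<^sub>2\<close> are represented by functions; limits are determined up to null sets.\<close>

definition L2_space :: "'a measure \<Rightarrow> ('a \<Rightarrow> real) set" where
  "L2_space M = {f \<in> borel_measurable M. integrable M (\<lambda>x. (f x)\<^sup>2)}"

definition L2_tendsto :: "'a measure \<Rightarrow> ('i \<Rightarrow> 'a \<Rightarrow> real) \<Rightarrow> ('a \<Rightarrow> real) \<Rightarrow> 'i filter \<Rightarrow> bool" where
  "L2_tendsto M g f F \<longleftrightarrow> f \<in> L2_space M \<and> (\<forall>\<^sub>F i in F. g i \<in> L2_space M) \<and>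
     ((\<lambda>i. sqrt (\<integral>x. (g i x - f x)\<^sup>2 \<partial>M)) \<longlongrightarrow> 0) F"

definition qN_measure :: "real \<Rightarrow> real measure" where
  "qN_measure q = density (restrict_space lborel (state_space q)) (\<lambda>x. ennreal (f_N x q))"

definition B_space :: "real \<Rightarrow> (real \<Rightarrow> real) set" where
  "B_space q = L2_space (qN_measure q)"

definition hermite_expansion :: "real \<Rightarrow> (real \<Rightarrow> real) \<Rightarrow> (nat \<Rightarrow> real) \<Rightarrow> bool" where
  "hermite_expansion q f b \<longleftrightarrow> summable (\<lambda>j. (b j)\<^sup>2) \<and>
     L2_tendsto (qN_measure q)
       (\<lambda>n x. \<Sum>j<n. b j / sqrt (qfact q j) * qHermite q j x) f sequentially"

definition B0_space :: "real \<Rightarrow> (real \<Rightarrow> real) set" where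
  "B0_space q = {f \<in> B_space q. \<exists>b. hermite_expansion q f b \<and> summable (\<lambda>j. (real j)\<^sup>2 * (b j)\<^sup>2)}"


section \<open>Stochastic processes indexed by the real line\<close>

text \<open>The time index is extended to \<open>ereal\<close> so that stopping times may take the value \<open>\<infinity>\<close>.\<close>

definition natural_filtration :: "'a measure \<Rightarrow> (real \<Rightarrow> 'a \<Rightarrow> real) \<Rightarrow> ereal \<Rightarrow> 'a measure" where
  "natural_filtration M Y t =
     sigma (space M) {Y u -` C \<inter> space M | u C. ereal u \<le> t \<and> C \<in> sets borel}"

definition generated_algebra :: "'a measure \<Rightarrow> ('a \<Rightarrow> real) \<Rightarrow> 'a measure" where
  "generated_algebra M X = vimage_algebra (space M) X borel"

definition cond_variance :: "'a measure \<Rightarrow> 'a measure \<Rightarrow> ('a \<Rightarrow> real) \<Rightarrow> 'a \<Rightarrow> real" where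
  "cond_variance M F X = real_cond_exp M F (\<lambda>\<omega>. (X \<omega> - real_cond_exp M F X \<omega>)\<^sup>2)"

definition process_in :: "'a measure \<Rightarrow> real set \<Rightarrow> (real \<Rightarrow> 'a \<Rightarrow> real) \<Rightarrow> bool" where
  "process_in M E Y \<longleftrightarrow> (\<forall>t. Y t \<in> borel_measurable M \<and> (\<forall>\<omega>\<in>space M. Y t \<omega> \<in> E))"

definition stationary_process :: "'a measure \<Rightarrow> (real \<Rightarrow> 'a \<Rightarrow> real) \<Rightarrow> bool" where
  "stationary_process M Y \<longleftrightarrow> (\<forall>J h. finite J \<longrightarrow>
     distr M (PiM J (\<lambda>_. borel)) (\<lambda>\<omega>. \<lambda>t\<in>J. Y (t + h) \<omega>) =
     distr M (PiM J (\<lambda>_. borel)) (\<lambda>\<omega>. \<lambda>t\<in>J. Y t \<omega>))"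

definition markov_process :: "'a measure \<Rightarrow> (real \<Rightarrow> 'a \<Rightarrow> real) \<Rightarrow> bool" where
  "markov_process M Y \<longleftrightarrow> (\<forall>t s. t < s \<longrightarrow> (\<forall>C\<in>sets borel.
     AE \<omega> in M. real_cond_exp M (natural_filtration M Y (ereal t)) (\<lambda>\<omega>. indicator C (Y s \<omega>)) \<omega> =
                real_cond_exp M (generated_algebra M (Y t)) (\<lambda>\<omega>. indicator C (Y s \<omega>)) \<omega>))"

text \<open>The conditional distribution of \<open>X\<close> given \<open>Z = y\<close> has Lebesgue density \<open>k y\<close>.\<close>

definition has_cond_density ::
    "'a measure \<Rightarrow> ('a \<Rightarrow> real) \<Rightarrow> ('a \<Rightarrow> real) \<Rightarrow> (real \<Rightarrow> real \<Rightarrow> real) \<Rightarrow> bool" where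
  "has_cond_density M X Z k \<longleftrightarrow> (\<forall>C\<in>sets borel.
     AE \<omega> in M. real_cond_exp M (generated_algebra M Z) (\<lambda>\<omega>. indicator C (X \<omega>)) \<omega> =
                (LINT x:C|lborel. k (Z \<omega>) x))"

definition cadlag :: "(real \<Rightarrow> real) \<Rightarrow> bool" where
  "cadlag f \<longleftrightarrow> (\<forall>t. (f \<longlongrightarrow> f t) (at_right t) \<and> (\<exists>l. (f \<longlongrightarrow> l) (at_left t)))"

definition cadlag_modification ::
    "'a measure \<Rightarrow> real set \<Rightarrow> (real \<Rightarrow> 'a \<Rightarrow> real) \<Rightarrow> (real \<Rightarrow> 'a \<Rightarrow> real) \<Rightarrow> bool" where
  "cadlag_modification M E Y Z \<longleftrightarrow> process_in M E Z \<and> (\<forall>t. AE \<omega> in M. Z t \<omega> = Y t \<omega>) \<and>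
     (\<forall>\<omega>\<in>space M. cadlag (\<lambda>t. Z t \<omega>))"

definition markov_with_transition ::
    "'a measure \<Rightarrow> (real \<Rightarrow> 'a \<Rightarrow> real) \<Rightarrow> (real \<Rightarrow> (real \<Rightarrow> real) \<Rightarrow> real \<Rightarrow> real) \<Rightarrow> bool" where
  "markov_with_transition M Y P \<longleftrightarrow> (\<forall>t \<tau>. 0 < \<tau> \<longrightarrow>
     (\<forall>g\<in>borel_measurable borel. bounded (range g) \<longrightarrow>
       (AE \<omega> in M. real_cond_exp M (natural_filtration M Y (ereal t)) (\<lambda>\<omega>. g (Y (t + \<tau>) \<omega>)) \<omega> =
                  P \<tau> g (Y t \<omega>))))"

definition strong_markov ::
    "'a measure \<Rightarrow> (real \<Rightarrow> 'a \<Rightarrow> real) \<Rightarrow> (real \<Rightarrow> (real \<Rightarrow> real) \<Rightarrow> real \<Rightarrow> real) \<Rightarrow> bool" where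
  "strong_markov M Y P \<longleftrightarrow>
     (\<forall>T. stopping_time (natural_filtration M Y) T \<and> (\<forall>\<omega>\<in>space M. T \<omega> \<noteq> -\<infinity>) \<longrightarrow>
       (\<forall>\<tau>>0. \<forall>g\<in>borel_measurable borel. bounded (range g) \<longrightarrow>
         (AE \<omega> in M. T \<omega> < \<infinity> \<longrightarrow>
            real_cond_exp M (filtration.pre_sigma (space M) (natural_filtration M Y) T)
              (\<lambda>\<omega>. if T \<omega> < \<infinity> then g (Y (real_of_ereal (T \<omega>) + \<tau>) \<omega>) else 0) \<omega> =
            P \<tau> g (Y (real_of_ereal (T \<omega>)) \<omega>))))"

definition feller_continuous :: "real set \<Rightarrow> (real \<Rightarrow> (real \<Rightarrow> real) \<Rightarrow> real \<Rightarrow> real) \<Rightarrow> bool" where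
  "feller_continuous E P \<longleftrightarrow>
     (\<forall>\<tau>>0. \<forall>f. continuous_on E f \<longrightarrow> continuous_on E (P \<tau> f))"

definition right_continuous_family ::
    "real set \<Rightarrow> (real \<Rightarrow> (real \<Rightarrow> real) \<Rightarrow> real \<Rightarrow> real) \<Rightarrow> bool" where
  "right_continuous_family E P \<longleftrightarrow>
     (\<forall>f. continuous_on E f \<longrightarrow> ((\<lambda>\<tau>. SUP x\<in>E. \<bar>f x - P \<tau> f x\<bar>) \<longlongrightarrow> 0) (at_right 0))"

text \<open>A conservative Feller semigroup on the continuous functions on a compact set \<open>E\<close>.\<close>

definition feller_semigroup :: "real set \<Rightarrow> (real \<Rightarrow> (real \<Rightarrow> real) \<Rightarrow> real \<Rightarrow> real) \<Rightarrow> bool" where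
  "feller_semigroup E P \<longleftrightarrow>
     feller_continuous E P \<and> right_continuous_family E P \<and>
     (\<forall>\<tau>>0. \<forall>f g a b. continuous_on E f \<and> continuous_on E g \<longrightarrow>
        (\<forall>x\<in>E. P \<tau> (\<lambda>z. a * f z + b * g z) x = a * P \<tau> f x + b * P \<tau> g x)) \<and>
     (\<forall>\<tau>>0. \<forall>f. continuous_on E f \<and> (\<forall>x\<in>E. 0 \<le> f x) \<longrightarrow> (\<forall>x\<in>E. 0 \<le> P \<tau> f x)) \<and>
     (\<forall>\<tau>>0. \<forall>x\<in>E. P \<tau> (\<lambda>_. 1) x = 1) \<and>
     (\<forall>\<sigma>>0. \<forall>\<tau>>0. \<forall>f. continuous_on E f \<longrightarrow> (\<forall>x\<in>E. P \<sigma> (P \<tau> f) x = P (\<sigma> + \<tau>) f x))"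

definition feller_process ::
    "'a measure \<Rightarrow> real set \<Rightarrow> (real \<Rightarrow> 'a \<Rightarrow> real) \<Rightarrow>
     (real \<Rightarrow> (real \<Rightarrow> real) \<Rightarrow> real \<Rightarrow> real) \<Rightarrow> bool" where
  "feller_process M E Y P \<longleftrightarrow>
     process_in M E Y \<and> markov_with_transition M Y P \<and> feller_semigroup E P"

text \<open>The graph of the operator \<open>f \<mapsto> lim (P\<^sup>h f - f) / h\<close>, limit in \<open>L2_space N\<close>.\<close>

definition infinitesimal_operator ::
    "real measure \<Rightarrow> (real \<Rightarrow> (real \<Rightarrow> real) \<Rightarrow> real \<Rightarrow> real) \<Rightarrow>
     ((real \<Rightarrow> real) \<times> (real \<Rightarrow> real)) set" where
  "infinitesimal_operator N P = {(f, g). f \<in> L2_space N \<and>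
     L2_tendsto N (\<lambda>h x. 1 / h * (P h f x - f x)) g (at_right 0)}"


section \<open>The \<open>(\<alpha>, q)\<close>-Ornstein-Uhlenbeck process\<close>

definition transition_op :: "real \<Rightarrow> real \<Rightarrow> real \<Rightarrow> (real \<Rightarrow> real) \<Rightarrow> real \<Rightarrow> real" where
  "transition_op \<alpha> q \<tau> f y = (LINT x:state_space q|lborel. f x * f_CN x y (exp (- \<alpha> * \<tau>)) q)"

definition OU_process :: "'a measure \<Rightarrow> real \<Rightarrow> real \<Rightarrow> (real \<Rightarrow> 'a \<Rightarrow> real) \<Rightarrow> bool" where
  "OU_process M \<alpha> q Y \<longleftrightarrow> prob_space M \<and> process_in M (state_space q) Y \<and>
     stationary_process M Y \<and> markov_process M Y \<and>
     (\<forall>t. distributed M lborel (Y t) (\<lambda>x. ennreal (f_N x q))) \<and>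
     (\<forall>t s. t < s \<longrightarrow>
        has_cond_density M (Y s) (Y t) (\<lambda>y x. f_CN x y (exp (- \<alpha> * (s - t))) q))"

end

theory Submission
  imports Defs
begin

text \<open>
  The functional equation of \<open>\<rho> \<mapsto> \<Sum>n. \<rho>\<^sup>n H\<^sub>n(x) H\<^sub>n(y) / [n]!\<close> under \<open>\<rho> \<mapsto> \<rho> q\<close> gives Mehler's formula: this
  series is \<open>f_CN x y \<rho> q / f_N x q\<close>. It converges uniformly on the state space because the normalised
  \<open>H\<^sub>n\<close> grow at most linearly there. As every conditional density of the process has mass 1, comparing
  powers of \<open>\<rho>\<close> shows that \<open>H\<^sub>n\<close> has mean 0 for \<open>n \<ge> 1\<close>, and the three-term recurrence then yields
  orthogonality; completeness is Weierstrass' theorem. Hence \<open>P\<^sup>\<tau>\<close> is diagonal in the Hermite basis with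
  eigenvalues \<open>exp (- \<alpha> \<tau> n)\<close>, from which the Feller properties and the generator can be read off.
  Since \<open>exp (\<alpha> t) Y\<^sub>t\<close> is a martingale, bounding upcrossings produces a cadlag modification, and for such
  a modification the strong Markov property follows by approximating stopping times from above by
  dyadic ones.
\<close>


section \<open>\<open>q\<close>-Hermite polynomials and the Mehler kernel\<close>

text \<open>No q-integral is ever evaluated. That \<open>f_N\<close> has mass 1 and that the
  polynomials have mean 0 is extracted from the given process, so the analytic lemmas live in
  locales whose assumptions the process discharges later. Conditional laws determine things only
  almost surely, whereas the Feller properties speak of every point of the state space; the
  uniformly convergent Mehler series bridges this gap, since it controls \<open>P \<tau> f\<close>
  at each point. The natural filtration is not completed, so a modification has a filtration of its
  own; the Markov property is therefore kept in an integrated form that survives changes on null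
  sets. Identities are proved only where they are accessible, namely for indicators, on which
  conditional densities are given, or for continuous functions, along which stopping times can be
  approximated. A monotone class argument carries both kinds to bounded Borel functions.\<close>

lemma qint_eq: "q \<noteq> 1 \<Longrightarrow> qint q n = (1 - q ^ n) / (1 - q)"
  by (simp add: qint_def sum_gp_strict)

lemma qint_pos:
  assumes "\<bar>q\<bar> < 1" "0 < n"
  shows "0 < qint q n"
proof -
  have "\<bar>q ^ n\<bar> < 1"
    using assms by (simp add: power_abs power_less_one_iff)
  then show ?thesis
    using assms by (auto simp: qint_eq intro!: divide_pos_pos)
qed

lemma qfact_0 [simp]: "qfact q 0 = 1"
  by (simp add: qfact_def)

lemma qfact_Suc: "qfact q (Suc n) = qint q (Suc n) * qfact q n"
  by (simp add: qfact_def mult.commute)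

lemma qfact_pos: "\<bar>q\<bar> < 1 \<Longrightarrow> 0 < qfact q n"
  by (induction n) (auto simp: qfact_Suc qint_pos)

definition qh :: "real \<Rightarrow> nat \<Rightarrow> real \<Rightarrow> real" where
  "qh q n x = qHermite q n x / sqrt (qfact q n)"

lemma qh_0 [simp]: "qh q 0 x = 1"
  by (simp add: qh_def)

lemma continuous_on_qHermite: "continuous_on A (qHermite q n)"
proof (induction q n "0::real" rule: qHermite.induct)
  case (3 q n)
  then show ?case by (subst qHermite.simps[abs_def]) (intro continuous_intros)
qed (subst qHermite.simps[abs_def], intro continuous_intros)+

lemma continuous_on_qh: "continuous_on A (qh q n)"
  unfolding qh_def[abs_def] divide_inverse
  by (intro continuous_intros continuous_on_qHermite)

lemma qh_recurrence:
  assumes "\<bar>q\<bar> < 1"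
  shows "x * qh q (Suc n) x =
    sqrt (qint q (Suc (Suc n))) * qh q (Suc (Suc n)) x + sqrt (qint q (Suc n)) * qh q n x"
proof -
  have "0 < qint q (Suc n)" "0 < qint q (Suc (Suc n))" "0 < qfact q n"
    using assms by (auto intro: qint_pos qfact_pos)
  then show ?thesis
    by (simp add: qh_def qfact_Suc real_sqrt_mult field_simps)
qed

section \<open>Growth of the normalised polynomials on the state space\<close>

lemma qpoch_finite_lower_bound:
  fixes q :: real
  assumes q: "\<bar>q\<bar> < 1"
  obtains c where "0 < c" "\<And>n. c \<le> (\<Prod>k=1..n. 1 - q ^ k)"
proof -
  define p where "p n = (\<Prod>k\<le>n. 1 - q ^ Suc k)" for n
  have "abs_convergent_prod (\<lambda>k. 1 - q ^ Suc k)"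
    unfolding abs_convergent_prod_conv_summable
    using q by (simp add: abs_mult power_abs)
  then have conv: "convergent_prod (\<lambda>k. 1 - q ^ Suc k)"
    by (rule abs_convergent_prod_imp_convergent_prod)
  have pos: "0 < 1 - q ^ Suc k" for k
  proof -
    have "\<bar>q ^ Suc k\<bar> < 1"
      using q by (simp only: power_abs power_less_one_iff) auto
    then show ?thesis by auto
  qed
  define L where "L = prodinf (\<lambda>k. 1 - q ^ Suc k)"
  have lim: "p \<longlonglongrightarrow> L"
    unfolding p_def L_def by (rule convergent_prod_LIMSEQ[OF conv])
  have "L \<noteq> 0"
    unfolding L_def using pos conv by (intro prodinf_nonzero) (auto simp: less_imp_neq[symmetric])
  have ppos: "0 < p n" for n
    unfolding p_def using pos by (intro prod_pos) auto
  have "0 \<le> L"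
    using lim ppos by (intro LIMSEQ_le_const[OF lim]) (auto intro: less_imp_le)
  with \<open>L \<noteq> 0\<close> have "0 < L" by simp
  then obtain N where N: "\<And>n. n \<ge> N \<Longrightarrow> L / 2 < p n"
    using order_tendstoD(1)[OF lim, of "L/2"] by (auto simp: eventually_sequentially)
  \<comment> \<open>1 covers the empty product, \<open>L / 2\<close> the tail, and the other entries
    the finitely many products before the tail.\<close>
  define c where "c = Min (insert 1 (insert (L/2) (p ` {..N})))"
  have c: "0 < c" "c \<le> 1" "c \<le> L / 2"
    unfolding c_def using ppos \<open>0 < L\<close> by auto
  have c': "c \<le> p n" if "n \<le> N" for n
    unfolding c_def using that by (intro Min_le) auto
  have "c \<le> p n" for n
    using c(3) c'[of n] N[of n] by (cases "n \<le> N") auto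
  moreover have "(\<Prod>k=1..Suc n. 1 - q ^ k) = p n" for n
    unfolding p_def by (rule prod.reindex_bij_witness[of _ Suc "\<lambda>k. k - 1"]) auto
  ultimately have "c \<le> (\<Prod>k=1..n. 1 - q ^ k)" for n
    using c(2) by (cases n) (auto simp del: prod.cl_ivl_Suc)
  with c(1) show ?thesis by (rule that)
qed

text \<open>In this scale the numerators obey a recurrence with the bounded coefficients 1 - q^n,
  and the denominators are bounded below by \<open>qpoch_finite_lower_bound\<close>; hence
  \<open>qh\<close> grows no faster than the numerators.\<close>

lemma qh_normalized:
  assumes q: "\<bar>q\<bar> < 1"
  shows "qh q n x = sqrt (1 - q) ^ n * qHermite q n x / sqrt (\<Prod>k=1..n. 1 - q ^ k)"
proof -
  have "qfact q n = (\<Prod>k=1..n. 1 - q ^ k) / (1 - q) ^ n"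
  proof (induction n)
    case (Suc n)
    have "qint q (Suc n) = (1 - q ^ Suc n) / (1 - q)" using q by (intro qint_eq) auto
    then show ?case using Suc q by (simp add: qfact_Suc mult_ac)
  qed simp
  moreover have "sqrt ((1 - q) ^ n) = sqrt (1 - q) ^ n"
    by (rule real_sqrt_power)
  ultimately show ?thesis
    unfolding qh_def by (simp add: real_sqrt_divide)
qed

text \<open>Writing \<open>x = 2 cos \<theta> / \<surd>(1 - q)\<close>, the rescaled polynomials \<open>a\<^sub>n\<close> satisfy a recurrence that is a
  summable perturbation of the Chebyshev recurrence; factoring the latter through \<open>z = e\<^sup>i\<^sup>\<theta>\<close> gives
  linear growth.\<close>

lemma qh_linear_growth:
  assumes q: "\<bar>q\<bar> < 1"
  obtains C where "0 \<le> C" "\<And>n x. x \<in> state_space q \<Longrightarrow> \<bar>qh q n x\<bar> \<le> C * (real n + 1)"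
proof -
  \<comment> \<open>The factor of index k is the loss in the step to k of the induction below, where
    the perturbation q^k meets the bound k * D (k - 1) on the preceding term. The losses being
    summable, \<open>D\<close> stays bounded.\<close>
  define D where "D n = (\<Prod>k=1..n. 1 + real k * \<bar>q\<bar> ^ k)" for n
  have Dpos: "1 \<le> D n" for n
    unfolding D_def by (intro prod_ge_1) auto
  have D0: "D 0 = 1" and DS: "D (Suc n) = D n * (1 + real (Suc n) * \<bar>q\<bar> ^ Suc n)" for n
    unfolding D_def by auto
  have Dmono: "D n \<le> D (Suc n)" for n
    using Dpos[of n] by (simp add: DS mult_le_cancel_left1 del: of_nat_Suc)
  have summ: "summable (\<lambda>k. real k * \<bar>q\<bar> ^ k)"
  proof -
    have "summable (\<lambda>k. diffs (\<lambda>_. 1) k * \<bar>q\<bar> ^ k)"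
      by (rule termdiff_converges[where K=1]) (use q in \<open>auto intro!: summable_geometric\<close>)
    then have "summable (\<lambda>k. \<bar>q\<bar> * (real (Suc k) * \<bar>q\<bar> ^ k))"
      by (intro summable_mult) (simp add: diffs_def)
    then have "summable (\<lambda>k. real (Suc k) * \<bar>q\<bar> ^ Suc k)"
      by (simp add: mult_ac)
    then show ?thesis
      by (subst (asm) summable_Suc_iff)
  qed
  define E where "E = exp (\<Sum>k. real k * \<bar>q\<bar> ^ k)"
  have DE: "D n \<le> E" for n
  proof -
    have "D n \<le> exp (\<Sum>k=1..n. real k * \<bar>q\<bar> ^ k)"
      unfolding D_def by (rule prod_le_exp_sum) auto
    also have "(\<Sum>k=1..n. real k * \<bar>q\<bar> ^ k) \<le> (\<Sum>k. real k * \<bar>q\<bar> ^ k)"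
      by (intro sum_le_suminf summ) auto
    finally show ?thesis by (simp add: E_def)
  qed
  obtain c where c: "0 < c" "\<And>n. c \<le> (\<Prod>k=1..n. 1 - q ^ k)"
    using qpoch_finite_lower_bound[OF q] by blast
  have bound: "\<bar>sqrt (1 - q) ^ n * qHermite q n x\<bar> \<le> (real n + 1) * E" if x: "x \<in> state_space q" for n x
  proof -
    define u where "u = sqrt (1 - q) * x / 2"
    have s: "0 < sqrt (1 - q)" using q by simp
    have "- 1 \<le> u" "u \<le> 1"
      using x s by (auto simp: u_def state_space_def field_simps)
    then obtain \<theta> where \<theta>: "u = cos \<theta>" by (metis cos_arccos)
    define a where "a n = sqrt (1 - q) ^ n * qHermite q n x" for n
    have a0: "a 0 = 1" and a1: "a (Suc 0) = 2 * u"
      by (auto simp: a_def u_def)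
    have rec: "a (Suc (Suc n)) = 2 * u * a (Suc n) - (1 - q ^ Suc n) * a n" for n
    proof -
      have "sqrt (1 - q) * sqrt (1 - q) = 1 - q" using q by simp
      then have "sqrt (1 - q) ^ Suc (Suc n) * (qint q (Suc n) * qHermite q n x)
          = sqrt (1 - q) ^ n * ((1 - q) * qint q (Suc n)) * qHermite q n x"
        by simp
      also have "(1 - q) * qint q (Suc n) = 1 - q ^ Suc n"
        using q by (subst qint_eq) auto
      finally show ?thesis
        unfolding a_def u_def by (simp add: algebra_simps)
    qed
    define z where "z = cis \<theta>"
    \<comment> \<open>Without the perturbation the recurrence has the characteristic roots
      \<open>z\<close> and \<open>cnj z\<close>. Removing \<open>z\<close> leaves a quantity that is
      merely rotated by \<open>cnj z\<close>; estimating \<open>a\<close> directly from the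
      recurrence would only give exponential growth.\<close>
    define d where "d n = complex_of_real (a (Suc n)) - z * a n" for n
    have z: "norm z = 1" "cnj z * z = 1" "complex_of_real (2 * u) = z + cnj z"
      by (auto simp: z_def \<theta> cis_cnj cis_mult complex_eq_iff)
    have dS: "d (Suc n) = cnj z * d n + q ^ Suc n * a n" for n
    proof -
      have "d (Suc n) = complex_of_real (2 * u) * a (Suc n) - (1 - q ^ Suc n) * a n - z * a (Suc n)"
        unfolding d_def rec by simp
      also have "\<dots> = cnj z * a (Suc n) - (cnj z * z) * a n + q ^ Suc n * a n"
        unfolding z(3) unfolding z(2) by (simp add: algebra_simps)
      finally show ?thesis
        by (simp add: d_def algebra_simps)
    qed
    have "\<bar>a n\<bar> \<le> (real n + 1) * D n \<and> norm (d n) \<le> D n" for n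
    proof (induction n)
      case 0
      have "d 0 = cnj z"
        using z(3) by (simp add: d_def a0 a1)
      then show ?case using z(1) by (simp add: a0 D0)
    next
      case (Suc n)
      have "norm (complex_of_real (a (Suc n))) = norm (d n + z * a n)"
        by (simp add: d_def)
      also have "\<dots> \<le> norm (d n) + \<bar>a n\<bar>"
        by (rule order_trans[OF norm_triangle_ineq]) (simp add: norm_mult z)
      also have "\<dots> \<le> D n + (real n + 1) * D n"
        using Suc by auto
      also have "\<dots> = (real (Suc n) + 1) * D n"
        by (simp add: algebra_simps)
      also have "\<dots> \<le> (real (Suc n) + 1) * D (Suc n)"
        by (intro mult_left_mono Dmono) auto
      finally have 1: "\<bar>a (Suc n)\<bar> \<le> (real (Suc n) + 1) * D (Suc n)" by simp
      have "norm (d (Suc n)) \<le> norm (d n) + \<bar>q\<bar> ^ Suc n * \<bar>a n\<bar>"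
        unfolding dS
        by (rule order_trans[OF norm_triangle_ineq]) (simp add: norm_mult z norm_power)
      also have "\<dots> \<le> D n + \<bar>q\<bar> ^ Suc n * ((real n + 1) * D n)"
        using Suc by (intro add_mono mult_left_mono) auto
      also have "\<dots> = D (Suc n)"
        by (simp add: DS algebra_simps)
      finally show ?case using 1 by simp
    qed
    then have "\<bar>a n\<bar> \<le> (real n + 1) * D n" by blast
    also have "\<dots> \<le> (real n + 1) * E"
      by (intro mult_left_mono DE) auto
    finally show ?thesis by (simp add: a_def)
  qed
  have "0 < E" by (simp add: E_def)
  show ?thesis
  proof (rule that[of "E / sqrt c"])
    fix n x assume "x \<in> state_space q"
    then have "\<bar>qh q n x\<bar> \<le> ((real n + 1) * E) / sqrt c"
      unfolding qh_normalized[OF q] abs_divide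
      using c \<open>0 < E\<close> by (intro frac_le bound) (auto intro!: abs_ge_self order_trans[OF _ abs_ge_self])
    then show "\<bar>qh q n x\<bar> \<le> E / sqrt c * (real n + 1)"
      by (simp add: mult.commute)
  qed (use c \<open>0 < E\<close> in auto)
qed

section \<open>The Mehler series and its functional equation\<close>

definition mehler :: "real \<Rightarrow> real \<Rightarrow> real \<Rightarrow> real \<Rightarrow> real" where
  "mehler q \<rho> x y = (\<Sum>n. \<rho> ^ n * (qh q n x * qh q n y))"

text \<open>The factor of index 0 in the denominator of \<open>f_CN\<close>; the factor of index k
  arises from it by replacing \<rho> with \<open>\<rho> * q ^ k\<close>.\<close>

definition mehler_den :: "real \<Rightarrow> real \<Rightarrow> real \<Rightarrow> real \<Rightarrow> real" where
  "mehler_den q \<rho> x y = (1 - \<rho>\<^sup>2)\<^sup>2 - (1 - q) * \<rho> * (1 + \<rho>\<^sup>2) * x * y + (1 - q) * \<rho>\<^sup>2 * (x\<^sup>2 + y\<^sup>2)"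

text \<open>The second derivative of the geometric series has the coefficients (k + 1) (k + 2);
  subtracting the first derivative, with coefficients k + 1, leaves the square.\<close>

lemma summable_quadratic_geometric:
  fixes r :: real
  assumes "\<bar>r\<bar> < 1"
  shows "summable (\<lambda>n. (real n + 1)\<^sup>2 * r ^ n)"
proof -
  have 1: "summable (\<lambda>k. diffs (\<lambda>_. 1) k * x ^ k)" if "norm x < 1" for x :: real
    by (rule termdiff_converges[where K=1]) (use that in \<open>auto intro!: summable_geometric\<close>)
  have 2: "summable (\<lambda>k. diffs (diffs (\<lambda>_. 1)) k * r ^ k)"
    by (rule termdiff_converges[where K=1]) (use assms 1 in auto)
  have "summable (\<lambda>k. diffs (diffs (\<lambda>_. 1)) k * r ^ k - diffs (\<lambda>_. 1) k * r ^ k)"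
    using 1[of r] 2 assms by (intro summable_diff) auto
  then show ?thesis
    by (simp add: diffs_def algebra_simps power2_eq_square)
qed

text \<open>Two factors of linear growth give the square. The constant depends on none of \<rho>, x
  and y, so the bound can serve as majorant in M-tests.\<close>

lemma mehler_majorant:
  assumes q: "\<bar>q\<bar> < 1"
  obtains C where "0 \<le> C"
    "\<And>n \<rho> x y. x \<in> state_space q \<Longrightarrow> y \<in> state_space q \<Longrightarrow>
        \<bar>\<rho> ^ n * (qh q n x * qh q n y)\<bar> \<le> C * ((real n + 1)\<^sup>2 * \<bar>\<rho>\<bar> ^ n)"
proof -
  obtain C where C: "0 \<le> C" "\<And>n x. x \<in> state_space q \<Longrightarrow> \<bar>qh q n x\<bar> \<le> C * (real n + 1)"
    using qh_linear_growth[OF q] by blast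
  show ?thesis
  proof (rule that[of "C * C"])
    fix n \<rho> x y assume "x \<in> state_space q" "y \<in> state_space q"
    then have "\<bar>qh q n x\<bar> * \<bar>qh q n y\<bar> \<le> (C * (real n + 1)) * (C * (real n + 1))"
      using C by (intro mult_mono) auto
    then have "\<bar>\<rho>\<bar> ^ n * (\<bar>qh q n x\<bar> * \<bar>qh q n y\<bar>) \<le> \<bar>\<rho>\<bar> ^ n * ((C * (real n + 1)) * (C * (real n + 1)))"
      by (intro mult_left_mono) auto
    then show "\<bar>\<rho> ^ n * (qh q n x * qh q n y)\<bar> \<le> C * C * ((real n + 1)\<^sup>2 * \<bar>\<rho>\<bar> ^ n)"
      by (simp add: abs_mult power_abs power2_eq_square mult_ac)
  qed (use C in auto)
qed

lemma summable_mehler: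
  assumes "\<bar>q\<bar> < 1" "\<bar>\<rho>\<bar> < 1" "x \<in> state_space q" "y \<in> state_space q"
  shows "summable (\<lambda>n. \<rho> ^ n * (qh q n x * qh q n y))"
proof -
  obtain C where "\<And>n \<rho> x y. x \<in> state_space q \<Longrightarrow> y \<in> state_space q \<Longrightarrow>
        \<bar>\<rho> ^ n * (qh q n x * qh q n y)\<bar> \<le> C * ((real n + 1)\<^sup>2 * \<bar>\<rho>\<bar> ^ n)"
    using mehler_majorant[OF assms(1)] by metis
  then show ?thesis
    using assms by (intro summable_comparison_test'[OF summable_mult[OF summable_quadratic_geometric[of "\<bar>\<rho>\<bar>"], of C]]) auto
qed

text \<open>Brings monomial multiples of a series back to the powers \<open>\<rho> ^ n\<close>, so
  that combinations of such multiples can be compared coefficient by coefficient.\<close>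

lemma sums_shift_power:
  fixes h :: "nat \<Rightarrow> real"
  assumes "(\<lambda>n. \<rho> ^ n * h n) sums s"
  shows "(\<lambda>n. \<rho> ^ n * (if n < k then 0 else h (n - k))) sums (\<rho> ^ k * s)"
proof -
  have "(\<lambda>n. \<rho> ^ k * (\<rho> ^ n * h n)) sums (\<rho> ^ k * s)"
    by (rule sums_mult[OF assms])
  then have "(\<lambda>n. \<rho> ^ (n + k) * (if n + k < k then 0 else h (n + k - k))) sums (\<rho> ^ k * s)"
    by (simp add: power_add mult_ac)
  then show ?thesis
    by (subst (asm) sums_zero_iff_shift) auto
qed

text \<open>The coefficientwise form of the functional equation
  \<open>mehler_den q \<rho> x y * mehler q \<rho> x y = (1 - \<rho>\<^sup>2) (1 - \<rho>\<^sup>2 q) mehler q (\<rho> q) x y\<close>.\<close>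

lemma qHermite_product_recurrence:
  assumes q: "\<bar>q\<bar> < 1"
  defines "h \<equiv> \<lambda>x y n. qHermite q n x * qHermite q n y / qfact q n"
  defines "s \<equiv> \<lambda>x y k n. if n < k then 0 else h x y (n - k)"
  defines "t \<equiv> \<lambda>x y k n. if n < k then 0 else q ^ (n - k) * h x y (n - k)"
  shows "s x y 0 n - (1 - q) * x * y * (s x y 1 n + s x y 3 n) - (2 - (1 - q) * (x\<^sup>2 + y\<^sup>2)) * s x y 2 n
      + s x y 4 n = t x y 0 n - (1 + q) * t x y 2 n + q * t x y 4 n"
proof -
  have q1: "qint q (Suc n) = 1 + q * qint q n" for n
    unfolding qint_def by (subst sum.lessThan_Suc_shift) (simp add: sum_distrib_left)
  \<comment> \<open>For n < 3 several shifted indices are negative. From 3 on only the shift by 4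
    can still leave the range, namely at m = 0.\<close>
  consider "n = 0" | "n = 1" | "n = 2" | m where "n = m + 3"
  proof -
    have "n = 0 \<or> n = 1 \<or> n = 2 \<or> n = (n - 3) + 3" by arith
    then show ?thesis using that by blast
  qed
  then show ?thesis
  proof cases
    case 3
    have h: "h x y 0 = 1" "h x y 1 = x * y" "h x y 2 = (x * x - 1) * (y * y - 1) * inverse (1 + q)"
      by (auto simp: h_def numeral_2_eq_2 qfact_Suc qint_def divide_inverse)
    have "(1 + q) * inverse (1 + q) = 1" using q by auto
    moreover have "s x y 0 n = h x y 2" "s x y 1 n = h x y 1" "s x y 3 n = 0" "s x y 2 n = h x y 0" "s x y 4 n = 0"
      "t x y 0 n = q\<^sup>2 * h x y 2" "t x y 2 n = h x y 0" "t x y 4 n = 0"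
      using 3 by (auto simp: s_def t_def)
    ultimately show ?thesis
      unfolding h by algebra
  next
    case (4 m)
    define a b c d where "a = qHermite q (Suc m) x" and "b = qHermite q m x"
      and "c = qHermite q (Suc m) y" and "d = qHermite q m y"
    define A B C F where "A = qint q (Suc m)" and "B = qint q (Suc (Suc m))"
      and "C = qint q (Suc (Suc (Suc m)))" and "F = qfact q m"
    have pos: "0 < A" "0 < B" "0 < C" "0 < F"
      using q by (auto simp: A_def B_def C_def F_def qint_pos qfact_pos)
    have "(1 - q) * qint q k = 1 - q ^ k" for k
      using q by (subst qint_eq) auto
    note this[of "Suc m"] this[of "Suc (Suc m)"] this[of "Suc (Suc (Suc m))"]
    \<comment> \<open>The coefficients with which \<open>h\<close> of index m + 3 and m + 1 enter
      once the \<open>t\<close>-terms are moved to the left. Expressed through A, B and C they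
      reduce the claim to polynomial algebra.\<close>
    then have powers: "(1 - q) * C = 1 - q ^ (m + 3)" "(1 - q) * (A + B) = 2 - (1 + q) * q ^ (m + 1)"
      unfolding A_def B_def C_def distrib_left by (auto simp: power3_eq_cube power_add algebra_simps)
    define x2 y2 where "x2 = x * a - A * b" and "y2 = y * c - A * d"
    define x3 y3 where "x3 = x * x2 - B * a" and "y3 = y * y2 - B * c"
    have h: "h x y (m + 3) = x3 * y3 / (C * B * A * F)" "h x y (m + 2) = x2 * y2 / (B * A * F)"
       "h x y (m + 1) = a * c / (A * F)" "h x y m = b * d / F"
      by (auto simp: h_def numeral_3_eq_3 numeral_2_eq_2 qfact_Suc x3_def y3_def x2_def y2_def
          a_def b_def c_def d_def A_def B_def C_def F_def mult_ac)
    \<comment> \<open>\<open>x * b - a\<close> is [m] times the polynomial of index m - 1 and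
      vanishes for m = 0. This form therefore covers the shift by 4 in both cases and never mentions
      the index m - 1.\<close>
    have last: "s x y 4 n - q * t x y 4 n = (1 - q) * ((x * b - a) * (y * d - c) / F)"
    proof (cases m)
      case 0
      then show ?thesis by (simp add: 4 s_def t_def a_def b_def c_def d_def)
    next
      case (Suc k)
      have "0 < qint q (Suc k)" "0 < qfact q k" using q by (auto simp: qint_pos qfact_pos)
      moreover have "x * b - a = qint q (Suc k) * qHermite q k x" "y * d - c = qint q (Suc k) * qHermite q k y"
        by (auto simp: a_def b_def c_def d_def Suc)
      moreover have "1 - q * q ^ k = (1 - q) * qint q (Suc k)"
        using q by (auto simp: qint_eq)
      moreover have "s x y 4 n - q * t x y 4 n = (1 - q * q ^ k) * h x y k"
        by (simp add: 4 s_def t_def Suc algebra_simps)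
      ultimately show ?thesis
        by (simp only: h_def F_def Suc qfact_Suc) simp
    qed
    have main: "x3 * y3 / (B * A) = x * y * (x2 * y2 / (B * A) + b * d)
        + (A + B - x\<^sup>2 - y\<^sup>2) * (a * c / A) - (x * b - a) * (y * d - c)"
    proof -
      have "A * inverse A = 1" "B * inverse B = 1" using pos by auto
      then show ?thesis
        unfolding x3_def y3_def x2_def y2_def divide_inverse inverse_mult_distrib by algebra
    qed
    have "(1 - q) * C * h x y (m + 3) = (1 - q) * ((x3 * y3 / (B * A)) / F)"
      using pos by (simp add: h field_simps)
    also have "\<dots> = (1 - q) * x * y * (h x y (m + 2) + h x y m)
       + ((1 - q) * (A + B) - (1 - q) * (x\<^sup>2 + y\<^sup>2)) * h x y (m + 1) - (1 - q) * ((x * b - a) * (y * d - c) / F)"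
      unfolding main h using pos by (simp add: field_simps)
    finally show ?thesis
      unfolding powers last[symmetric] by (simp add: 4 s_def t_def algebra_simps)
  qed (use q in \<open>simp_all add: s_def t_def h_def qfact_Suc qint_def algebra_simps\<close>)
qed

text \<open>Both polynomial factors are expanded in powers of \<rho>;
  \<open>sums_shift_power\<close> turns every monomial into a shift of coefficients, and what
  remains is \<open>qHermite_product_recurrence\<close> at each index.\<close>

lemma mehler_functional_equation:
  assumes q: "\<bar>q\<bar> < 1" and \<rho>: "\<bar>\<rho>\<bar> < 1" and xy: "x \<in> state_space q" "y \<in> state_space q"
  shows "mehler_den q \<rho> x y * mehler q \<rho> x y = (1 - \<rho>\<^sup>2) * (1 - \<rho>\<^sup>2 * q) * mehler q (\<rho> * q) x y"
proof -
  define h where "h n = qHermite q n x * qHermite q n y / qfact q n" for n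
  have h: "qh q n x * qh q n y = h n" for n
    using qfact_pos[OF q, of n] by (simp add: qh_def h_def)
  have \<rho>q: "\<bar>\<rho> * q\<bar> < 1"
    using abs_mult_less[OF \<rho> q] by (simp add: abs_mult)
  define G G' where "G = mehler q \<rho> x y" and "G' = mehler q (\<rho> * q) x y"
  have G: "(\<lambda>n. \<rho> ^ n * h n) sums G"
    using summable_mehler[OF q \<rho> xy] unfolding G_def mehler_def h by (rule summable_sums)
  have G': "(\<lambda>n. \<rho> ^ n * (q ^ n * h n)) sums G'"
    using summable_mehler[OF q \<rho>q xy, THEN summable_sums]
    unfolding G'_def mehler_def h by (simp add: power_mult_distrib mult_ac)
  define s t where "s k n = (if n < k then 0 else h (n - k))"
    and "t k n = (if n < k then 0 else q ^ (n - k) * h (n - k))" for k n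
  have s: "(\<lambda>n. \<rho> ^ n * s k n) sums (\<rho> ^ k * G)" for k
    unfolding s_def by (rule sums_shift_power[OF G])
  have t: "(\<lambda>n. \<rho> ^ n * t k n) sums (\<rho> ^ k * G')" for k
    unfolding t_def by (rule sums_shift_power[OF G'])
  have "(\<lambda>n. \<rho> ^ n * s 0 n - (1 - q) * x * y * (\<rho> ^ n * s 1 n + \<rho> ^ n * s 3 n)
      - (2 - (1 - q) * (x\<^sup>2 + y\<^sup>2)) * (\<rho> ^ n * s 2 n) + \<rho> ^ n * s 4 n)
    sums (\<rho> ^ 0 * G - (1 - q) * x * y * (\<rho> ^ 1 * G + \<rho> ^ 3 * G)
      - (2 - (1 - q) * (x\<^sup>2 + y\<^sup>2)) * (\<rho> ^ 2 * G) + \<rho> ^ 4 * G)"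
    by (intro sums_add sums_diff sums_mult s)
  moreover have "(\<lambda>n. \<rho> ^ n * t 0 n - (1 + q) * (\<rho> ^ n * t 2 n) + q * (\<rho> ^ n * t 4 n))
    sums (\<rho> ^ 0 * G' - (1 + q) * (\<rho> ^ 2 * G') + q * (\<rho> ^ 4 * G'))"
    by (intro sums_add sums_diff sums_mult t)
  moreover have "\<rho> ^ n * s 0 n - (1 - q) * x * y * (\<rho> ^ n * s 1 n + \<rho> ^ n * s 3 n)
      - (2 - (1 - q) * (x\<^sup>2 + y\<^sup>2)) * (\<rho> ^ n * s 2 n) + \<rho> ^ n * s 4 n
    = \<rho> ^ n * t 0 n - (1 + q) * (\<rho> ^ n * t 2 n) + q * (\<rho> ^ n * t 4 n)" for n
  proof -
    have "\<rho> ^ n * (s 0 n - (1 - q) * x * y * (s 1 n + s 3 n) - (2 - (1 - q) * (x\<^sup>2 + y\<^sup>2)) * s 2 n + s 4 n)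
      = \<rho> ^ n * (t 0 n - (1 + q) * t 2 n + q * t 4 n)"
      unfolding s_def t_def h_def by (subst qHermite_product_recurrence[OF q]) simp
    then show ?thesis by (simp add: algebra_simps)
  qed
  ultimately have eq: "\<rho> ^ 0 * G - (1 - q) * x * y * (\<rho> ^ 1 * G + \<rho> ^ 3 * G)
      - (2 - (1 - q) * (x\<^sup>2 + y\<^sup>2)) * (\<rho> ^ 2 * G) + \<rho> ^ 4 * G
      = \<rho> ^ 0 * G' - (1 + q) * (\<rho> ^ 2 * G') + q * (\<rho> ^ 4 * G')"
    by (simp add: sums_unique2)
  have "mehler_den q \<rho> x y * G = \<rho> ^ 0 * G - (1 - q) * x * y * (\<rho> ^ 1 * G + \<rho> ^ 3 * G)
      - (2 - (1 - q) * (x\<^sup>2 + y\<^sup>2)) * (\<rho> ^ 2 * G) + \<rho> ^ 4 * G"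
    unfolding mehler_den_def by algebra
  also have "\<dots> = (1 - \<rho>\<^sup>2) * (1 - \<rho>\<^sup>2 * q) * G'"
    unfolding eq by algebra
  finally show ?thesis
    by (simp add: G_def G'_def)
qed

section \<open>Mehler's product formula and the factorisation of the conditional density\<close>

lemma mehler_den_pos:
  assumes q: "\<bar>q\<bar> < 1" and \<rho>: "\<bar>\<rho>\<bar> < 1" and xy: "x \<in> state_space q" "y \<in> state_space q"
  shows "0 < mehler_den q \<rho> x y"
proof -
  have *: "\<exists>\<theta>. sqrt (1 - q) * x = 2 * cos \<theta>" if "x \<in> state_space q" for x
  proof -
    have s: "0 < sqrt (1 - q)" using q by simp
    have "- 1 \<le> sqrt (1 - q) * x / 2" "sqrt (1 - q) * x / 2 \<le> 1"
      using that s by (auto simp: state_space_def field_simps)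
    then show ?thesis
      by (intro exI[of _ "arccos (sqrt (1 - q) * x / 2)"]) simp
  qed
  obtain \<theta> \<phi> where \<theta>: "sqrt (1 - q) * x = 2 * cos \<theta>" and \<phi>: "sqrt (1 - q) * y = 2 * cos \<phi>"
    using *[OF xy(1)] *[OF xy(2)] by blast
  have sq: "sqrt (1 - q) * sqrt (1 - q) = 1 - q" using q by simp
  have e: "(1 - q) * x * y = 4 * cos \<theta> * cos \<phi>" "(1 - q) * x\<^sup>2 = 4 * (cos \<theta>)\<^sup>2" "(1 - q) * y\<^sup>2 = 4 * (cos \<phi>)\<^sup>2"
    using \<theta> \<phi> sq by algebra+
  \<comment> \<open>\<open>f (cos t)\<close> is the squared modulus of 1 - \<rho> e^(it), hence at
    least (1 - |\<rho>|)^2. In the angles of x and y, \<open>mehler_den\<close> is the product of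
    these moduli at t = \<theta> + \<phi> and t = \<theta> - \<phi>.\<close>
  define f where "f c = 1 - 2 * \<rho> * c + \<rho>\<^sup>2" for c :: real
  have fpos: "0 < f (cos t)" for t
  proof -
    have "\<rho> * cos t \<le> \<bar>\<rho>\<bar> * 1"
      by (rule order_trans[OF abs_ge_self]) (auto simp: abs_mult intro!: mult_left_le)
    then have "1 - 2 * \<bar>\<rho>\<bar> + \<rho>\<^sup>2 \<le> f (cos t)" unfolding f_def by simp
    moreover have "1 - 2 * \<bar>\<rho>\<bar> + \<rho>\<^sup>2 = (1 - \<bar>\<rho>\<bar>)\<^sup>2" by (simp add: power2_diff)
    moreover have "0 < (1 - \<bar>\<rho>\<bar>)\<^sup>2" using \<rho> by simp
    ultimately show ?thesis by linarith
  qed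
  have "cos (\<theta> + \<phi>) * cos (\<theta> - \<phi>) = (cos \<theta>)\<^sup>2 + (cos \<phi>)\<^sup>2 - 1"
    using sin_cos_squared_add[of \<theta>] sin_cos_squared_add[of \<phi>]
    unfolding cos_add cos_diff by algebra
  moreover have "cos (\<theta> + \<phi>) + cos (\<theta> - \<phi>) = 2 * cos \<theta> * cos \<phi>"
    by (simp add: cos_add cos_diff)
  moreover have "f u * f v = (1 + \<rho>\<^sup>2)\<^sup>2 - 2 * \<rho> * (1 + \<rho>\<^sup>2) * (u + v) + 4 * \<rho>\<^sup>2 * (u * v)" for u v
    unfolding f_def by algebra
  ultimately have "f (cos (\<theta> + \<phi>)) * f (cos (\<theta> - \<phi>)) =
      (1 + \<rho>\<^sup>2)\<^sup>2 - 2 * \<rho> * (1 + \<rho>\<^sup>2) * (2 * cos \<theta> * cos \<phi>) + 4 * \<rho>\<^sup>2 * ((cos \<theta>)\<^sup>2 + (cos \<phi>)\<^sup>2 - 1)"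
    by simp
  also have "\<dots> = (1 - \<rho>\<^sup>2)\<^sup>2 - \<rho> * (1 + \<rho>\<^sup>2) * ((1 - q) * x * y) + \<rho>\<^sup>2 * ((1 - q) * x\<^sup>2 + (1 - q) * y\<^sup>2)"
    unfolding e by algebra
  also have "\<dots> = mehler_den q \<rho> x y"
    unfolding mehler_den_def by algebra
  finally show ?thesis using fpos[of "\<theta> + \<phi>"] fpos[of "\<theta> - \<phi>"] by (metis mult_pos_pos)
qed

text \<open>Iterating the functional equation N times peels off N denominators and leaves the series
  at \<open>\<rho> * q ^ N\<close>, which tends to its value 1 at \<rho> = 0.\<close>

lemma mehler_limit:
  assumes q: "\<bar>q\<bar> < 1" and \<rho>: "\<bar>\<rho>\<bar> < 1" and xy: "x \<in> state_space q" "y \<in> state_space q"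
  shows "(\<lambda>N. (\<Prod>i<2 * N. 1 - \<rho>\<^sup>2 * q ^ i) / (\<Prod>k<N. mehler_den q (\<rho> * q ^ k) x y)) \<longlonglongrightarrow> mehler q \<rho> x y"
proof -
  let ?P = "\<lambda>N. \<Prod>i<2 * N. 1 - \<rho>\<^sup>2 * q ^ i" and ?W = "\<lambda>N. \<Prod>k<N. mehler_den q (\<rho> * q ^ k) x y"
  have r: "\<bar>\<rho> * q ^ k\<bar> < 1" for k
  proof -
    have "\<bar>\<rho> * q ^ k\<bar> \<le> \<bar>\<rho>\<bar> * 1"
      unfolding abs_mult power_abs using q by (intro mult_left_mono power_le_one) auto
    with \<rho> show ?thesis by linarith
  qed
  have den: "0 < mehler_den q (\<rho> * q ^ k) x y" for k
    by (rule mehler_den_pos[OF q r xy])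
  have step: "mehler q \<rho> x y = ?P N / ?W N * mehler q (\<rho> * q ^ N) x y" for N
  proof (induction N)
    case (Suc N)
    have "mehler q (\<rho> * q ^ N) x y = (1 - (\<rho> * q ^ N)\<^sup>2) * (1 - (\<rho> * q ^ N)\<^sup>2 * q)
        * mehler q (\<rho> * q ^ N * q) x y / mehler_den q (\<rho> * q ^ N) x y"
      using mehler_functional_equation[OF q r xy, of N] den[of N] by (simp add: field_simps)
    \<comment> \<open>One iteration contributes the factors of index 2 N and 2 N + 1; hence the
      numerator runs up to \<open>2 * N\<close>.\<close>
    also have "\<dots> = (1 - \<rho>\<^sup>2 * q ^ (2 * N)) * (1 - \<rho>\<^sup>2 * q ^ Suc (2 * N))
        * mehler q (\<rho> * q ^ Suc N) x y / mehler_den q (\<rho> * q ^ N) x y"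
      by (simp add: power_mult_distrib power_mult[symmetric] mult_ac)
    finally show ?case
      using Suc by (simp add: mult_ac)
  qed simp
  have "(\<lambda>N. \<rho> * q ^ N) \<longlonglongrightarrow> \<rho> * 0"
    using q by (intro tendsto_mult tendsto_const LIMSEQ_power_zero) auto
  moreover have "isCont (\<lambda>r. mehler q r x y) 0"
  proof -
    have "summable (\<lambda>n. (qh q n x * qh q n y) * (1 / 2) ^ n)"
      using summable_mehler[OF q _ xy, of "1/2"] by (simp add: mult_ac)
    then have "isCont (\<lambda>r. \<Sum>n. (qh q n x * qh q n y) * r ^ n) (0::real)"
      by (rule isCont_powser) simp
    then show ?thesis by (simp add: mehler_def mult_ac)
  qed
  ultimately have "(\<lambda>N. mehler q (\<rho> * q ^ N) x y) \<longlonglongrightarrow> mehler q 0 x y"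
    by (intro isCont_tendsto_compose[where g="\<lambda>r. mehler q r x y"]) simp_all
  moreover have "mehler q 0 x y = 1"
    using powser_zero[of "\<lambda>n. qh q n x * qh q n y"] by (simp add: mehler_def mult_ac)
  \<comment> \<open>The remaining series is known to be nonzero only for large N, which is enough to
    divide by it in the limit.\<close>
  ultimately have lim: "(\<lambda>N. mehler q \<rho> x y / mehler q (\<rho> * q ^ N) x y) \<longlonglongrightarrow> mehler q \<rho> x y / 1"
    and ev: "\<forall>\<^sub>F N in sequentially. 0 < mehler q (\<rho> * q ^ N) x y"
    using tendsto_divide[OF tendsto_const[of "mehler q \<rho> x y"], of "\<lambda>N. mehler q (\<rho> * q ^ N) x y" 1]
    by (auto intro: order_tendstoD(1)[where a=0])
  show ?thesis
    using lim unfolding div_by_1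
  proof (rule Lim_transform_eventually)
    show "\<forall>\<^sub>F N in sequentially. mehler q \<rho> x y / mehler q (\<rho> * q ^ N) x y = ?P N / ?W N"
      using ev
    proof eventually_elim
      case (elim N)
      then show ?case by (subst step[of N]) simp
    qed
  qed
qed

text \<open>Invisible in the series, whose terms have varying sign; it comes from the quotients in
  \<open>mehler_limit\<close>, all of whose factors are nonnegative. Positivity of the transition
  operators rests on it.\<close>

lemma mehler_nonneg:
  assumes q: "\<bar>q\<bar> < 1" and \<rho>: "\<bar>\<rho>\<bar> < 1" and xy: "x \<in> state_space q" "y \<in> state_space q"
  shows "0 \<le> mehler q \<rho> x y"
proof (rule LIMSEQ_le_const[OF mehler_limit[OF assms]], intro exI[of _ 0] allI impI divide_nonneg_nonneg prod_nonneg)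
  fix k
  have "\<bar>q ^ k\<bar> \<le> 1" "\<rho>\<^sup>2 \<le> 1"
    using q \<rho> by (auto simp: power_abs power_le_one abs_square_le_1)
  then have "\<rho>\<^sup>2 * \<bar>q ^ k\<bar> \<le> 1"
    by (intro mult_le_one) auto
  moreover have "\<rho>\<^sup>2 * q ^ k \<le> \<rho>\<^sup>2 * \<bar>q ^ k\<bar>"
    by (intro mult_left_mono) auto
  ultimately show "0 \<le> 1 - \<rho>\<^sup>2 * q ^ k" by linarith
  have "\<bar>\<rho> * q ^ k\<bar> \<le> \<bar>\<rho>\<bar> * 1"
    unfolding abs_mult using \<open>\<bar>q ^ k\<bar> \<le> 1\<close> by (intro mult_left_mono) auto
  then show "0 \<le> mehler_den q (\<rho> * q ^ k) x y"
    using \<rho> by (intro less_imp_le mehler_den_pos[OF q _ xy]) linarith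
qed

lemma convergent_prod_geometric:
  fixes a :: "nat \<Rightarrow> real"
  assumes q: "\<bar>q\<bar> < 1" and a: "\<And>k. \<bar>a k - 1\<bar> \<le> C * \<bar>q\<bar> ^ k"
  shows "convergent_prod a"
proof (rule abs_convergent_prod_imp_convergent_prod)
  show "abs_convergent_prod a"
    unfolding abs_convergent_prod_conv_summable
    using q a by (intro summable_comparison_test'[OF summable_mult[OF summable_geometric[of "\<bar>q\<bar>"], of C]]) auto
qed

lemma qpoch_LIMSEQ:
  assumes q: "\<bar>q\<bar> < 1"
  shows "(\<lambda>n. \<Prod>i<n. 1 - a * q ^ i) \<longlonglongrightarrow> qpoch a q"
proof -
  have "convergent_prod (\<lambda>i. 1 - a * q ^ i)"
    by (rule convergent_prod_geometric[OF q, of _ "\<bar>a\<bar>"]) (simp add: abs_mult power_abs)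
  then have "(\<lambda>n. \<Prod>i\<le>n. 1 - a * q ^ i) \<longlonglongrightarrow> qpoch a q"
    unfolding qpoch_def by (rule convergent_prod_LIMSEQ)
  then have "(\<lambda>n. \<Prod>i<Suc n. 1 - a * q ^ i) \<longlonglongrightarrow> qpoch a q"
    by (simp add: lessThan_Suc_atMost)
  then show ?thesis
    by (subst (asm) filterlim_sequentially_Suc)
qed

text \<open>\<open>mehler_den q r x y - 1\<close> is divisible by r, so the factor of index k
  differs from 1 by at most a constant times |q|^k. No restriction on x and y is involved.\<close>

lemma convergent_prod_mehler_den:
  assumes q: "\<bar>q\<bar> < 1" and \<rho>: "\<bar>\<rho>\<bar> < 1"
  shows "convergent_prod (\<lambda>k. mehler_den q (\<rho> * q ^ k) x y)"
proof (rule convergent_prod_geometric[OF q])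
  fix k
  define r where "r = \<rho> * q ^ k"
  have r: "\<bar>r\<bar> \<le> \<bar>q\<bar> ^ k"
    unfolding r_def abs_mult power_abs using \<rho> by (intro mult_left_le_one_le) auto
  also have "\<bar>q\<bar> ^ k \<le> 1" using q by (intro power_le_one) auto
  finally have r1: "\<bar>r\<bar> \<le> 1" .
  define C where "C = 3 + 2 * \<bar>(1 - q) * x * y\<bar> + \<bar>(1 - q) * (x\<^sup>2 + y\<^sup>2)\<bar>"
  have rr: "\<bar>r\<^sup>2\<bar> \<le> 1" "\<bar>r ^ 3\<bar> \<le> 1"
    using power_le_one[OF abs_ge_zero r1, of 2] power_le_one[OF abs_ge_zero r1, of 3]
    by (simp_all add: power_abs)
  have "mehler_den q r x y - 1 = r * (- 2 * r + r ^ 3 - (1 + r\<^sup>2) * ((1 - q) * x * y) + r * ((1 - q) * (x\<^sup>2 + y\<^sup>2)))"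
    unfolding mehler_den_def by algebra
  also have "\<bar>\<dots>\<bar> \<le> \<bar>r\<bar> * C"
  proof -
    have "\<bar>- 2 * r + r ^ 3 - (1 + r\<^sup>2) * ((1 - q) * x * y) + r * ((1 - q) * (x\<^sup>2 + y\<^sup>2))\<bar>
      \<le> 2 * \<bar>r\<bar> + \<bar>r ^ 3\<bar> + \<bar>(1 + r\<^sup>2) * ((1 - q) * x * y)\<bar> + \<bar>r * ((1 - q) * (x\<^sup>2 + y\<^sup>2))\<bar>"
      by linarith
    also have "\<bar>(1 + r\<^sup>2) * ((1 - q) * x * y)\<bar> \<le> 2 * \<bar>(1 - q) * x * y\<bar>"
      unfolding abs_mult[of "1 + r\<^sup>2"] using rr by (intro mult_right_mono) auto
    also have "\<bar>r * ((1 - q) * (x\<^sup>2 + y\<^sup>2))\<bar> \<le> 1 * \<bar>(1 - q) * (x\<^sup>2 + y\<^sup>2)\<bar>"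
      unfolding abs_mult[of r] using r1 by (intro mult_right_mono) auto
    finally show ?thesis
      unfolding abs_mult[of r] C_def using r1 rr by (intro mult_left_mono) auto
  qed
  also have "\<dots> \<le> \<bar>q\<bar> ^ k * C"
    using r by (intro mult_right_mono) (auto simp: C_def)
  finally show "\<bar>mehler_den q (\<rho> * q ^ k) x y - 1\<bar> \<le> C * \<bar>q\<bar> ^ k"
    by (simp add: r_def mult.commute)
qed

lemma mehler_product:
  assumes q: "\<bar>q\<bar> < 1" and \<rho>: "\<bar>\<rho>\<bar> < 1" and xy: "x \<in> state_space q" "y \<in> state_space q"
  shows "mehler q \<rho> x y = qpoch (\<rho>\<^sup>2) q / (\<Prod>k. mehler_den q (\<rho> * q ^ k) x y)"
proof (rule LIMSEQ_unique[OF mehler_limit[OF assms]])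
  let ?d = "\<lambda>k. mehler_den q (\<rho> * q ^ k) x y"
  have r: "\<bar>\<rho> * q ^ k\<bar> < 1" for k
  proof -
    have "\<bar>\<rho> * q ^ k\<bar> \<le> \<bar>\<rho>\<bar> * 1"
      unfolding abs_mult power_abs using q by (intro mult_left_mono power_le_one) auto
    with \<rho> show ?thesis by linarith
  qed
  have nz: "?d k \<noteq> 0" for k
    using mehler_den_pos[OF q r xy, of k] by simp
  have "(\<lambda>n. \<Prod>k\<le>n. ?d k) \<longlonglongrightarrow> prodinf ?d"
    by (rule convergent_prod_LIMSEQ[OF convergent_prod_mehler_den[OF q \<rho>]])
  then have "(\<lambda>n. \<Prod>k<Suc n. ?d k) \<longlonglongrightarrow> prodinf ?d"
    by (simp add: lessThan_Suc_atMost)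
  then have W: "(\<lambda>n. \<Prod>k<n. ?d k) \<longlonglongrightarrow> prodinf ?d"
    by (subst (asm) filterlim_sequentially_Suc)
  have "(\<lambda>N. \<Prod>i<2 * N. 1 - \<rho>\<^sup>2 * q ^ i) \<longlonglongrightarrow> qpoch (\<rho>\<^sup>2) q"
    by (rule filterlim_compose[OF qpoch_LIMSEQ[OF q]])
      (auto intro!: filterlim_subseq simp: strict_mono_def)
  moreover have "prodinf ?d \<noteq> 0"
    by (rule prodinf_nonzero[OF convergent_prod_mehler_den[OF q \<rho>] nz])
  ultimately show "(\<lambda>N. (\<Prod>i<2 * N. 1 - \<rho>\<^sup>2 * q ^ i) / (\<Prod>k<N. ?d k)) \<longlonglongrightarrow> qpoch (\<rho>\<^sup>2) q / prodinf ?d"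
    by (intro tendsto_divide W)
qed

lemma convergent_prod_f_N:
  fixes q x :: real
  assumes q: "\<bar>q\<bar> < 1"
  shows "convergent_prod (\<lambda>k. (1 + q ^ k)\<^sup>2 - (1 - q) * x\<^sup>2 * q ^ k)"
proof (rule convergent_prod_geometric[OF q])
  fix k
  have "\<bar>q ^ k\<bar> \<le> 1" using q by (simp add: power_abs power_le_one)
  have "(1 + q ^ k)\<^sup>2 - (1 - q) * x\<^sup>2 * q ^ k - 1 = q ^ k * (2 + q ^ k - (1 - q) * x\<^sup>2)"
    by algebra
  also have "\<bar>\<dots>\<bar> \<le> \<bar>q ^ k\<bar> * (3 + \<bar>(1 - q) * x\<^sup>2\<bar>)"
    unfolding abs_mult[of "q ^ k"] using \<open>\<bar>q ^ k\<bar> \<le> 1\<close> by (intro mult_left_mono) auto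
  finally show "\<bar>(1 + q ^ k)\<^sup>2 - (1 - q) * x\<^sup>2 * q ^ k - 1\<bar> \<le> (3 + \<bar>(1 - q) * x\<^sup>2\<bar>) * \<bar>q\<bar> ^ k"
    by (simp add: power_abs mult.commute)
qed

text \<open>The numerators with the common prefactor make up \<open>f_N\<close>; the denominators
  with \<open>qpoch (\<rho>\<^sup>2) q\<close> make up Mehler's product. The series is thus the
  density of the conditional law relative to the stationary one.\<close>

lemma f_CN_eq_f_N_mehler:
  assumes q: "\<bar>q\<bar> < 1" and \<rho>: "\<bar>\<rho>\<bar> < 1" and xy: "x \<in> state_space q" "y \<in> state_space q"
  shows "f_CN x y \<rho> q = f_N x q * mehler q \<rho> x y"
proof -
  let ?n = "\<lambda>k. (1 + q ^ k)\<^sup>2 - (1 - q) * x\<^sup>2 * q ^ k"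
  let ?d = "\<lambda>k. (1 - \<rho>\<^sup>2 * q ^ (2 * k))\<^sup>2 - (1 - q) * \<rho> * q ^ k * (1 + \<rho>\<^sup>2 * q ^ (2 * k)) * x * y
             + (1 - q) * \<rho>\<^sup>2 * (x\<^sup>2 + y\<^sup>2) * q ^ (2 * k)"
  have d: "?d k = mehler_den q (\<rho> * q ^ k) x y" for k
    unfolding mehler_den_def by (simp add: power_mult_distrib power_mult[symmetric] mult_ac)
  have "(\<Prod>k. ?n k / ?d k) = prodinf ?n / (\<Prod>k. mehler_den q (\<rho> * q ^ k) x y)"
    unfolding d
    by (rule prodinf_divide[symmetric, OF convergent_prod_f_N[OF q] convergent_prod_mehler_den[OF q \<rho>]])
  then show ?thesis
    unfolding f_CN_def f_N_def mehler_product[OF assms] by simp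
qed

lemma qpoch_nonneg:
  assumes q: "\<bar>q\<bar> < 1" and a: "\<bar>a\<bar> \<le> 1"
  shows "0 \<le> qpoch a q"
proof (rule LIMSEQ_le_const[OF qpoch_LIMSEQ[OF q]], intro exI[of _ 0] allI impI prod_nonneg)
  fix k
  have "\<bar>a * q ^ k\<bar> \<le> 1 * 1"
    unfolding abs_mult power_abs using q a by (intro mult_mono power_le_one) auto
  then show "0 \<le> 1 - a * q ^ k" by linarith
qed

text \<open>Since (1 - q) x^2 \<le> 4 on the state space, a factor with q^k \<ge> 0 is at least (1 -
  q^k)^2. For negative q the odd powers are negative, and then the subtracted term is
  nonpositive.\<close>

lemma f_N_nonneg:
  assumes q: "\<bar>q\<bar> < 1"
  shows "0 \<le> f_N x q"
proof (cases "x \<in> state_space q")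
  case True
  have s: "0 < sqrt (1 - q)" using q by simp
  have "- 2 \<le> sqrt (1 - q) * x" "sqrt (1 - q) * x \<le> 2"
    using True s by (auto simp: state_space_def field_simps)
  then have "(sqrt (1 - q) * x)\<^sup>2 \<le> 2\<^sup>2"
    by (intro abs_le_square_iff[THEN iffD1]) auto
  then have x: "(1 - q) * x\<^sup>2 \<le> 4"
    using q by (simp add: power_mult_distrib)
  have "0 \<le> (1 + q ^ k)\<^sup>2 - (1 - q) * x\<^sup>2 * q ^ k" for k
  proof (cases "0 \<le> q ^ k")
    case True
    have "(1 - q) * x\<^sup>2 * q ^ k \<le> 4 * q ^ k"
      by (rule mult_right_mono[OF x True])
    also have "\<dots> \<le> (1 + q ^ k)\<^sup>2"
      using zero_le_power2[of "1 - q ^ k"] by (simp add: power2_eq_square algebra_simps)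
    finally show ?thesis by simp
  next
    case False
    then have "(1 - q) * x\<^sup>2 * q ^ k \<le> 0"
      using q by (intro mult_nonneg_nonpos) auto
    then show ?thesis using zero_le_power2[of "1 + q ^ k"] by linarith
  qed
  then have "0 \<le> (\<Prod>k. (1 + q ^ k)\<^sup>2 - (1 - q) * x\<^sup>2 * q ^ k)"
    by (intro has_prod_nonneg[OF convergent_prod_has_prod[OF convergent_prod_f_N[OF q]]]) auto
  moreover have "0 \<le> qpoch q q" using q by (intro qpoch_nonneg) auto
  ultimately show ?thesis
    using x q unfolding f_N_def by (auto intro!: mult_nonneg_nonneg divide_nonneg_nonneg)
qed (simp add: f_N_def)


section \<open>Square-integrable functions and orthonormal bases\<close>

lemma L2_spaceD:
  assumes "f \<in> L2_space M"
  shows "f \<in> borel_measurable M" "integrable M (\<lambda>x. (f x)\<^sup>2)"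
  using assms by (auto simp: L2_space_def)

lemma L2_space_mult_integrable:
  assumes f: "f \<in> L2_space M" and g: "g \<in> L2_space M"
  shows "integrable M (\<lambda>x. f x * g x)"
proof (rule Bochner_Integration.integrable_bound)
  show "integrable M (\<lambda>x. (f x)\<^sup>2 + (g x)\<^sup>2)"
    using f g by (auto dest: L2_spaceD)
  show "(\<lambda>x. f x * g x) \<in> borel_measurable M"
    using L2_spaceD(1)[OF f] L2_spaceD(1)[OF g] by measurable
  have "\<bar>a * b\<bar> \<le> a\<^sup>2 + b\<^sup>2" for a b :: real
    using sum_squares_bound[of "\<bar>a\<bar>" "\<bar>b\<bar>"] mult_nonneg_nonneg[of "\<bar>a\<bar>" "\<bar>b\<bar>"]
    by (simp add: abs_mult del: mult_nonneg_nonneg)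
  then show "AE x in M. norm (f x * g x) \<le> norm ((f x)\<^sup>2 + (g x)\<^sup>2)"
    by auto
qed

lemma L2_space_scale: "f \<in> L2_space M \<Longrightarrow> (\<lambda>x. c * f x) \<in> L2_space M"
  by (auto simp: L2_space_def power_mult_distrib)

lemma L2_space_add:
  assumes "f \<in> L2_space M" "g \<in> L2_space M"
  shows "(\<lambda>x. f x + g x) \<in> L2_space M"
  using L2_space_mult_integrable[OF assms] assms
  by (auto simp: L2_space_def power2_sum mult.assoc)

lemma L2_space_diff:
  assumes "f \<in> L2_space M" "g \<in> L2_space M"
  shows "(\<lambda>x. f x - g x) \<in> L2_space M"
  using L2_space_add[OF assms(1) L2_space_scale[OF assms(2), of "- 1"]] by simp

lemma L2_space_sum:
  assumes "\<And>i. i \<in> I \<Longrightarrow> f i \<in> L2_space M"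
  shows "(\<lambda>x. \<Sum>i\<in>I. f i x) \<in> L2_space M"
  using assms
proof (induction I rule: infinite_finite_induct)
  case (insert i I)
  then show ?case by (simp add: L2_space_add)
qed (auto simp: L2_space_def)

lemma (in prob_space) bounded_imp_L2_space:
  assumes "f \<in> borel_measurable M" "\<And>x. x \<in> space M \<Longrightarrow> \<bar>f x\<bar> \<le> C"
  shows "f \<in> L2_space M"
proof -
  have "(f x)\<^sup>2 \<le> C\<^sup>2" if "x \<in> space M" for x
    using assms(2)[OF that] power_mono[of "\<bar>f x\<bar>" C 2] by simp
  then show ?thesis
    using assms(1) unfolding L2_space_def
    by (auto intro!: integrable_const_bound[where B="C\<^sup>2"])
qed

lemma (in prob_space) L2_space_integrable:
  assumes "f \<in> L2_space M" shows "integrable M f"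
  using L2_space_mult_integrable[OF assms bounded_imp_L2_space[of "\<lambda>_. 1" 1]] by simp

text \<open>Cauchy-Schwarz against the constant 1, obtained from the nonnegativity of the variance
  of |f|.\<close>

lemma (in prob_space) integral_abs_le_L2:
  assumes f: "f \<in> L2_space M"
  shows "(\<integral>x. \<bar>f x\<bar> \<partial>M) \<le> sqrt (\<integral>x. (f x)\<^sup>2 \<partial>M)"
proof (rule real_le_rsqrt)
  have "(\<lambda>x. \<bar>f x\<bar>) \<in> L2_space M" using f by (auto simp: L2_space_def)
  then have "integrable M (\<lambda>x. \<bar>f x\<bar>)" by (rule L2_space_integrable)
  then have "variance (\<lambda>x. \<bar>f x\<bar>) = (\<integral>x. \<bar>f x\<bar>\<^sup>2 \<partial>M) - (\<integral>x. \<bar>f x\<bar> \<partial>M)\<^sup>2"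
    using L2_spaceD[OF f] by (intro variance_eq) auto
  then show "(\<integral>x. \<bar>f x\<bar> \<partial>M)\<^sup>2 \<le> (\<integral>x. (f x)\<^sup>2 \<partial>M)"
    using variance_positive[of "\<lambda>x. \<bar>f x\<bar>"] by simp
qed

text \<open>Boundedness of the basis puts it into \<open>L2_space N\<close> and bounds every
  coefficient by a multiple of the L1 norm, so coefficients are continuous under L2 limits through
  \<open>integral_abs_le_L2\<close> alone.\<close>

locale orthonormal_basis = prob_space N for N :: "'a measure" +
  fixes e :: "nat \<Rightarrow> 'a \<Rightarrow> real"
  assumes e_measurable: "e n \<in> borel_measurable N"
    and e_bounded: "\<exists>C. \<forall>x\<in>space N. \<bar>e n x\<bar> \<le> C"
    and orthonormal: "(\<integral>x. e m x * e n x \<partial>N) = (if m = n then 1 else 0)"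
    and complete: "f \<in> L2_space N \<Longrightarrow> (\<And>n. (\<integral>x. f x * e n x \<partial>N) = 0) \<Longrightarrow> AE x in N. f x = 0"
begin

definition coeff :: "('a \<Rightarrow> real) \<Rightarrow> nat \<Rightarrow> real" where
  "coeff f j = (\<integral>x. f x * e j x \<partial>N)"

abbreviation psum :: "(nat \<Rightarrow> real) \<Rightarrow> nat \<Rightarrow> 'a \<Rightarrow> real" where
  "psum c n x \<equiv> (\<Sum>j<n. c j * e j x)"

lemma e_L2: "e n \<in> L2_space N"
  using e_bounded[of n] by (auto intro: bounded_imp_L2_space[OF e_measurable])

lemma psum_L2: "psum c n \<in> L2_space N"
  by (intro L2_space_sum L2_space_scale e_L2)

lemma coeff_diff:
  assumes "f \<in> L2_space N" "g \<in> L2_space N"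
  shows "coeff (\<lambda>x. f x - g x) j = coeff f j - coeff g j"
  unfolding coeff_def
  by (subst Bochner_Integration.integral_diff[symmetric])
    (auto simp: algebra_simps intro!: L2_space_mult_integrable assms e_L2)

lemma coeff_scale: "coeff (\<lambda>x. c * f x) j = c * coeff f j"
  unfolding coeff_def by (simp add: mult.assoc)

lemma coeff_psum: "coeff (psum c n) j = (if j < n then c j else 0)"
proof -
  have "coeff (psum c n) j = (\<integral>x. (\<Sum>i<n. c i * (e i x * e j x)) \<partial>N)"
    unfolding coeff_def by (simp add: sum_distrib_right mult.assoc)
  also have "\<dots> = (\<Sum>i<n. c i * (\<integral>x. e i x * e j x \<partial>N))"
    by (subst Bochner_Integration.integral_sum) (auto intro!: L2_space_mult_integrable e_L2)
  also have "\<dots> = (\<Sum>i<n. if j = i then c i else 0)"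
    by (intro sum.cong) (auto simp: orthonormal)
  finally show ?thesis by simp
qed

lemma integral_mult_psum:
  assumes "f \<in> L2_space N"
  shows "(\<integral>x. f x * psum c n x \<partial>N) = (\<Sum>j<n. c j * coeff f j)"
proof -
  have "(\<integral>x. f x * psum c n x \<partial>N) = (\<integral>x. (\<Sum>j<n. c j * (f x * e j x)) \<partial>N)"
    by (simp add: sum_distrib_left mult_ac)
  also have "\<dots> = (\<Sum>j<n. c j * coeff f j)"
    unfolding coeff_def
    by (subst Bochner_Integration.integral_sum) (auto intro!: L2_space_mult_integrable assms e_L2)
  finally show ?thesis .
qed

text \<open>Completing the square in the coefficients. With \<open>c = coeff f\<close> it yields
  Bessel's inequality and Parseval's identity; with a partial sum as f it measures the distance of
  two partial sums.\<close>

lemma integral_diff_psum_square: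
  assumes f: "f \<in> L2_space N"
  shows "(\<integral>x. (f x - psum c n x)\<^sup>2 \<partial>N)
    = (\<integral>x. (f x)\<^sup>2 \<partial>N) - (\<Sum>j<n. (coeff f j)\<^sup>2) + (\<Sum>j<n. (c j - coeff f j)\<^sup>2)"
proof -
  have "(\<integral>x. (f x - psum c n x)\<^sup>2 \<partial>N)
      = (\<integral>x. (f x)\<^sup>2 - 2 * (f x * psum c n x) + psum c n x * psum c n x \<partial>N)"
    by (simp add: power2_eq_square algebra_simps)
  also have "\<dots> = (\<integral>x. (f x)\<^sup>2 \<partial>N) - 2 * (\<integral>x. f x * psum c n x \<partial>N) + (\<integral>x. psum c n x * psum c n x \<partial>N)"
    using L2_space_mult_integrable[OF f psum_L2] L2_space_mult_integrable[OF psum_L2 psum_L2] L2_spaceD[OF f]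
    by (subst Bochner_Integration.integral_add) auto
  also have "\<dots> = (\<integral>x. (f x)\<^sup>2 \<partial>N) - 2 * (\<Sum>j<n. c j * coeff f j) + (\<Sum>j<n. c j * c j)"
    by (simp add: integral_mult_psum[OF f] integral_mult_psum[OF psum_L2] coeff_psum)
  also have "\<dots> = (\<integral>x. (f x)\<^sup>2 \<partial>N) - (\<Sum>j<n. (coeff f j)\<^sup>2) + (\<Sum>j<n. (c j - coeff f j)\<^sup>2)"
    by (simp add: power2_diff sum.distrib sum_subtractf sum_distrib_left power2_eq_square algebra_simps)
  finally show ?thesis .
qed

lemma bessel:
  assumes f: "f \<in> L2_space N"
  shows "summable (\<lambda>j. (coeff f j)\<^sup>2)"
proof (rule summableI_nonneg_bounded)
  show "(\<Sum>j<n. (coeff f j)\<^sup>2) \<le> (\<integral>x. (f x)\<^sup>2 \<partial>N)" for n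
  proof -
    have "0 \<le> (\<integral>x. (f x - psum (coeff f) n x)\<^sup>2 \<partial>N)" by simp
    then show ?thesis by (simp add: integral_diff_psum_square[OF f])
  qed
qed simp

definition expansion :: "('a \<Rightarrow> real) \<Rightarrow> (nat \<Rightarrow> real) \<Rightarrow> bool" where
  "expansion f b \<longleftrightarrow> summable (\<lambda>j. (b j)\<^sup>2) \<and> L2_tendsto N (\<lambda>n. psum b n) f sequentially"

lemma coeff_tendsto:
  assumes "L2_tendsto N g f F"
  shows "((\<lambda>i. coeff (g i) j) \<longlongrightarrow> coeff f j) F"
proof -
  have f: "f \<in> L2_space N" and g: "\<forall>\<^sub>F i in F. g i \<in> L2_space N"
    and lim: "((\<lambda>i. sqrt (\<integral>x. (g i x - f x)\<^sup>2 \<partial>N)) \<longlongrightarrow> 0) F"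
    using assms by (auto simp: L2_tendsto_def)
  obtain C where C: "\<And>x. x \<in> space N \<Longrightarrow> \<bar>e j x\<bar> \<le> C" using e_bounded by blast
  have "((\<lambda>i. coeff (g i) j - coeff f j) \<longlongrightarrow> 0) F"
  proof (rule Lim_null_comparison)
    show "((\<lambda>i. sqrt (\<integral>x. (g i x - f x)\<^sup>2 \<partial>N) * C) \<longlongrightarrow> 0) F"
      by (rule tendsto_mult_left_zero[OF lim])
    show "\<forall>\<^sub>F i in F. norm (coeff (g i) j - coeff f j) \<le> sqrt (\<integral>x. (g i x - f x)\<^sup>2 \<partial>N) * C"
      using g
    proof eventually_elim
      case (elim i)
      have d: "(\<lambda>x. g i x - f x) \<in> L2_space N" by (rule L2_space_diff[OF elim f])
      have "norm (coeff (\<lambda>x. g i x - f x) j) \<le> (\<integral>x. \<bar>g i x - f x\<bar> * C \<partial>N)"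
        unfolding coeff_def
      proof (rule order_trans[OF integral_norm_bound integral_mono])
        show "integrable N (\<lambda>x. norm ((g i x - f x) * e j x))"
          by (intro integrable_norm, rule L2_space_mult_integrable[OF d e_L2])
        show "integrable N (\<lambda>x. \<bar>g i x - f x\<bar> * C)"
          using L2_space_integrable[OF d] by auto
        show "norm ((g i x - f x) * e j x) \<le> \<bar>g i x - f x\<bar> * C" if "x \<in> space N" for x
          unfolding real_norm_def abs_mult using C[OF that] by (intro mult_left_mono) auto
      qed
      also have "\<dots> = (\<integral>x. \<bar>g i x - f x\<bar> \<partial>N) * C" by simp
      also have "\<dots> \<le> sqrt (\<integral>x. (g i x - f x)\<^sup>2 \<partial>N) * C"
      proof (rule mult_right_mono[OF integral_abs_le_L2[OF d]])
        obtain x where "x \<in> space N" using not_empty by blast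
        then show "0 \<le> C" using C[of x] by linarith
      qed
      finally show ?case by (simp add: coeff_diff[OF elim f])
    qed
  qed
  then show ?thesis by (simp add: LIM_zero_iff)
qed

lemma expansion_imp_coeff:
  assumes b: "expansion f b"
  shows "f \<in> L2_space N" "b = coeff f"
proof -
  show f: "f \<in> L2_space N"
    using b by (auto simp: expansion_def L2_tendsto_def)
  have lim: "L2_tendsto N (\<lambda>n. psum b n) f sequentially"
    using b by (auto simp: expansion_def)
  have "b j = coeff f j" for j
  proof (rule LIMSEQ_unique)
    show "(\<lambda>n. coeff (psum b n) j) \<longlonglongrightarrow> coeff f j" by (rule coeff_tendsto[OF lim])
    show "(\<lambda>n. coeff (psum b n) j) \<longlonglongrightarrow> b j"
      by (rule tendsto_eventually) (auto simp: coeff_psum eventually_sequentially intro!: exI[of _ "Suc j"])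
  qed
  then show "b = coeff f" by auto
qed

text \<open>The partial sums are Cauchy in L2, hence in L1, so a subsequence converges almost
  everywhere; its limit is the candidate g.\<close>

lemma riesz_fischer:
  assumes b: "summable (\<lambda>j. (b j)\<^sup>2)"
  obtains g where "g \<in> L2_space N" "coeff g = b" "expansion g b"
proof -
  let ?S = "psum b"
  define R where "R n = (\<Sum>j. (b (j + n))\<^sup>2)" for n
  have R0: "R \<longlonglongrightarrow> 0" unfolding R_def by (rule suminf_exist_split2[OF b])
  have diff_le: "(\<integral>x. (?S m x - ?S n x)\<^sup>2 \<partial>N) \<le> R (min m n)" for m n
  proof -
    have *: "(\<integral>x. (?S m x - ?S n x)\<^sup>2 \<partial>N) \<le> R n" if "n \<le> m" for m n
    proof -
      have "(\<integral>x. (?S m x - ?S n x)\<^sup>2 \<partial>N) = (\<Sum>j<m. (b j)\<^sup>2) - (\<Sum>j<n. (b j)\<^sup>2)"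
      proof -
        have "(\<integral>x. (?S m x)\<^sup>2 \<partial>N) = (\<Sum>j<m. (b j)\<^sup>2)"
          using integral_mult_psum[OF psum_L2, of b m b m] by (simp add: coeff_psum power2_eq_square)
        then show ?thesis
          using that by (simp add: integral_diff_psum_square[OF psum_L2] coeff_psum)
      qed
      also have "\<dots> \<le> R n"
        using sum_le_suminf[OF b, of "{..<m}"] unfolding R_def by (simp add: suminf_minus_initial_segment[OF b])
      finally show ?thesis .
    qed
    show ?thesis
    proof (cases "n \<le> m")
      case False
      then show ?thesis using *[of m n] by (simp add: power2_commute min_absorb1)
    qed (use *[of n m] in \<open>simp add: min_absorb2\<close>)
  qed
  have "\<exists>n0. \<forall>i\<ge>n0. \<forall>j\<ge>n0. (LINT x|N. norm (?S i x - ?S j x)) < \<epsilon>" if "0 < \<epsilon>" for \<epsilon>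
  proof -
    have "\<forall>\<^sub>F n in sequentially. R n < \<epsilon>\<^sup>2"
      using R0 that by (intro order_tendstoD(2)) auto
    then obtain n0 where n0: "\<And>n. n \<ge> n0 \<Longrightarrow> R n < \<epsilon>\<^sup>2" by (auto simp: eventually_sequentially)
    have "(LINT x|N. norm (?S i x - ?S j x)) < \<epsilon>" if "i \<ge> n0" "j \<ge> n0" for i j
    proof -
      have "(LINT x|N. norm (?S i x - ?S j x)) \<le> sqrt (\<integral>x. (?S i x - ?S j x)\<^sup>2 \<partial>N)"
        using integral_abs_le_L2[OF L2_space_diff[OF psum_L2 psum_L2]] by simp
      also have "\<dots> \<le> sqrt (R (min i j))" by (intro real_sqrt_le_mono diff_le)
      also have "\<dots> < sqrt (\<epsilon>\<^sup>2)" using that by (intro real_sqrt_less_mono n0) auto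
      finally show ?thesis using \<open>0 < \<epsilon>\<close> by simp
    qed
    then show ?thesis by blast
  qed
  then obtain r where r: "strict_mono r" "AE x in N. Cauchy (\<lambda>i. ?S (r i) x)"
    by (rule cauchy_L1_AE_cauchy_subseq[of N ?S, OF L2_space_integrable[OF psum_L2]])
  define g where "g x = lim (\<lambda>i. ?S (r i) x)" for x
  have S_meas[measurable]: "?S n \<in> borel_measurable N" for n by (rule L2_spaceD[OF psum_L2])
  have g_meas[measurable]: "g \<in> borel_measurable N"
    unfolding g_def by measurable
  have g_lim: "AE x in N. (\<lambda>i. ?S (r i) x) \<longlonglongrightarrow> g x"
    using r(2) by eventually_elim (simp add: g_def convergent_LIMSEQ_iff[symmetric] Cauchy_convergent)
  \<comment> \<open>Fatou's lemma along the subsequence \<open>r\<close>. The bound by the tail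
    \<open>R n\<close> is obtained for every n, so the full sequence converges in L2 and not just
    the subsequence.\<close>
  have nn_le: "(\<integral>\<^sup>+x. ennreal ((?S n x - g x)\<^sup>2) \<partial>N) \<le> ennreal (R n)" for n
  proof -
    have "(\<integral>\<^sup>+x. ennreal ((?S n x - g x)\<^sup>2) \<partial>N) = (\<integral>\<^sup>+x. liminf (\<lambda>i. ennreal ((?S n x - ?S (r i) x)\<^sup>2)) \<partial>N)"
    proof (rule nn_integral_cong_AE)
      show "AE x in N. ennreal ((?S n x - g x)\<^sup>2) = liminf (\<lambda>i. ennreal ((?S n x - ?S (r i) x)\<^sup>2))"
        using g_lim
      proof eventually_elim
        case (elim x)
        have "(\<lambda>i. ennreal ((?S n x - ?S (r i) x)\<^sup>2)) \<longlonglongrightarrow> ennreal ((?S n x - g x)\<^sup>2)"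
          by (intro tendsto_ennrealI tendsto_intros elim)
        from lim_imp_Liminf[OF _ this] show ?case by simp
      qed
    qed
    also have "\<dots> \<le> liminf (\<lambda>i. \<integral>\<^sup>+x. ennreal ((?S n x - ?S (r i) x)\<^sup>2) \<partial>N)"
      by (rule nn_integral_liminf) measurable
    also have "\<dots> \<le> liminf (\<lambda>i. ennreal (R n))"
    proof (rule Liminf_mono)
      show "\<forall>\<^sub>F i in sequentially. (\<integral>\<^sup>+x. ennreal ((?S n x - ?S (r i) x)\<^sup>2) \<partial>N) \<le> ennreal (R n)"
        unfolding eventually_sequentially
      proof (intro exI[of _ n] allI impI)
        fix i assume "n \<le> i"
        then have "n \<le> r i" using seq_suble[OF r(1), of i] by simp
        then have "(\<integral>x. (?S n x - ?S (r i) x)\<^sup>2 \<partial>N) \<le> R n" using diff_le[of n "r i"] by (simp add: min_def)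
        then show "(\<integral>\<^sup>+x. ennreal ((?S n x - ?S (r i) x)\<^sup>2) \<partial>N) \<le> ennreal (R n)"
          by (subst nn_integral_eq_integral)
            (auto intro!: ennreal_leI L2_spaceD(2)[OF L2_space_diff[OF psum_L2 psum_L2]])
      qed
    qed
    also have "\<dots> = ennreal (R n)" by (simp add: Liminf_const)
    finally show ?thesis .
  qed
  have int: "integrable N (\<lambda>x. (?S n x - g x)\<^sup>2)" for n
    using le_less_trans[OF nn_le[of n] ennreal_less_top] by (intro integrableI_bounded) auto
  have d: "(\<lambda>x. ?S n x - g x) \<in> L2_space N" for n
    using int by (auto simp: L2_space_def)
  have g: "g \<in> L2_space N"
    using L2_space_diff[OF psum_L2[of b 0] d[of 0]] by simp
  have le: "(\<integral>x. (?S n x - g x)\<^sup>2 \<partial>N) \<le> R n" for n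
  proof -
    have "0 \<le> R n" unfolding R_def by (intro suminf_nonneg summable_ignore_initial_segment b) auto
    then show ?thesis
      using nn_le[of n] by (simp add: nn_integral_eq_integral[OF int])
  qed
  have "(\<lambda>n. \<integral>x. (?S n x - g x)\<^sup>2 \<partial>N) \<longlonglongrightarrow> 0"
    by (rule tendsto_sandwich[OF _ _ tendsto_const R0]) (auto simp: le)
  from tendsto_real_sqrt[OF this] have "expansion g b"
    unfolding expansion_def L2_tendsto_def using g psum_L2 b by simp
  then show ?thesis
    using that expansion_imp_coeff(2) g by blast
qed

text \<open>\<open>riesz_fischer\<close> provides some g with the coefficients of f and with the
  required convergence; completeness identifies f with g almost everywhere.\<close>

lemma expansion_coeff:
  assumes f: "f \<in> L2_space N"
  shows "expansion f (coeff f)"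
proof -
  obtain g where g: "g \<in> L2_space N" "coeff g = coeff f" "expansion g (coeff f)"
    using riesz_fischer[OF bessel[OF f]] by blast
  have eq: "AE x in N. f x - g x = 0"
  proof (rule complete[OF L2_space_diff[OF f g(1)]])
    show "(\<integral>x. (f x - g x) * e n x \<partial>N) = 0" for n
      using coeff_diff[OF f g(1), of n] by (simp add: g(2) coeff_def)
  qed
  have "(\<integral>x. (psum b n x - f x)\<^sup>2 \<partial>N) = (\<integral>x. (psum b n x - g x)\<^sup>2 \<partial>N)" for b n
  proof (rule integral_cong_AE)
    show "AE x in N. (psum b n x - f x)\<^sup>2 = (psum b n x - g x)\<^sup>2"
      using eq by eventually_elim simp
  qed (use L2_spaceD(1)[OF psum_L2[of b n]] L2_spaceD(1)[OF f] L2_spaceD(1)[OF g(1)] in measurable)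
  then show ?thesis
    using g(3) f by (simp add: expansion_def L2_tendsto_def)
qed

lemma expansion_iff: "expansion f b \<longleftrightarrow> f \<in> L2_space N \<and> b = coeff f"
  using expansion_imp_coeff expansion_coeff by blast

lemma parseval:
  assumes f: "f \<in> L2_space N"
  shows "(\<lambda>j. (coeff f j)\<^sup>2) sums (\<integral>x. (f x)\<^sup>2 \<partial>N)"
proof -
  have "(\<lambda>n. sqrt (\<integral>x. (psum (coeff f) n x - f x)\<^sup>2 \<partial>N)) \<longlonglongrightarrow> 0"
    using expansion_coeff[OF f] by (simp add: expansion_def L2_tendsto_def)
  from tendsto_power[OF this, of 2] have "(\<lambda>n. \<integral>x. (f x - psum (coeff f) n x)\<^sup>2 \<partial>N) \<longlonglongrightarrow> 0"
    by (simp add: power2_commute)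
  from tendsto_diff[OF tendsto_const this, of "\<integral>x. (f x)\<^sup>2 \<partial>N"] show ?thesis
    by (simp add: integral_diff_psum_square[OF f] sums_def)
qed

end


section \<open>Upcrossings and regular paths\<close>

text \<open>Doob's strategy: buy below a, sell above b. The position after index i depends on the
  values up to i only, which makes it admissible for the increment from i to i + 1.\<close>

primrec holding :: "real \<Rightarrow> real \<Rightarrow> (nat \<Rightarrow> real) \<Rightarrow> nat \<Rightarrow> bool" where
  "holding a b x 0 = (x 0 < a)"
| "holding a b x (Suc i) = (if holding a b x i then x (Suc i) \<le> b else x (Suc i) < a)"

primrec upcrossings :: "real \<Rightarrow> real \<Rightarrow> (nat \<Rightarrow> real) \<Rightarrow> nat \<Rightarrow> nat" where
  "upcrossings a b x 0 = 0"
| "upcrossings a b x (Suc i) = upcrossings a b x i + (if holding a b x i \<and> b < x (Suc i) then 1 else 0)"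

text \<open>The right-hand side is the gain from holding one unit from each visit below \<open>a\<close> to the next visit
  above \<open>b\<close>; for a martingale its expectation is 0.\<close>

lemma upcrossings_gain:
  assumes "a < b"
  shows "(b - a) * upcrossings a b x n + (if holding a b x n then x n - a else 0)
    \<le> (\<Sum>i<n. of_bool (holding a b x i) * (x (Suc i) - x i))"
proof (induction n)
  case (Suc n)
  then show ?case by (auto simp: algebra_simps)
qed auto

lemma upcrossings_mono: "i \<le> j \<Longrightarrow> upcrossings a b x i \<le> upcrossings a b x j"
  by (rule lift_Suc_mono_le[of "upcrossings a b x"]) auto

lemma holding_below: "a < b \<Longrightarrow> x i < a \<Longrightarrow> holding a b x i"
  by (cases i) auto

lemma upcrossings_Suc_le:
  assumes "a < b" "x i < a" "i < j" "b < x j"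
  shows "Suc (upcrossings a b x i) \<le> upcrossings a b x j"
proof -
  \<comment> \<open>Invariant after the visit below a at index i: either the unit is still held, or
    an upcrossing has been completed since then.\<close>
  have "holding a b x k \<or> Suc (upcrossings a b x i) \<le> upcrossings a b x k" if "i \<le> k" for k
    using that
  proof (induction rule: dec_induct)
    case base
    then show ?case using assms by (simp add: holding_below)
  next
    case (step k)
    then show ?case using upcrossings_mono[of i k a b x] by auto
  qed
  from this[of "j - 1"] show ?thesis
    using assms upcrossings_mono[of i "j - 1" a b x] by (cases j) auto
qed

text \<open>\<open>crosses f D a b lo m hi\<close>: along times of \<open>D\<close> in \<open>(lo, hi]\<close> the path \<open>f\<close> passes \<open>m\<close> times from
  below \<open>a\<close> to above \<open>b\<close>.\<close>

inductive crosses :: "(real \<Rightarrow> real) \<Rightarrow> real set \<Rightarrow> real \<Rightarrow> real \<Rightarrow> real \<Rightarrow> nat \<Rightarrow> real \<Rightarrow> bool"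
  for f D a b lo where
  base: "lo \<le> hi \<Longrightarrow> crosses f D a b lo 0 hi"
| step: "crosses f D a b lo m r \<Longrightarrow> r < s \<Longrightarrow> s < u \<Longrightarrow> u \<le> hi \<Longrightarrow> s \<in> D \<Longrightarrow> u \<in> D \<Longrightarrow>
    f s < a \<Longrightarrow> b < f u \<Longrightarrow> crosses f D a b lo (Suc m) hi"

lemma crosses_widen:
  assumes "crosses f D a b lo m hi" "lo' \<le> lo" "hi \<le> hi'"
  shows "crosses f D a b lo' m hi'"
  using assms
proof (induction arbitrary: hi' rule: crosses.induct)
  case (step m r s u hi)
  then show ?case by (intro crosses.step[of f D a b lo' m r s u]) auto
qed (auto intro: crosses.base)

text \<open>The inductive rule adds crossings at the right end. Approaching a time from the left
  requires adding them at the left end, which concatenation makes possible.\<close>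

lemma crosses_append:
  assumes "crosses f D a b r n hi" "crosses f D a b lo m r"
  shows "crosses f D a b lo (n + m) hi"
  using assms
proof (induction rule: crosses.induct)
  case (base hi)
  then show ?case using crosses_widen[of f D a b lo m r lo hi] by simp
next
  case (step n r' s u hi)
  then show ?case using crosses.step[of f D a b lo "n + m" r' s u hi] by simp
qed

text \<open>Rational levels and integer windows keep the quantifiers countable, so that an almost
  sure statement for each of them is one for all.\<close>

definition no_oscillation :: "(real \<Rightarrow> real) \<Rightarrow> real set \<Rightarrow> bool" where
  "no_oscillation f D \<longleftrightarrow>
     (\<forall>L::nat. \<forall>a\<in>\<rat>. \<forall>b\<in>\<rat>. a < b \<longrightarrow> (\<exists>m. \<not> crosses f D a b (- real L) m (real L)))"

text \<open>The lower and upper limits are finite and differ, so two rationals fit strictly between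
  them.\<close>

lemma bounded_tendsto_or_frequently:
  fixes f :: "real \<Rightarrow> real"
  assumes F: "F \<noteq> bot" and bd: "\<forall>\<^sub>F x in F. \<bar>f x\<bar> \<le> K"
    and no: "\<not> (\<exists>l. (f \<longlongrightarrow> l) F)"
  obtains a b where "a \<in> \<rat>" "b \<in> \<rat>" "a < b" "\<exists>\<^sub>F x in F. f x < a" "\<exists>\<^sub>F x in F. b < f x"
proof -
  let ?g = "\<lambda>x. ereal (f x)"
  let ?i = "Liminf F ?g" and ?s = "Limsup F ?g"
  have "ereal (- K) \<le> ?i"
    using bd by (intro Liminf_bounded) (auto elim!: eventually_mono)
  moreover have "?s \<le> ereal K"
    using bd by (intro Limsup_bounded) (auto elim!: eventually_mono)
  moreover have "?i \<le> ?s" by (rule Liminf_le_Limsup[OF F])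
  ultimately obtain i s where lims: "?i = ereal i" "?s = ereal s" "i \<le> s"
    by (cases ?i; cases ?s) auto
  have "i \<noteq> s"
  proof
    assume "i = s"
    then have "(?g \<longlongrightarrow> ereal i) F"
      using lims by (intro Liminf_eq_Limsup[OF F]) auto
    with no show False by auto
  qed
  with lims have "i < s" by simp
  obtain b where b: "b \<in> \<rat>" "i < b" "b < s" using Rats_dense_in_real[OF \<open>i < s\<close>] by blast
  obtain a where a: "a \<in> \<rat>" "i < a" "a < b" using Rats_dense_in_real[OF b(2)] by blast
  show ?thesis
  proof (rule that[OF a(1) b(1) a(3)]; rule ccontr)
    assume "\<not> (\<exists>\<^sub>F x in F. f x < a)"
    then have "\<forall>\<^sub>F x in F. ereal a \<le> ?g x" by (simp add: frequently_def not_less)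
    then have "ereal a \<le> ?i" by (rule Liminf_bounded)
    with lims a show False by simp
  next
    assume "\<not> (\<exists>\<^sub>F x in F. b < f x)"
    then have "\<forall>\<^sub>F x in F. ?g x \<le> ereal b" by (simp add: frequently_def not_less)
    then have "?s \<le> ereal b" by (rule Limsup_bounded)
    with lims b show False by simp
  qed
qed

lemma frequently_right:
  fixes t :: real
  assumes "\<exists>\<^sub>F x in at t within (D \<inter> {t<..}). P x" "t < c"
  obtains s where "s \<in> D" "t < s" "s < c" "P s"
proof -
  have "\<forall>\<^sub>F x in at t within (D \<inter> {t<..}). x \<in> D \<and> t < x \<and> x < c"
    unfolding eventually_at using assms(2)
    by (intro exI[of _ "c - t"]) (auto simp: dist_real_def)
  from frequently_eventually_conj[OF assms(1) this] have "\<exists>x. P x \<and> x \<in> D \<and> t < x \<and> x < c"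
    by (auto dest: frequently_ex)
  then show ?thesis using that by blast
qed

lemma frequently_left:
  fixes t :: real
  assumes "\<exists>\<^sub>F x in at t within (D \<inter> {..<t}). P x" "c < t"
  obtains s where "s \<in> D" "c < s" "s < t" "P s"
proof -
  have "\<forall>\<^sub>F x in at t within (D \<inter> {..<t}). x \<in> D \<and> x < t \<and> c < x"
    unfolding eventually_at using assms(2)
    by (intro exI[of _ "t - c"]) (auto simp: dist_real_def)
  from frequently_eventually_conj[OF assms(1) this] have "\<exists>x. P x \<and> x \<in> D \<and> x < t \<and> c < x"
    by (auto dest: frequently_ex)
  then show ?thesis using that by blast
qed

lemma dense_at_right_neq_bot:
  fixes D :: "real set"
  assumes "\<And>u v. u < v \<Longrightarrow> \<exists>d\<in>D. u < d \<and> d < v"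
  shows "at t within (D \<inter> {t<..}) \<noteq> bot"
proof -
  have "t islimpt (D \<inter> {t<..})"
    unfolding islimpt_approachable
  proof (intro allI impI)
    fix e :: real assume "0 < e"
    then obtain d where "d \<in> D" "t < d" "d < t + e" using assms[of t "t + e"] by auto
    then show "\<exists>x'\<in>D \<inter> {t<..}. x' \<noteq> t \<and> dist x' t < e" by (auto simp: dist_real_def intro!: bexI[of _ d])
  qed
  then show ?thesis by (simp add: trivial_limit_within)
qed

lemma dense_at_left_neq_bot:
  fixes D :: "real set"
  assumes "\<And>u v. u < v \<Longrightarrow> \<exists>d\<in>D. u < d \<and> d < v"
  shows "at t within (D \<inter> {..<t}) \<noteq> bot"
proof -
  have "t islimpt (D \<inter> {..<t})"
    unfolding islimpt_approachable
  proof (intro allI impI)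
    fix e :: real assume "0 < e"
    then obtain d where "d \<in> D" "t - e < d" "d < t" using assms[of "t - e" t] by auto
    then show "\<exists>x'\<in>D \<inter> {..<t}. x' \<noteq> t \<and> dist x' t < e" by (auto simp: dist_real_def intro!: bexI[of _ d])
  qed
  then show ?thesis by (simp add: trivial_limit_within)
qed

text \<open>Without a one-sided limit at t the path is, arbitrarily close to t, below some a and
  above some b > a. Each crossing found leaves room for another one nearer to t, so every number of
  crossings fits into a fixed window.\<close>

lemma no_oscillation_one_sided_limits:
  fixes f :: "real \<Rightarrow> real"
  assumes dense: "\<And>u v. u < v \<Longrightarrow> \<exists>d\<in>D. u < d \<and> d < v"
    and osc: "no_oscillation f D" and bd: "\<And>c. \<exists>K. \<forall>x. \<bar>x\<bar> \<le> c \<longrightarrow> \<bar>f x\<bar> \<le> K"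
  shows "\<exists>l. (f \<longlongrightarrow> l) (at t within (D \<inter> {t<..}))" "\<exists>l. (f \<longlongrightarrow> l) (at t within (D \<inter> {..<t}))"
proof -
  obtain L :: nat where L: "\<bar>t\<bar> + 1 \<le> real L" using real_arch_simple by blast
  obtain K where "\<forall>x. \<bar>x\<bar> \<le> \<bar>t\<bar> + 1 \<longrightarrow> \<bar>f x\<bar> \<le> K" using bd by blast
  then have ev: "\<forall>\<^sub>F x in at t within S. \<bar>f x\<bar> \<le> K" for S
    unfolding eventually_at by (intro exI[of _ 1]) (auto simp: dist_real_def)
  have osc': "\<exists>m. \<not> crosses f D a b lo m hi" if "a \<in> \<rat>" "b \<in> \<rat>" "a < b" "- real L \<le> lo" "hi \<le> real L" for a b lo hi
    using osc that crosses_widen[of f D a b lo _ hi] unfolding no_oscillation_def by blast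
  show "\<exists>l. (f \<longlongrightarrow> l) (at t within (D \<inter> {t<..}))"
  proof (rule ccontr)
    assume "\<nexists>l. (f \<longlongrightarrow> l) (at t within (D \<inter> {t<..}))"
    then obtain a b where ab: "a \<in> \<rat>" "b \<in> \<rat>" "a < b"
      and fr: "\<exists>\<^sub>F x in at t within (D \<inter> {t<..}). f x < a" "\<exists>\<^sub>F x in at t within (D \<inter> {t<..}). b < f x"
      using bounded_tendsto_or_frequently[OF dense_at_right_neq_bot[OF dense] ev] by metis
    have "crosses f D a b t m c" if "t < c" for m c
      using that
    proof (induction m arbitrary: c)
      case (Suc m)
      obtain u where u: "u \<in> D" "t < u" "u < c" "b < f u" using frequently_right[OF fr(2) Suc.prems] by blast
      obtain s where s: "s \<in> D" "t < s" "s < u" "f s < a" using frequently_right[OF fr(1) u(2)] by blast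
      obtain r where r: "t < r" "r < s" using dense[OF s(2)] by blast
      show ?case
        by (rule crosses.step[OF Suc.IH[OF r(1)], of s u]) (use r s u in auto)
    qed (auto intro: crosses.base)
    from this[of "t + 1"] osc'[OF ab, of t "t + 1"] L show False by (auto simp: abs_if split: if_splits)
  qed
  show "\<exists>l. (f \<longlongrightarrow> l) (at t within (D \<inter> {..<t}))"
  proof (rule ccontr)
    assume "\<nexists>l. (f \<longlongrightarrow> l) (at t within (D \<inter> {..<t}))"
    then obtain a b where ab: "a \<in> \<rat>" "b \<in> \<rat>" "a < b"
      and fr: "\<exists>\<^sub>F x in at t within (D \<inter> {..<t}). f x < a" "\<exists>\<^sub>F x in at t within (D \<inter> {..<t}). b < f x"
      using bounded_tendsto_or_frequently[OF dense_at_left_neq_bot[OF dense] ev] by metis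
    have "crosses f D a b c m t" if "c < t" for m c
      using that
    proof (induction m arbitrary: c)
      case (Suc m)
      obtain s where s: "s \<in> D" "c < s" "s < t" "f s < a" using frequently_left[OF fr(1) Suc.prems] by blast
      obtain u where u: "u \<in> D" "s < u" "u < t" "b < f u" using frequently_left[OF fr(2) s(3)] by blast
      have "crosses f D a b c (Suc 0) u"
        by (rule crosses.step[OF crosses.base[OF order_refl], of c s u]) (use s u in auto)
      from crosses_append[OF Suc.IH[OF u(3)] this] show ?case by simp
    qed (auto intro: crosses.base)
    from this[of "t - 1"] osc'[OF ab, of "t - 1" t] L show False by (auto simp: abs_if split: if_splits)
  qed
qed

lemma right_limits_cadlag:
  fixes f g :: "real \<Rightarrow> real"
  assumes dense: "\<And>u v. u < v \<Longrightarrow> \<exists>d\<in>D. u < d \<and> d < v"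
    and g: "\<And>t. (f \<longlongrightarrow> g t) (at t within (D \<inter> {t<..}))"
    and left: "\<And>t. \<exists>l. (f \<longlongrightarrow> l) (at t within (D \<inter> {..<t}))"
  shows "cadlag g"
proof -
  \<comment> \<open>\<open>g u\<close> is a limit of values of f at times of D strictly after u, so
    it inherits non-strict bounds valid on (c, d), even for u = c.\<close>
  have close: "\<bar>g u - l\<bar> \<le> \<epsilon>" if "\<And>s. s \<in> D \<Longrightarrow> c < s \<Longrightarrow> s < d \<Longrightarrow> \<bar>f s - l\<bar> < \<epsilon>" "c \<le> u" "u < d" for u l \<epsilon> c d
  proof (rule tendsto_upperbound)
    show "((\<lambda>s. \<bar>f s - l\<bar>) \<longlongrightarrow> \<bar>g u - l\<bar>) (at u within (D \<inter> {u<..}))"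
      by (intro tendsto_intros g)
    show "\<forall>\<^sub>F s in at u within (D \<inter> {u<..}). \<bar>f s - l\<bar> \<le> \<epsilon>"
      unfolding eventually_at using that
      by (intro exI[of _ "d - u"]) (auto simp: dist_real_def intro!: less_imp_le)
    show "at u within (D \<inter> {u<..}) \<noteq> bot" by (rule dense_at_right_neq_bot[OF dense])
  qed
  have "(g \<longlongrightarrow> g t) (at_right t)" for t
  proof (rule tendstoI)
    fix \<epsilon> :: real assume "0 < \<epsilon>"
    then have "\<forall>\<^sub>F s in at t within (D \<inter> {t<..}). dist (f s) (g t) < \<epsilon> / 2"
      using g[of t] by (intro tendstoD) auto
    then obtain \<delta> where \<delta>: "0 < \<delta>" "\<And>s. s \<in> D \<Longrightarrow> t < s \<Longrightarrow> s < t + \<delta> \<Longrightarrow> \<bar>f s - g t\<bar> < \<epsilon> / 2"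
      unfolding eventually_at by (auto simp: dist_real_def)
    show "\<forall>\<^sub>F u in at_right t. dist (g u) (g t) < \<epsilon>"
      unfolding eventually_at
    proof (intro exI[of _ \<delta>] conjI ballI impI \<delta>(1))
      fix u assume "u \<in> {t<..}" "u \<noteq> t \<and> dist u t < \<delta>"
      then have "\<bar>g u - g t\<bar> \<le> \<epsilon> / 2"
        using close[of t "t + \<delta>" "g t" "\<epsilon> / 2" u, OF \<delta>(2)] by (auto simp: dist_real_def)
      then show "dist (g u) (g t) < \<epsilon>" using \<open>0 < \<epsilon>\<close> by (auto simp: dist_real_def)
    qed
  qed
  moreover have "\<exists>l. (g \<longlongrightarrow> l) (at_left t)" for t
  proof -
    obtain l where l: "(f \<longlongrightarrow> l) (at t within (D \<inter> {..<t}))" using left by blast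
    have "(g \<longlongrightarrow> l) (at_left t)"
    proof (rule tendstoI)
      fix \<epsilon> :: real assume "0 < \<epsilon>"
      then have "\<forall>\<^sub>F s in at t within (D \<inter> {..<t}). dist (f s) l < \<epsilon> / 2"
        using l by (intro tendstoD) auto
      then obtain \<delta> where \<delta>: "0 < \<delta>" "\<And>s. s \<in> D \<Longrightarrow> t - \<delta> < s \<Longrightarrow> s < t \<Longrightarrow> \<bar>f s - l\<bar> < \<epsilon> / 2"
        unfolding eventually_at by (auto simp: dist_real_def)
      show "\<forall>\<^sub>F u in at_left t. dist (g u) l < \<epsilon>"
        unfolding eventually_at
      proof (intro exI[of _ \<delta>] conjI ballI impI \<delta>(1))
        fix u assume "u \<in> {..<t}" "u \<noteq> t \<and> dist u t < \<delta>"
        then have "\<bar>g u - l\<bar> \<le> \<epsilon> / 2"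
          using close[of "t - \<delta>" t l "\<epsilon> / 2" u, OF \<delta>(2)] by (auto simp: dist_real_def)
        then show "dist (g u) l < \<epsilon>" using \<open>0 < \<epsilon>\<close> by (auto simp: dist_real_def)
      qed
    qed
    then show ?thesis by blast
  qed
  ultimately show ?thesis unfolding cadlag_def by blast
qed

section \<open>Dyadic times and the upcrossing bound for martingales\<close>

definition dyadics :: "real set" where
  "dyadics = {real_of_int j / 2 ^ k | j k. True}"

lemma dyadics_dense:
  assumes "u < (v::real)" shows "\<exists>d\<in>dyadics. u < d \<and> d < v"
proof -
  obtain k where k: "(1 / 2) ^ k < v - u"
    using real_arch_pow_inv[of "v - u" "1 / 2"] assms by auto
  define j where "j = \<lfloor>u * 2 ^ k\<rfloor> + 1"
  have "u * 2 ^ k < j" "j \<le> u * 2 ^ k + 1" unfolding j_def by linarith+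
  moreover have "1 < (v - u) * 2 ^ k" using k by (simp add: field_simps)
  ultimately have "u < j / 2 ^ k" "j / 2 ^ k < v" by (auto simp: field_simps)
  then show ?thesis unfolding dyadics_def by (intro bexI[of _ "j / 2 ^ k"]) auto
qed

definition grid :: "nat \<Rightarrow> nat \<Rightarrow> nat \<Rightarrow> real" where
  "grid L k i = real i / 2 ^ k - real L"

lemma dyadic_on_grid:
  assumes "s \<in> dyadics" "- real L \<le> s"
  shows "\<forall>\<^sub>F k in sequentially. grid L k (nat \<lfloor>(s + L) * 2 ^ k\<rfloor>) = s"
proof -
  obtain j k0 where s: "s = real_of_int j / 2 ^ k0" using assms by (auto simp: dyadics_def)
  have "grid L k (nat \<lfloor>(s + L) * 2 ^ k\<rfloor>) = s" if k: "k0 \<le> k" for k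
  proof -
    have "(s + L) * 2 ^ k = real_of_int (j * 2 ^ (k - k0) + int L * 2 ^ k)"
      using k power_add[of "2::real" k0 "k - k0"] by (simp add: s field_simps)
    then have "real_of_int \<lfloor>(s + L) * 2 ^ k\<rfloor> = (s + L) * 2 ^ k" by (metis floor_of_int)
    moreover have "0 \<le> (s + L) * 2 ^ k" using assms by simp
    ultimately have "real (nat \<lfloor>(s + L) * 2 ^ k\<rfloor>) = (s + L) * 2 ^ k"
      by (simp add: of_nat_nat)
    then show ?thesis by (simp add: grid_def)
  qed
  then show ?thesis by (auto simp: eventually_sequentially)
qed

text \<open>A chain of m crossings involves finitely many dyadic times, and all of these lie on
  every sufficiently fine grid.\<close>

lemma crosses_imp_upcrossings:
  assumes "crosses f dyadics a b (- real L) m hi" "a < b"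
  shows "\<forall>\<^sub>F k in sequentially.
    m \<le> upcrossings a b (\<lambda>i. f (grid L k i)) (nat \<lfloor>(hi + L) * 2 ^ k\<rfloor>)"
  using assms(1)
proof (induction rule: crosses.induct)
  case (step m r s u hi)
  have r: "- real L \<le> r" using step(1) by (induction rule: crosses.induct) auto
  have s: "\<forall>\<^sub>F k in sequentially. grid L k (nat \<lfloor>(s + L) * 2 ^ k\<rfloor>) = s"
    using r step by (intro dyadic_on_grid) auto
  have u: "\<forall>\<^sub>F k in sequentially. grid L k (nat \<lfloor>(u + L) * 2 ^ k\<rfloor>) = u"
    using r step by (intro dyadic_on_grid) auto
  have IH: "\<forall>\<^sub>F k in sequentially. m \<le> upcrossings a b (\<lambda>i. f (grid L k i)) (nat \<lfloor>(r + L) * 2 ^ k\<rfloor>)"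
    by (rule step)
  show ?case
    using IH s u
  proof eventually_elim
    case (elim k)
    let ?n = "\<lambda>t::real. nat \<lfloor>(t + L) * 2 ^ k\<rfloor>" and ?x = "\<lambda>i. f (grid L k i)"
    have mono: "?n t \<le> ?n t'" if "t \<le> t'" for t t'
      using that by (intro nat_mono floor_mono mult_right_mono) auto
    have g: "grid L k (?n s) = s" "grid L k (?n u) = u" using elim r step by auto
    then have "?n s \<noteq> ?n u" using step(3) by auto
    then have "?n s < ?n u" using mono[of s u] step(3) by linarith
    then have "Suc (upcrossings a b ?x (?n s)) \<le> upcrossings a b ?x (?n u)"
      using g step assms(2) by (intro upcrossings_Suc_le) auto
    moreover have "upcrossings a b ?x (?n r) \<le> upcrossings a b ?x (?n s)"
      using step(2) by (intro upcrossings_mono mono) auto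
    moreover have "upcrossings a b ?x (?n u) \<le> upcrossings a b ?x (?n hi)"
      using step(4) by (intro upcrossings_mono mono) auto
    ultimately show ?case using elim by linarith
  qed
qed auto

text \<open>On each grid the expected gain of Doob's strategy is 0, which bounds the expected number
  of upcrossings independently of the mesh. By Fatou's lemma the lower limit of these numbers is
  almost surely finite.\<close>

lemma (in prob_space) martingale_no_oscillation:
  fixes X :: "real \<Rightarrow> 'a \<Rightarrow> real" and F :: "real \<Rightarrow> 'a measure"
  assumes F: "\<And>t. subalgebra M (F t)" and F_mono: "\<And>s t. s \<le> t \<Longrightarrow> sets (F s) \<subseteq> sets (F t)"
    and adapted: "\<And>t. X t \<in> borel_measurable (F t)"
    and bounded: "\<And>L. \<exists>K. \<forall>t \<omega>. \<bar>t\<bar> \<le> L \<longrightarrow> \<omega> \<in> space M \<longrightarrow> \<bar>X t \<omega>\<bar> \<le> K"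
    and martingale: "\<And>s t A. s < t \<Longrightarrow> A \<in> sets (F s) \<Longrightarrow>
      (\<integral>\<omega>. indicator A \<omega> * (X t \<omega> - X s \<omega>) \<partial>M) = 0"
  shows "AE \<omega> in M. no_oscillation (\<lambda>t. X t \<omega>) dyadics"
proof -
  have spaceF: "space (F t) = space M" and setsF: "sets (F t) \<subseteq> sets M" for t
    using F[of t] by (auto simp: subalgebra_def)
  have "AE \<omega> in M. \<exists>m. \<not> crosses (\<lambda>t. X t \<omega>) dyadics a b (- real L) m (real L)" if ab: "a < b" for L :: nat and a b
  proof -
    obtain K where K: "\<And>t \<omega>. \<bar>t\<bar> \<le> real L \<Longrightarrow> \<omega> \<in> space M \<Longrightarrow> \<bar>X t \<omega>\<bar> \<le> K"
      using bounded by blast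
    \<comment> \<open>The number of steps of mesh 2^(-k) between - L and L.\<close>
    define n where "n k = nat \<lfloor>(real L + real L) * 2 ^ k\<rfloor>" for k :: nat
    define x where "x k \<omega> i = X (grid L k i) \<omega>" for k \<omega> i
    define U where "U k \<omega> = upcrossings a b (x k \<omega>) (n k)" for k \<omega>
    have grid: "\<bar>grid L k i\<bar> \<le> real L" if "i \<le> n k" for k i
    proof -
      have "real i \<le> (real L + real L) * 2 ^ k"
        using order_trans[OF of_nat_mono[OF that, where 'a=real]] of_nat_floor[of "(real L + real L) * 2 ^ k"]
        unfolding n_def by simp
      then have "real i / 2 ^ k \<le> real L + real L" by (simp add: field_simps)
      moreover have "0 \<le> real i / 2 ^ k" by simp
      ultimately show ?thesis unfolding grid_def abs_le_iff by linarith
    qed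
    have grid_mono: "grid L k i < grid L k (Suc i)" for k i
      by (simp add: grid_def divide_strict_right_mono)
    have X_meas [measurable]: "X t \<in> borel_measurable M" for t
      using measurable_from_subalg[OF F adapted] .
    \<comment> \<open>The position is known at the left end of each increment, which is what the
      martingale hypothesis asks of the set A.\<close>
    have hold: "{\<omega> \<in> space M. holding a b (x k \<omega>) i} \<in> sets (F (grid L k i))" for k i
    proof (induction i)
      case 0
      have "{\<omega> \<in> space (F (grid L k 0)). X (grid L k 0) \<omega> < a} \<in> sets (F (grid L k 0))"
        using adapted by measurable
      then show ?case by (simp add: x_def spaceF)
    next
      case (Suc i)
      let ?F = "F (grid L k (Suc i))"
      let ?H = "{\<omega> \<in> space M. holding a b (x k \<omega>) i}"
      have H: "?H \<in> sets ?F" using Suc F_mono[OF less_imp_le[OF grid_mono]] by blast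
      have "{\<omega> \<in> space ?F. X (grid L k (Suc i)) \<omega> \<le> b} \<in> sets ?F" "{\<omega> \<in> space ?F. X (grid L k (Suc i)) \<omega> < a} \<in> sets ?F"
        using adapted by measurable
      then have "(?H \<inter> {\<omega> \<in> space ?F. X (grid L k (Suc i)) \<omega> \<le> b})
          \<union> ({\<omega> \<in> space ?F. X (grid L k (Suc i)) \<omega> < a} - ?H) \<in> sets ?F"
        using H by blast
      moreover have "{\<omega> \<in> space M. holding a b (x k \<omega>) (Suc i)} =
          (?H \<inter> {\<omega> \<in> space ?F. X (grid L k (Suc i)) \<omega> \<le> b})
          \<union> ({\<omega> \<in> space ?F. X (grid L k (Suc i)) \<omega> < a} - ?H)"
        by (auto simp: x_def spaceF)
      ultimately show ?case by simp
    qed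
    have hold_M [measurable]: "Measurable.pred M (\<lambda>\<omega>. holding a b (x k \<omega>) i)" for k i
      unfolding pred_def using hold[of k i] setsF by blast
    have x_meas [measurable]: "(\<lambda>\<omega>. x k \<omega> i) \<in> borel_measurable M" for k i
      unfolding x_def by measurable
    have up_meas: "(\<lambda>\<omega>. real (upcrossings a b (x k \<omega>) i)) \<in> borel_measurable M" for k i
    proof (induction i)
      case (Suc i)
      have "(\<lambda>\<omega>. real (upcrossings a b (x k \<omega>) i) + (if holding a b (x k \<omega>) i \<and> b < x k \<omega> (Suc i) then 1 else 0))
          \<in> borel_measurable M"
        using Suc by measurable
      moreover have "real (upcrossings a b (x k \<omega>) (Suc i))
          = real (upcrossings a b (x k \<omega>) i) + (if holding a b (x k \<omega>) i \<and> b < x k \<omega> (Suc i) then 1 else 0)" for \<omega>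
        by simp
      ultimately show ?case by presburger
    qed simp
    have U_meas [measurable]: "(\<lambda>\<omega>. real (U k \<omega>)) \<in> borel_measurable M" for k
      unfolding U_def by (rule up_meas)
    define G where "G k \<omega> = (\<Sum>i<n k. of_bool (holding a b (x k \<omega>) i) * (x k \<omega> (Suc i) - x k \<omega> i))" for k \<omega>
    have term_eq: "of_bool (holding a b (x k \<omega>) i) * (x k \<omega> (Suc i) - x k \<omega> i)
        = indicator {\<omega> \<in> space M. holding a b (x k \<omega>) i} \<omega> * (X (grid L k (Suc i)) \<omega> - X (grid L k i) \<omega>)"
      if "\<omega> \<in> space M" for k \<omega> i
      using that by (auto simp: x_def)
    have G_int: "integrable M (\<lambda>\<omega>. of_bool (holding a b (x k \<omega>) i) * (x k \<omega> (Suc i) - x k \<omega> i))" if "i < n k" for k i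
    proof (rule integrable_const_bound[where B="2 * K"])
      show "AE \<omega> in M. norm (of_bool (holding a b (x k \<omega>) i) * (x k \<omega> (Suc i) - x k \<omega> i)) \<le> 2 * K"
      proof (rule AE_I2)
        fix \<omega> assume "\<omega> \<in> space M"
        then have "\<bar>x k \<omega> (Suc i)\<bar> \<le> K" "\<bar>x k \<omega> i\<bar> \<le> K"
          using that unfolding x_def by (auto intro!: K grid)
        then show "norm (of_bool (holding a b (x k \<omega>) i) * (x k \<omega> (Suc i) - x k \<omega> i)) \<le> 2 * K"
          by auto
      qed
    qed measurable
    have "(\<integral>\<omega>. G k \<omega> \<partial>M) = 0" for k
    proof -
      have "(\<integral>\<omega>. G k \<omega> \<partial>M) = (\<Sum>i<n k. \<integral>\<omega>. of_bool (holding a b (x k \<omega>) i) * (x k \<omega> (Suc i) - x k \<omega> i) \<partial>M)"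
        unfolding G_def using G_int by (intro Bochner_Integration.integral_sum) auto
      also have "\<dots> = (\<Sum>i<n k. 0)"
      proof (rule sum.cong[OF refl])
        fix i
        have "(\<integral>\<omega>. of_bool (holding a b (x k \<omega>) i) * (x k \<omega> (Suc i) - x k \<omega> i) \<partial>M)
          = (\<integral>\<omega>. indicator {\<omega> \<in> space M. holding a b (x k \<omega>) i} \<omega> * (X (grid L k (Suc i)) \<omega> - X (grid L k i) \<omega>) \<partial>M)"
          by (intro Bochner_Integration.integral_cong refl term_eq)
        also have "\<dots> = 0" by (rule martingale[OF grid_mono hold])
        finally show "(\<integral>\<omega>. of_bool (holding a b (x k \<omega>) i) * (x k \<omega> (Suc i) - x k \<omega> i) \<partial>M) = 0" .
      qed
      finally show ?thesis by simp
    qed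
    moreover have "integrable M (G k)" for k
      unfolding G_def using G_int by (intro Bochner_Integration.integrable_sum) auto
    \<comment> \<open>A unit still held at the end is worth at least - K and thus costs at most
      \<open>K + \<bar>a\<bar>\<close> relative to a.\<close>
    moreover have U_le: "(b - a) * real (U k \<omega>) \<le> G k \<omega> + (K + \<bar>a\<bar>)" if "\<omega> \<in> space M" for k \<omega>
    proof -
      have "\<bar>x k \<omega> (n k)\<bar> \<le> K" unfolding x_def using that by (intro K grid) auto
      then show ?thesis
        using upcrossings_gain[OF ab, of "x k \<omega>" "n k"] unfolding U_def G_def by (auto split: if_splits)
    qed
    ultimately have nn: "(\<integral>\<^sup>+\<omega>. ennreal ((b - a) * real (U k \<omega>)) \<partial>M) \<le> ennreal (K + \<bar>a\<bar>)" for k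
    proof -
      have "(\<integral>\<^sup>+\<omega>. ennreal ((b - a) * real (U k \<omega>)) \<partial>M) \<le> (\<integral>\<^sup>+\<omega>. ennreal (G k \<omega> + (K + \<bar>a\<bar>)) \<partial>M)"
        using U_le by (intro nn_integral_mono ennreal_leI) auto
      also have "\<dots> = ennreal (\<integral>\<omega>. G k \<omega> + (K + \<bar>a\<bar>) \<partial>M)"
      proof (rule nn_integral_eq_integral)
        show "integrable M (\<lambda>\<omega>. G k \<omega> + (K + \<bar>a\<bar>))"
          using \<open>\<And>k. integrable M (G k)\<close> by simp
        have "0 \<le> (b - a) * real (U k \<omega>)" for \<omega> using ab by simp
        then show "AE \<omega> in M. 0 \<le> G k \<omega> + (K + \<bar>a\<bar>)"
          using U_le by (intro AE_I2) (metis order_trans)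
      qed
      also have "(\<integral>\<omega>. G k \<omega> + (K + \<bar>a\<bar>) \<partial>M) = K + \<bar>a\<bar>"
        using \<open>\<And>k. integrable M (G k)\<close> \<open>\<And>k. (\<integral>\<omega>. G k \<omega> \<partial>M) = 0\<close> by (simp add: prob_space)
      finally show ?thesis .
    qed
    have "(\<integral>\<^sup>+\<omega>. liminf (\<lambda>k. ennreal ((b - a) * real (U k \<omega>))) \<partial>M) \<le> liminf (\<lambda>k. \<integral>\<^sup>+\<omega>. ennreal ((b - a) * real (U k \<omega>)) \<partial>M)"
      by (rule nn_integral_liminf) measurable
    also have "\<dots> \<le> liminf (\<lambda>k. ennreal (K + \<bar>a\<bar>))"
      using nn by (intro Liminf_mono always_eventually) auto
    also have "\<dots> = ennreal (K + \<bar>a\<bar>)" by (simp add: Liminf_const)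
    finally have "(\<integral>\<^sup>+\<omega>. liminf (\<lambda>k. ennreal ((b - a) * real (U k \<omega>))) \<partial>M) \<noteq> \<infinity>"
      using ennreal_less_top[of "K + \<bar>a\<bar>"] by (auto simp: top_unique)
    then have "AE \<omega> in M. liminf (\<lambda>k. ennreal ((b - a) * real (U k \<omega>))) \<noteq> \<infinity>"
      by (intro nn_integral_PInf_AE) measurable
    then show ?thesis
    proof eventually_elim
      case (elim \<omega>)
      show ?case
      proof (rule ccontr)
        assume "\<nexists>m. \<not> crosses (\<lambda>t. X t \<omega>) dyadics a b (- real L) m (real L)"
        \<comment> \<open>Unlimited crossings would push the counts beyond every m on fine grids, so
          their lower limit would be infinite.\<close>
        then have ev: "\<forall>\<^sub>F k in sequentially. m \<le> U k \<omega>" for m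
          using crosses_imp_upcrossings[OF _ ab, of "\<lambda>t. X t \<omega>" L m "real L"] unfolding U_def x_def n_def by auto
        have "ennreal ((b - a) * real m) \<le> liminf (\<lambda>k. ennreal ((b - a) * real (U k \<omega>)))" for m
          using ev[of m] ab by (intro Liminf_bounded) (auto elim!: eventually_mono intro!: ennreal_leI)
        moreover obtain r where r: "0 \<le> r" "liminf (\<lambda>k. ennreal ((b - a) * real (U k \<omega>))) = ennreal r"
          using elim by (cases "liminf (\<lambda>k. ennreal ((b - a) * real (U k \<omega>)))") auto
        ultimately have le: "(b - a) * real m \<le> r" for m
          by (simp add: ennreal_le_iff)
        obtain m :: nat where "r / (b - a) < real m" using reals_Archimedean2 by blast
        then show False using le[of m] ab by (simp add: field_simps)
      qed
    qed
  qed
  then have "AE \<omega> in M. \<forall>L. \<forall>a\<in>\<rat>. \<forall>b\<in>\<rat>. a < b \<longrightarrow> (\<exists>m. \<not> crosses (\<lambda>t. X t \<omega>) dyadics a b (- real L) m (real L))"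
    unfolding AE_all_countable
    by (intro allI AE_ball_countable[THEN iffD2] countable_rat ballI) (auto simp: AE_ball_countable[OF countable_rat])
  then show ?thesis
    unfolding no_oscillation_def .
qed


section \<open>Functionals on bounded Borel functions\<close>

definition bounded_borel :: "(real \<Rightarrow> real) \<Rightarrow> bool" where
  "bounded_borel g \<longleftrightarrow> g \<in> borel_measurable borel \<and> bounded (range g)"

lemma bounded_borelI: "g \<in> borel_measurable borel \<Longrightarrow> (\<And>x. \<bar>g x\<bar> \<le> K) \<Longrightarrow> bounded_borel g"
  by (auto simp: bounded_borel_def bounded_iff)

lemma bounded_borelE:
  assumes "bounded_borel g"
  obtains K where "g \<in> borel_measurable borel" "0 \<le> K" "\<And>x. \<bar>g x\<bar> \<le> K"
  using assms unfolding bounded_borel_def bounded_iff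
  by (metis abs_ge_zero order_trans rangeI real_norm_def)

lemma bounded_borel_indicator: "C \<in> sets borel \<Longrightarrow> bounded_borel (indicator C)"
  by (rule bounded_borelI[of _ 1]) (auto simp: indicator_def)

lemma bounded_borel_const: "bounded_borel (\<lambda>_. c)"
  by (rule bounded_borelI[of _ "\<bar>c\<bar>"]) auto

lemma bounded_borel_add:
  assumes "bounded_borel f" "bounded_borel g"
  shows "bounded_borel (\<lambda>x. f x + g x)"
proof -
  obtain K where K: "f \<in> borel_measurable borel" "\<And>x. \<bar>f x\<bar> \<le> K" using assms(1) by (elim bounded_borelE) blast
  obtain L where L: "g \<in> borel_measurable borel" "\<And>x. \<bar>g x\<bar> \<le> L" using assms(2) by (elim bounded_borelE) blast
  show ?thesis
  proof (rule bounded_borelI[of _ "K + L"])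
    show "\<bar>f x + g x\<bar> \<le> K + L" for x using K(2)[of x] L(2)[of x] by linarith
  qed (use K L in measurable)
qed

lemma bounded_borel_scale:
  assumes "bounded_borel f"
  shows "bounded_borel (\<lambda>x. c * f x)"
proof -
  obtain K where K: "f \<in> borel_measurable borel" "\<And>x. \<bar>f x\<bar> \<le> K" using assms by (elim bounded_borelE) blast
  show ?thesis
  proof (rule bounded_borelI[of _ "\<bar>c\<bar> * K"])
    show "\<bar>c * f x\<bar> \<le> \<bar>c\<bar> * K" for x using K(2)[of x] by (simp add: abs_mult mult_left_mono)
  qed (use K in measurable)
qed

text \<open>The difference of the two sides of an integral identity, as a function of its test
  function, is meant here. Vanishing on a small class then spreads to all bounded Borel
  functions.\<close>

locale bounded_functional =
  fixes \<Phi> :: "(real \<Rightarrow> real) \<Rightarrow> real"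
  assumes functional_add: "bounded_borel f \<Longrightarrow> bounded_borel g \<Longrightarrow> \<Phi> (\<lambda>x. f x + g x) = \<Phi> f + \<Phi> g"
    and functional_scale: "bounded_borel f \<Longrightarrow> \<Phi> (\<lambda>x. c * f x) = c * \<Phi> f"
    and functional_limit: "(\<And>n. bounded_borel (u n)) \<Longrightarrow> (\<And>n x. \<bar>u n x\<bar> \<le> K) \<Longrightarrow> bounded_borel f \<Longrightarrow>
      (\<And>x. (\<lambda>n. u n x) \<longlonglongrightarrow> f x) \<Longrightarrow> (\<lambda>n. \<Phi> (u n)) \<longlonglongrightarrow> \<Phi> f"
begin

lemma limit_eq_0:
  assumes "\<And>n. bounded_borel (u n)" "\<And>n x. \<bar>u n x\<bar> \<le> K" "bounded_borel f"
    "\<And>x. (\<lambda>n. u n x) \<longlonglongrightarrow> f x" "\<And>n. \<Phi> (u n) = 0"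
  shows "\<Phi> f = 0"
  using functional_limit[OF assms(1-4)] assms(5) by (simp add: LIMSEQ_const_iff)

lemma eq_0_if_indicator:
  assumes ind: "\<And>C. C \<in> sets borel \<Longrightarrow> \<Phi> (indicator C) = 0" and g: "bounded_borel g"
  shows "\<Phi> g = 0"
proof -
  \<comment> \<open>Boundedness stands inside the induction formula because the induction runs
    through all nonnegative Borel functions; each case has to recover it for the smaller
    functions.\<close>
  have nonneg: "bounded_borel h \<longrightarrow> \<Phi> h = 0" if "h \<in> borel_measurable borel" "\<And>x. 0 \<le> h x" for h
    using that
  proof (induction rule: borel_measurable_induct_real)
    case (set A)
    then show ?case by (simp add: ind)
  next
    case (mult u c)
    show ?case
    proof (cases "c = 0")
      case True
      then show ?thesis using functional_scale[OF bounded_borel_const[of 0], of 0] by simp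
    next
      case False
      show ?thesis
      proof
        assume "bounded_borel (\<lambda>x. c * u x)"
        from bounded_borel_scale[OF this, of "inverse c"] False have "bounded_borel u"
          by (simp add: mult.assoc[symmetric])
        with mult show "\<Phi> (\<lambda>x. c * u x) = 0" by (simp add: functional_scale)
      qed
    qed
  next
    case (add u v)
    show ?case
    proof
      assume "bounded_borel (\<lambda>x. v x + u x)"
      then obtain K where K: "\<And>x. \<bar>v x + u x\<bar> \<le> K" by (elim bounded_borelE) blast
      have "\<bar>u x\<bar> \<le> K" "\<bar>v x\<bar> \<le> K" for x
        using K[of x] add.hyps(2)[of x] add.hyps(4)[of x] by linarith+
      then have "bounded_borel u" "bounded_borel v"
        using add.hyps(1,3) by (auto intro: bounded_borelI)
      with add.IH show "\<Phi> (\<lambda>x. v x + u x) = 0" by (simp add: functional_add)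
    qed
  next
    case (seq U)
    show ?case
    proof
      assume h: "bounded_borel h"
      then obtain K where K: "\<And>x. \<bar>h x\<bar> \<le> K" by (elim bounded_borelE) blast
      have "U i x \<le> h x" for i x
      proof (rule incseq_le)
        show "incseq (\<lambda>i. U i x)" using seq.hyps(3) by (auto simp: incseq_def le_fun_def)
        show "(\<lambda>i. U i x) \<longlonglongrightarrow> h x" using seq.hyps(4)[of x] by simp
      qed
      note le = this
      have UK: "\<bar>U i x\<bar> \<le> K" for i x
        using seq(2)[of i x] K[of x] le[of i x] by linarith
      then have U: "bounded_borel (U i)" for i using seq(1) by (intro bounded_borelI[of _ K])
      show "\<Phi> h = 0"
        by (rule limit_eq_0[OF U UK h]) (use seq U in auto)
    qed
  qed
  obtain K where K: "g \<in> borel_measurable borel" "\<And>x. \<bar>g x\<bar> \<le> K" using g by (elim bounded_borelE) blast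
  \<comment> \<open>Adding the bound K makes g nonnegative; the constant K is subtracted again by
    linearity.\<close>
  have 1: "bounded_borel (\<lambda>x. g x + K)" by (intro bounded_borel_add g bounded_borel_const)
  have "\<Phi> (\<lambda>x. g x + K) = 0"
  proof (rule nonneg[rule_format, OF _ _ 1])
    show "0 \<le> g x + K" for x using K(2)[of x] by linarith
  qed (use K in measurable)
  moreover have "\<Phi> (\<lambda>x. K) = 0"
  proof -
    have "0 \<le> K" using K(2)[of 0] by linarith
    then show ?thesis by (intro nonneg[rule_format] bounded_borel_const) auto
  qed
  ultimately show ?thesis using functional_add[OF g bounded_borel_const[of K]] by simp
qed

text \<open>Half-lines form an intersection-stable generator of the Borel sets, and their indicators
  are bounded limits of continuous ramps. A Dynkin argument reaches all indicators.\<close>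

lemma eq_0_if_continuous:
  assumes cont: "\<And>h. continuous_on UNIV h \<Longrightarrow> bounded_borel h \<Longrightarrow> \<Phi> h = 0" and g: "bounded_borel g"
  shows "\<Phi> g = 0"
proof (rule eq_0_if_indicator[OF _ g])
  have one: "\<Phi> (\<lambda>_. 1) = 0" by (intro cont bounded_borel_const continuous_intros)
  fix C :: "real set" assume "C \<in> sets borel"
  then have C: "C \<in> sigma_sets UNIV (range (\<lambda>a. {..a}))"
    by (simp add: borel_eq_atMost)
  have stable: "Int_stable (range (\<lambda>a::real. {..a}))"
  proof (rule Int_stableI_image)
    fix a b :: real
    show "\<exists>c\<in>UNIV. {..a} \<inter> {..b} = {..c}"
      by (intro bexI[of _ "min a b"]) auto
  qed
  have sub: "range (\<lambda>a::real. {..a}) \<subseteq> Pow UNIV" by simp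
  from stable sub C show "\<Phi> (indicator C) = 0"
  proof (induction rule: sigma_sets_induct_disjoint)
    case (basic A)
    then obtain a where A: "A = {..a}" by auto
    \<comment> \<open>The ramp is 1 up to a, falls with slope - n, and is 0 from a + 1/n on.\<close>
    define h where "h n x = max 0 (min 1 (1 - real n * (x - a)))" for n x
    have h01: "\<bar>h n x\<bar> \<le> 1" for n x by (auto simp: h_def)
    have hc: "continuous_on UNIV (h n)" for n unfolding h_def by (intro continuous_intros)
    have hb: "bounded_borel (h n)" for n
      using h01 by (intro bounded_borelI[of _ 1] borel_measurable_continuous_onI[OF hc])
    have A_ind: "bounded_borel (indicator A)" unfolding A by (intro bounded_borel_indicator) simp
    show ?case
    proof (rule limit_eq_0[OF hb h01 A_ind])
      fix x
      show "(\<lambda>n. h n x) \<longlonglongrightarrow> indicator A x"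
      proof (cases "x \<le> a")
        case True
        then have "h n x = 1" for n
          using mult_nonneg_nonpos[of "real n" "x - a"] by (auto simp: h_def)
        then show ?thesis using True by (simp add: A)
      next
        case False
        obtain n0 :: nat where n0: "1 / (x - a) < real n0" using reals_Archimedean2 by blast
        have "h n x = 0" if "n0 \<le> n" for n
        proof -
          have "1 < real n0 * (x - a)" using n0 False by (simp add: field_simps)
          also have "\<dots> \<le> real n * (x - a)" using that False by (intro mult_right_mono) auto
          finally show ?thesis by (simp add: h_def)
        qed
        then show ?thesis
          using False by (intro tendsto_eventually) (auto simp: A eventually_sequentially)
      qed
    qed (rule cont[OF hc hb])
  next
    case empty
    then show ?case using cont[OF continuous_on_const bounded_borel_const[of 0]] by simp
  next
    case (compl A)
    then have A: "A \<in> sets borel" by (simp add: borel_eq_atMost)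
    have "indicator (UNIV - A) = (\<lambda>x. 1 + (- 1) * indicator A x :: real)"
      by (auto simp: indicator_def fun_eq_iff)
    then show ?case
      using compl one functional_add[OF bounded_borel_const[of 1] bounded_borel_scale[OF bounded_borel_indicator[OF A], of "-1"]]
        functional_scale[OF bounded_borel_indicator[OF A], of "-1"] by simp
  next
    case (union A)
    then have A: "A i \<in> sets borel" for i by (auto simp: borel_eq_atMost)
    have fin: "\<Phi> (\<lambda>x. \<Sum>i<n. indicator (A i) x) = 0 \<and> bounded_borel (\<lambda>x. \<Sum>i<n. indicator (A i) x)" for n
    proof (induction n)
      case 0
      then show ?case using cont[OF continuous_on_const bounded_borel_const[of 0]] bounded_borel_const[of 0] by simp
    next
      case (Suc n)
      then show ?case
        using functional_add[of "\<lambda>x. \<Sum>i<n. indicator (A i) x" "indicator (A n)"] bounded_borel_indicator[OF A[of n]]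
          bounded_borel_add[of "\<lambda>x. \<Sum>i<n. indicator (A i) x" "indicator (A n)"] union.IH[of n] by simp
    qed
    have sums: "(\<lambda>i. indicator (A i) x :: real) sums indicator (\<Union>i. A i) x" for x
      by (rule indicator_sums) (use union(1) in \<open>auto simp: disjoint_family_on_def\<close>)
    show ?case
    proof (rule limit_eq_0[where u="\<lambda>n x. \<Sum>i<n. indicator (A i) x" and K=1])
      show "\<bar>\<Sum>i<n. indicator (A i) x\<bar> \<le> (1::real)" for n x
      proof -
        have "(\<Sum>i<n. indicator (A i) x) \<le> (\<Sum>i. indicator (A i) x :: real)"
          by (rule sum_le_suminf[OF sums_summable[OF sums]]) auto
        also have "\<dots> = indicator (\<Union>i. A i) x" using sums by (simp add: sums_iff)
        also have "\<dots> \<le> (1::real)" by (rule indicator_le_1)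
        finally have "(\<Sum>i<n. indicator (A i) x) \<le> (1::real)" .
        moreover have "0 \<le> (\<Sum>i<n. indicator (A i) x :: real)" by (intro sum_nonneg) auto
        ultimately show ?thesis by linarith
      qed
      show "(\<lambda>n. \<Sum>i<n. indicator (A i) x) \<longlonglongrightarrow> (indicator (\<Union>i. A i) x :: real)" for x
        using sums[of x] by (simp add: sums_def)
      show "bounded_borel (indicator (\<Union>i. A i))"
        using A by (intro bounded_borel_indicator) auto
    qed (use fin in auto)
  qed
qed

end


section \<open>The \<open>q\<close>-Hermite basis\<close>

inductive qspan :: "real \<Rightarrow> (real \<Rightarrow> real) \<Rightarrow> bool" for q where
  zero: "qspan q (\<lambda>_. 0)"
| add: "qspan q f \<Longrightarrow> qspan q (\<lambda>x. f x + c * qh q n x)"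

lemma qspan_basis: "qspan q (\<lambda>x. c * qh q n x)"
  using qspan.add[OF qspan.zero, of q c n] by simp

lemma qspan_plus:
  assumes "qspan q g" "qspan q f" shows "qspan q (\<lambda>x. f x + g x)"
  using assms
proof (induction rule: qspan.induct)
  case (add g c n)
  then have "qspan q (\<lambda>x. (f x + g x) + c * qh q n x)" by (intro qspan.add)
  then show ?case by (simp add: add.assoc)
qed simp

lemma qspan_scale:
  assumes "qspan q f" shows "qspan q (\<lambda>x. c * f x)"
  using assms
proof (induction rule: qspan.induct)
  case (add f d n)
  then have "qspan q (\<lambda>x. c * f x + (c * d) * qh q n x)" by (intro qspan.add)
  then show ?case by (simp add: algebra_simps)
qed (simp add: qspan.zero)

text \<open>At \<open>n = 0\<close> the last term vanishes because \<open>qint q 0 = 0\<close>.\<close>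

lemma qh_times_x:
  assumes "\<bar>q\<bar> < 1"
  shows "x * qh q n x = sqrt (qint q (Suc n)) * qh q (Suc n) x + sqrt (qint q n) * qh q (n - 1) x"
proof (cases n)
  case 0
  then show ?thesis by (simp add: qh_def qfact_Suc qint_def)
next
  case (Suc m)
  then show ?thesis using qh_recurrence[OF assms, of x m] by simp
qed

lemma qspan_times_x:
  assumes q: "\<bar>q\<bar> < 1" and "qspan q f" shows "qspan q (\<lambda>x. x * f x)"
  using assms(2)
proof (induction rule: qspan.induct)
  case (add f c n)
  have "x * (f x + c * qh q n x) = (x * f x + (c * sqrt (qint q (Suc n))) * qh q (Suc n) x)
      + (c * sqrt (qint q n)) * qh q (n - 1) x" for x
    using qh_times_x[OF q, of x n] by (simp add: algebra_simps)
  then show ?case by (auto intro!: qspan.add add.IH)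
qed (simp add: qspan.zero)

lemma real_polynomial_function_qspan:
  assumes q: "\<bar>q\<bar> < 1" and p: "real_polynomial_function (p :: real \<Rightarrow> real)"
  shows "qspan q p"
proof -
  \<comment> \<open>Strengthened to multiplication by p inside the span: products of polynomials
    then follow by applying the induction hypothesis twice, and only multiplication by x has to be
    checked.\<close>
  have "qspan q (\<lambda>x. p x * f x)" if "qspan q f" for f
    using p that
  proof (induction p arbitrary: f rule: real_polynomial_function.induct)
    case (linear p)
    obtain c where "p = (\<lambda>x. x * c)"
      using linear.hyps real_bounded_linear by blast
    then have "(\<lambda>x. p x * f x) = (\<lambda>x. c * (x * f x))" by (simp add: fun_eq_iff)
    then show ?case using qspan_scale[OF qspan_times_x[OF q linear.prems]] by simp
  next
    case (const c)
    then show ?case by (rule qspan_scale)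
  next
    case (add f g)
    then show ?case by (simp add: distrib_right qspan_plus)
  next
    case (mult f g)
    then show ?case by (simp add: mult.assoc)
  qed
  from this[OF qspan_basis[of q 1 0]] show ?thesis by simp
qed

lemma qspan_approx:
  assumes q: "\<bar>q\<bar> < 1" and f: "continuous_on (state_space q) f" and \<epsilon>: "0 < \<epsilon>"
  obtains p where "qspan q p" "\<And>x. x \<in> state_space q \<Longrightarrow> \<bar>f x - p x\<bar> < \<epsilon>"
proof -
  have "compact (state_space q)" by (simp add: state_space_def)
  from Stone_Weierstrass_real_polynomial_function[OF this f \<epsilon>]
  obtain p where "real_polynomial_function p" "\<And>x. x \<in> state_space q \<Longrightarrow> \<bar>f x - p x\<bar> < \<epsilon>" by blast
  then show ?thesis using that real_polynomial_function_qspan[OF q] by blast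
qed

lemma continuous_on_qspan: "qspan q f \<Longrightarrow> continuous_on A f"
  by (induction rule: qspan.induct) (auto intro!: continuous_intros continuous_on_qh)

section \<open>Measurability and integration on the state space\<close>

lemma space_qN_measure [simp]: "space (qN_measure q) = state_space q"
  by (simp add: qN_measure_def space_restrict_space)

lemma sets_qN_measure: "sets (qN_measure q) = sets (restrict_space borel (state_space q))"
  unfolding qN_measure_def sets_density by (rule sets_restrict_space_cong) simp

lemma borel_measurable_qN_measureI: "f \<in> borel_measurable borel \<Longrightarrow> f \<in> borel_measurable (qN_measure q)"
  by (subst measurable_cong_sets[OF sets_qN_measure refl]) (rule measurable_restrict_space1)

lemma borel_measurable_continuous_qN_measure:
  "continuous_on (state_space q) f \<Longrightarrow> f \<in> borel_measurable (qN_measure q)"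
  by (subst measurable_cong_sets[OF sets_qN_measure refl]) (rule borel_measurable_continuous_on_restrict)

lemma state_space_borel [measurable]: "state_space q \<in> sets borel"
  by (simp add: state_space_def)

lemma borel_measurable_extend_0:
  assumes "f \<in> borel_measurable (qN_measure q)"
  shows "(\<lambda>x. if x \<in> state_space q then f x else 0) \<in> borel_measurable borel"
proof -
  have "f \<in> borel_measurable (restrict_space borel (state_space q))"
    using assms measurable_cong_sets[OF sets_qN_measure refl] by blast
  then show ?thesis
    by (intro measurable_If_restrict_space_iff[THEN iffD2]) auto
qed

lemma state_space_nonempty:
  assumes "\<bar>q\<bar> < 1" shows "0 \<in> state_space q"
  using assms by (auto simp: state_space_def)

lemma state_space_bounded_by_continuous:
  fixes f :: "real \<Rightarrow> real"
  assumes "continuous_on (state_space q) f"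
  shows "\<exists>K. \<forall>x\<in>state_space q. \<bar>f x\<bar> \<le> K"
proof -
  have "compact (f ` state_space q)"
    using assms by (intro compact_continuous_image) (auto simp: state_space_def)
  then have "bounded (f ` state_space q)" by (rule compact_imp_bounded)
  then show ?thesis by (auto simp: bounded_iff)
qed

lemma qh_bounded_state_space: "\<exists>K. \<forall>x\<in>state_space q. \<bar>qh q n x\<bar> \<le> K"
  by (rule state_space_bounded_by_continuous[OF continuous_on_qh])

text \<open>Measurability and total mass of \<open>f_N\<close> are assumed here;
  \<open>OU_process_q_density\<close> obtains them from the marginal law.\<close>

locale q_density =
  fixes q :: real
  assumes q: "\<bar>q\<bar> < 1"
    and f_N_measurable: "(\<lambda>x. f_N x q) \<in> borel_measurable borel"
    and prob_qN: "prob_space (qN_measure q)"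
begin

abbreviation S :: "real set" where "S \<equiv> state_space q"
abbreviation N :: "real measure" where "N \<equiv> qN_measure q"

lemma integrable_bounded_N:
  fixes f :: "real \<Rightarrow> real"
  assumes "f \<in> borel_measurable N" "\<And>x. x \<in> S \<Longrightarrow> \<bar>f x\<bar> \<le> K"
  shows "integrable N f"
proof -
  interpret N: prob_space N by (rule prob_qN)
  show ?thesis using assms by (intro N.integrable_const_bound[where B=K]) auto
qed

lemma integrable_continuous_N:
  fixes f :: "real \<Rightarrow> real"
  assumes "continuous_on S f" shows "integrable N f"
  using state_space_bounded_by_continuous[OF assms] borel_measurable_continuous_qN_measure[OF assms]
  by (auto intro: integrable_bounded_N)

lemma integral_N:
  assumes "f \<in> borel_measurable N"
  shows "(\<integral>x. f x \<partial>N) = (LINT x:S|lborel. f x * f_N x q)"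
proof -
  have S: "S \<inter> space lborel \<in> sets lborel" by simp
  have f: "f \<in> borel_measurable (restrict_space lborel S)"
    using assms by (simp add: qN_measure_def)
  have fN: "(\<lambda>x. f_N x q) \<in> borel_measurable (restrict_space lborel S)"
    using f_N_measurable by (intro measurable_restrict_space1) simp
  have "(\<integral>x. f x \<partial>N) = (\<integral>x. f_N x q * f x \<partial>restrict_space lborel S)"
    unfolding qN_measure_def using f fN f_N_nonneg[OF q] by (subst integral_density) auto
  also have "\<dots> = (LINT x:S|lborel. f_N x q * f x)"
    by (subst integral_restrict_space[OF S]) (simp add: set_lebesgue_integral_def)
  finally show ?thesis by (simp add: mult.commute)
qed

lemma integrable_N:
  assumes "f \<in> borel_measurable N"
  shows "integrable N f \<longleftrightarrow> set_integrable lborel S (\<lambda>x. f x * f_N x q)"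
proof -
  have S: "S \<inter> space lborel \<in> sets lborel" by simp
  have f: "f \<in> borel_measurable (restrict_space lborel S)"
    using assms by (simp add: qN_measure_def)
  have fN: "(\<lambda>x. f_N x q) \<in> borel_measurable (restrict_space lborel S)"
    using f_N_measurable by (intro measurable_restrict_space1) simp
  have "integrable N f \<longleftrightarrow> integrable (restrict_space lborel S) (\<lambda>x. f_N x q * f x)"
    unfolding qN_measure_def using f fN f_N_nonneg[OF q] by (subst integrable_density) auto
  also have "\<dots> \<longleftrightarrow> set_integrable lborel S (\<lambda>x. f_N x q * f x)"
    by (subst integrable_restrict_space[OF S]) (simp add: set_integrable_def)
  finally show ?thesis by (simp add: mult.commute)
qed

lemma uniform_limit_mehler:
  assumes \<rho>: "\<bar>\<rho>\<bar> < 1" and y: "y \<in> S"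
  shows "uniform_limit S (\<lambda>n x. \<Sum>j<n. \<rho> ^ j * (qh q j x * qh q j y)) (\<lambda>x. mehler q \<rho> x y) sequentially"
proof -
  obtain C where C: "\<And>n \<rho> x y. x \<in> S \<Longrightarrow> y \<in> S \<Longrightarrow> \<bar>\<rho> ^ n * (qh q n x * qh q n y)\<bar> \<le> C * ((real n + 1)\<^sup>2 * \<bar>\<rho>\<bar> ^ n)"
    using mehler_majorant[OF q] by metis
  show ?thesis
    unfolding mehler_def
    using y \<rho> by (intro Weierstrass_m_test[where M="\<lambda>n. C * ((real n + 1)\<^sup>2 * \<bar>\<rho>\<bar> ^ n)"])
      (auto intro!: C summable_mult summable_quadratic_geometric)
qed

lemma continuous_on_mehler:
  assumes \<rho>: "\<bar>\<rho>\<bar> < 1" and y: "y \<in> S"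
  shows "continuous_on S (\<lambda>x. mehler q \<rho> x y)"
  by (rule uniform_limit_theorem[OF _ uniform_limit_mehler[OF \<rho> y]])
    (auto intro!: always_eventually continuous_intros continuous_on_qh)

text \<open>Integration term by term. On the state space the terms are dominated by |f| times a
  summable constant, so plain integrability of f suffices.\<close>

lemma mehler_integral_sums:
  assumes \<rho>: "\<bar>\<rho>\<bar> < 1" and f: "integrable N f" and y: "y \<in> S"
  shows "integrable N (\<lambda>x. f x * mehler q \<rho> x y)"
    and "(\<lambda>j. \<rho> ^ j * (\<integral>x. f x * qh q j x \<partial>N) * qh q j y) sums (\<integral>x. f x * mehler q \<rho> x y \<partial>N)"
proof -
  interpret N: prob_space N by (rule prob_qN)
  obtain K where K: "\<And>x. x \<in> S \<Longrightarrow> \<bar>mehler q \<rho> x y\<bar> \<le> K"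
    using state_space_bounded_by_continuous[OF continuous_on_mehler[OF \<rho> y]] by blast
  have f_meas [measurable]: "f \<in> borel_measurable N" by (rule borel_measurable_integrable[OF f])
  have m_meas [measurable]: "(\<lambda>x. mehler q \<rho> x y) \<in> borel_measurable N"
    by (rule borel_measurable_continuous_qN_measure[OF continuous_on_mehler[OF \<rho> y]])
  have e_measurable [measurable]: "qh q n \<in> borel_measurable N" for n
    by (intro borel_measurable_continuous_qN_measure continuous_on_qh)
  have "integrable N (\<lambda>x. \<bar>f x\<bar> * K)" using f by simp
  then show "integrable N (\<lambda>x. f x * mehler q \<rho> x y)"
  proof (rule Bochner_Integration.integrable_bound)
    show "AE x in N. norm (f x * mehler q \<rho> x y) \<le> norm (\<bar>f x\<bar> * K)"
      by (intro AE_I2) (auto simp: abs_mult intro!: mult_left_mono order_trans[OF K abs_ge_self])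
  qed measurable
  obtain C where C: "\<And>n \<rho> x y. x \<in> S \<Longrightarrow> y \<in> S \<Longrightarrow> \<bar>\<rho> ^ n * (qh q n x * qh q n y)\<bar> \<le> C * ((real n + 1)\<^sup>2 * \<bar>\<rho>\<bar> ^ n)"
    using mehler_majorant[OF q] by metis
  define M where "M n = C * ((real n + 1)\<^sup>2 * \<bar>\<rho>\<bar> ^ n)" for n
  have M: "summable M"
    unfolding M_def using \<rho> by (intro summable_mult summable_quadratic_geometric) auto
  define u where "u j x = f x * (\<rho> ^ j * (qh q j x * qh q j y))" for j x
  have u_le: "norm (u j x) \<le> \<bar>f x\<bar> * M j" if "x \<in> S" for j x
    unfolding u_def M_def using C[OF that y, of \<rho> j] by (simp add: abs_mult mult_left_mono)
  have u_int: "integrable N (u j)" for j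
  proof (rule Bochner_Integration.integrable_bound)
    show "integrable N (\<lambda>x. \<bar>f x\<bar> * M j)" using f by simp
    show "u j \<in> borel_measurable N" unfolding u_def by measurable
    show "AE x in N. norm (u j x) \<le> norm (\<bar>f x\<bar> * M j)"
      using u_le by (intro AE_I2) (auto intro: order_trans[OF _ abs_ge_self])
  qed
  have "(\<lambda>j. \<integral>x. u j x \<partial>N) sums (\<integral>x. (\<Sum>j. u j x) \<partial>N)"
  proof (rule sums_integral[OF u_int])
    show "AE x in N. summable (\<lambda>j. norm (u j x))"
    proof (rule AE_I2)
      fix x assume "x \<in> space N"
      then show "summable (\<lambda>j. norm (u j x))"
        using u_le[of x] by (intro summable_comparison_test'[OF summable_mult[OF M, of "\<bar>f x\<bar>"]]) auto
    qed
    show "summable (\<lambda>j. \<integral>x. norm (u j x) \<partial>N)"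
    proof (rule summable_comparison_test'[OF summable_mult[OF M, of "\<integral>x. \<bar>f x\<bar> \<partial>N"]])
      fix j
      have "(\<integral>x. norm (u j x) \<partial>N) \<le> (\<integral>x. \<bar>f x\<bar> * M j \<partial>N)"
        using u_int[of j] f u_le by (intro integral_mono) auto
      then show "norm (\<integral>x. norm (u j x) \<partial>N) \<le> (\<integral>x. \<bar>f x\<bar> \<partial>N) * M j" by simp
    qed
  qed
  moreover have "(\<integral>x. u j x \<partial>N) = \<rho> ^ j * (\<integral>x. f x * qh q j x \<partial>N) * qh q j y" for j
  proof -
    have "u j x = (\<rho> ^ j * qh q j y) * (f x * qh q j x)" for x by (simp add: u_def)
    then show ?thesis by simp
  qed
  moreover have "(\<integral>x. (\<Sum>j. u j x) \<partial>N) = (\<integral>x. f x * mehler q \<rho> x y \<partial>N)"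
    unfolding u_def mehler_def using summable_mehler[OF q \<rho> _ y]
    by (intro Bochner_Integration.integral_cong refl suminf_mult) simp
  ultimately show "(\<lambda>j. \<rho> ^ j * (\<integral>x. f x * qh q j x \<partial>N) * qh q j y) sums (\<integral>x. f x * mehler q \<rho> x y \<partial>N)" by simp
qed

end

text \<open>The vanishing means are the only input about integrals of the polynomials;
  \<open>OU_process_q_hermite\<close> derives them from the conditional densities.\<close>

locale q_hermite = q_density +
  assumes qh_mean: "0 < n \<Longrightarrow> (\<integral>x. qh q n x \<partial>qN_measure q) = 0"
begin

text \<open>Multiplication by x is symmetric under the integral, so the recurrence expresses row m +
  1 of the Gram matrix through rows m and m - 1. The means give row 0, and the induction carries two
  consecutive rows.\<close>

lemma qh_orthonormal: "(\<integral>x. qh q m x * qh q n x \<partial>N) = (if m = n then 1 else 0)"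
proof -
  interpret N: prob_space N by (rule prob_qN)
  define I where "I m n = (\<integral>x. qh q m x * qh q n x \<partial>N)" for m n
  define s where "s n = sqrt (qint q n)" for n
  have s0: "s 0 = 0" and spos: "0 < s (Suc n)" for n
    using qint_pos[OF q, of "Suc n"] by (auto simp: s_def) (simp add: qint_def)
  have int: "integrable N (\<lambda>x. qh q m x * qh q n x)" for m n
    by (intro integrable_continuous_N continuous_intros continuous_on_qh)
  have rec: "s (Suc m) * I (Suc m) n = s (Suc n) * I m (Suc n) + s n * I m (n - 1) - s m * I (m - 1) n" for m n
  proof -
    have "s (Suc m) * I (Suc m) n + s m * I (m - 1) n
        = (\<integral>x. (s (Suc m) * qh q (Suc m) x + s m * qh q (m - 1) x) * qh q n x \<partial>N)"
      unfolding I_def using int by (simp add: distrib_right mult.assoc)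
    also have "\<dots> = (\<integral>x. (x * qh q m x) * qh q n x \<partial>N)"
      unfolding s_def qh_times_x[OF q, symmetric] ..
    also have "\<dots> = (\<integral>x. qh q m x * (x * qh q n x) \<partial>N)"
      by (simp add: mult_ac)
    also have "\<dots> = (\<integral>x. qh q m x * (s (Suc n) * qh q (Suc n) x + s n * qh q (n - 1) x) \<partial>N)"
      unfolding s_def qh_times_x[OF q, symmetric] ..
    also have "\<dots> = (\<integral>x. s (Suc n) * (qh q m x * qh q (Suc n) x) + s n * (qh q m x * qh q (n - 1) x) \<partial>N)"
      by (simp add: algebra_simps)
    also have "\<dots> = s (Suc n) * I m (Suc n) + s n * I m (n - 1)"
      unfolding I_def using int by simp
    finally show ?thesis by simp
  qed
  have "(\<forall>n. I m n = (if m = n then 1 else 0)) \<and> (\<forall>n. I (Suc m) n = (if Suc m = n then 1 else 0))" for m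
  proof (induction m)
    case 0
    have I0: "I 0 n = (if 0 = n then 1 else 0)" for n
      using qh_mean[of n] using N.prob_space by (auto simp: I_def)
    have "I (Suc 0) n = (if Suc 0 = n then 1 else 0)" for n
      using rec[of 0 n] spos[of 0] spos[of "n - 1"] unfolding I0 s0 by (cases n) (auto simp: s0)
    then show ?case using I0 by blast
  next
    case (Suc m)
    have "I (Suc (Suc m)) n = (if Suc (Suc m) = n then 1 else 0)" for n
    proof -
      have "s (Suc (Suc m)) * I (Suc (Suc m)) n = s (Suc (Suc m)) * (if Suc (Suc m) = n then 1 else 0)"
        using rec[of "Suc m" n] Suc by (cases n) (auto simp: s0)
      then show ?thesis using spos[of "Suc m"] by simp
    qed
    then show ?case using Suc by blast
  qed
  then show ?thesis unfolding I_def by blast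
qed

text \<open>Testing against g is a bounded functional that vanishes on the span, hence on continuous
  functions by uniform approximation, hence on bounded Borel functions, in particular on the sign of
  g.\<close>

lemma qh_complete:
  assumes g: "g \<in> L2_space N" and orth: "\<And>n. (\<integral>x. g x * qh q n x \<partial>N) = 0"
  shows "AE x in N. g x = 0"
proof -
  interpret N: prob_space N by (rule prob_qN)
  define \<Phi> where "\<Phi> h = (\<integral>x. g x * h x \<partial>N)" for h
  have g_int: "integrable N g" by (rule N.L2_space_integrable[OF g])
  have g_meas [measurable]: "g \<in> borel_measurable N" by (rule L2_spaceD[OF g])
  have int: "integrable N (\<lambda>x. g x * h x)" if "h \<in> borel_measurable N" "\<And>x. x \<in> S \<Longrightarrow> \<bar>h x\<bar> \<le> K" for h K
    using that by (intro L2_space_mult_integrable[OF g] N.bounded_imp_L2_space) auto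
  have intb: "integrable N (\<lambda>x. g x * h x)" if "bounded_borel h" for h
  proof -
    obtain K where "h \<in> borel_measurable borel" "\<And>x. \<bar>h x\<bar> \<le> K" using \<open>bounded_borel h\<close> by (elim bounded_borelE) blast
    then show ?thesis by (intro int borel_measurable_qN_measureI) auto
  qed
  interpret bounded_functional \<Phi>
  proof
    show "\<Phi> (\<lambda>x. f x + h x) = \<Phi> f + \<Phi> h" if "bounded_borel f" "bounded_borel h" for f h
      unfolding \<Phi>_def distrib_left using intb[OF that(1)] intb[OF that(2)] by simp
    show "\<Phi> (\<lambda>x. c * f x) = c * \<Phi> f" for f c
      unfolding \<Phi>_def by (simp add: mult.left_commute)
    show "(\<lambda>n. \<Phi> (u n)) \<longlonglongrightarrow> \<Phi> f"
      if u: "\<And>n. bounded_borel (u n)" "\<And>n x. \<bar>u n x\<bar> \<le> K" "bounded_borel f" "\<And>x. (\<lambda>n. u n x) \<longlonglongrightarrow> f x" for u K f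
      unfolding \<Phi>_def
    proof (rule integral_dominated_convergence[where w="\<lambda>x. \<bar>g x\<bar> * K"])
      show "integrable N (\<lambda>x. \<bar>g x\<bar> * K)" using g_int by simp
      show "AE x in N. (\<lambda>n. g x * u n x) \<longlonglongrightarrow> g x * f x" by (intro AE_I2 tendsto_intros u)
      show "AE x in N. norm (g x * u n x) \<le> \<bar>g x\<bar> * K" for n
        by (intro AE_I2) (auto simp: abs_mult intro!: mult_left_mono u)
    qed (rule borel_measurable_integrable[OF intb[OF u(1)]] borel_measurable_integrable[OF intb[OF u(3)]])+
  qed
  have span: "\<Phi> p = 0" if "qspan q p" for p
    using that
  proof (induction rule: qspan.induct)
    case (add p c n)
    have intc: "integrable N (\<lambda>x. g x * h x)" if "continuous_on S h" for h
      using state_space_bounded_by_continuous[OF that] borel_measurable_continuous_qN_measure[OF that]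
      by (auto intro: int)
    have "\<Phi> (\<lambda>x. p x + c * qh q n x) = (\<integral>x. g x * p x + c * (g x * qh q n x) \<partial>N)"
      unfolding \<Phi>_def by (simp add: algebra_simps)
    also have "\<dots> = \<Phi> p + c * (\<integral>x. g x * qh q n x \<partial>N)"
      unfolding \<Phi>_def using intc[OF continuous_on_qspan[OF add.hyps]] intc[OF continuous_on_qh[of _ q n]] by simp
    finally show ?case using add.IH orth by simp
  qed (simp add: \<Phi>_def)
  have cont: "\<Phi> h = 0" if h: "continuous_on UNIV h" "bounded_borel h" for h
  proof -
    have "\<bar>\<Phi> h\<bar> \<le> (\<integral>x. \<bar>g x\<bar> \<partial>N) * \<epsilon>" if \<epsilon>: "0 < \<epsilon>" for \<epsilon>
    proof -
      obtain p where p: "qspan q p" "\<And>x. x \<in> S \<Longrightarrow> \<bar>h x - p x\<bar> < \<epsilon>"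
        using qspan_approx[OF q continuous_on_subset[OF h(1)] \<epsilon>] by blast
      have pc: "continuous_on S p" by (rule continuous_on_qspan[OF p(1)])
      have ip: "integrable N (\<lambda>x. g x * p x)"
        using state_space_bounded_by_continuous[OF pc] borel_measurable_continuous_qN_measure[OF pc]
        by (auto intro: int)
      have "\<Phi> h = \<Phi> h - \<Phi> p" using span[OF p(1)] by simp
      also have "\<dots> = (\<integral>x. g x * h x - g x * p x \<partial>N)"
        unfolding \<Phi>_def using ip intb[OF h(2)] by simp
      also have "norm \<dots> \<le> (\<integral>x. \<bar>g x\<bar> * \<epsilon> \<partial>N)"
      proof (rule order_trans[OF integral_norm_bound integral_mono])
        show "integrable N (\<lambda>x. norm (g x * h x - g x * p x))" using ip intb[OF h(2)] by simp
        show "integrable N (\<lambda>x. \<bar>g x\<bar> * \<epsilon>)" using g_int by simp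
        show "norm (g x * h x - g x * p x) \<le> \<bar>g x\<bar> * \<epsilon>" if "x \<in> space N" for x
          unfolding right_diff_distrib[symmetric] real_norm_def abs_mult
          using p(2)[of x] that by (intro mult_left_mono) auto
      qed
      finally show ?thesis by simp
    qed
    note bound = this
    have "\<bar>\<Phi> h\<bar> \<le> 0"
    proof (rule field_le_epsilon)
      fix \<epsilon> :: real assume \<epsilon>: "0 < \<epsilon>"
      define G where "G = (\<integral>x. \<bar>g x\<bar> \<partial>N)"
      have "0 \<le> G" by (simp add: G_def)
      have "\<bar>\<Phi> h\<bar> \<le> G * (\<epsilon> / (G + 1))"
      proof -
        have "0 < \<epsilon> / (G + 1)" using \<epsilon> \<open>0 \<le> G\<close> by simp
        from bound[OF this] show ?thesis by (simp only: G_def)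
      qed
      also have "\<dots> \<le> \<epsilon>" using \<epsilon> \<open>0 \<le> G\<close> by (simp add: field_simps)
      finally show "\<bar>\<Phi> h\<bar> \<le> 0 + \<epsilon>" by simp
    qed
    then show ?thesis by simp
  qed
  \<comment> \<open>With this test function the integral of \<open>g * h\<close> is that of |g|. The
    value 0 off the state space makes it a Borel function on the line.\<close>
  define h where "h x = (if x \<in> S then sgn (g x) else 0)" for x
  have "h \<in> borel_measurable borel"
    unfolding h_def by (rule borel_measurable_extend_0) measurable
  then have "bounded_borel h"
    by (rule bounded_borelI[of _ 1]) (auto simp: h_def sgn_if)
  from eq_0_if_continuous[OF cont this] have "(\<integral>x. g x * h x \<partial>N) = 0" by (simp add: \<Phi>_def)
  also have "(\<integral>x. g x * h x \<partial>N) = (\<integral>x. \<bar>g x\<bar> \<partial>N)"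
    by (intro Bochner_Integration.integral_cong) (auto simp: h_def abs_sgn)
  finally have "AE x in N. \<bar>g x\<bar> = 0"
    using g_int by (subst (asm) integral_nonneg_eq_0_iff_AE) auto
  then show ?thesis by simp
qed

sublocale orthonormal_basis N "qh q"
proof (unfold orthonormal_basis_def orthonormal_basis_axioms_def, intro conjI prob_qN allI impI)
  show "qh q n \<in> borel_measurable N" for n
    by (intro borel_measurable_continuous_qN_measure continuous_on_qh)
  show "\<exists>C. \<forall>x\<in>space N. \<bar>qh q n x\<bar> \<le> C" for n
    using qh_bounded_state_space by simp
  show "(\<integral>x. qh q m x * qh q n x \<partial>N) = (if m = n then 1 else 0)" for m n
    by (rule qh_orthonormal)
  show "AE x in N. f x = 0" if "f \<in> L2_space N" "\<forall>n. (\<integral>x. f x * qh q n x \<partial>N) = 0" for f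
    using that by (intro qh_complete) auto
qed

lemma hermite_expansion_eq: "hermite_expansion q f b \<longleftrightarrow> expansion f b"
  unfolding hermite_expansion_def expansion_def by (simp add: qh_def)

lemma B_space_eq: "B_space q = L2_space N"
  by (simp add: B_space_def)

end


section \<open>The transition semigroup\<close>

lemma transition_op_cong:
  "(\<And>x. x \<in> state_space q \<Longrightarrow> f x = g x) \<Longrightarrow> transition_op \<alpha> q \<tau> f y = transition_op \<alpha> q \<tau> g y"
  unfolding transition_op_def by (intro set_lebesgue_integral_cong) auto

context q_hermite
begin

text \<open>For merely integrable f the coefficients may grow, but at most linearly because
  \<open>qh\<close> does; the geometric factor \<open>rho \<tau> ^ j\<close> overcomes this.\<close>

lemma coeff_bound:
  obtains C where "0 \<le> C" "\<And>f j. integrable N f \<Longrightarrow> \<bar>coeff f j\<bar> \<le> C * (real j + 1) * (\<integral>x. \<bar>f x\<bar> \<partial>N)"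
    "\<And>j x. x \<in> S \<Longrightarrow> \<bar>qh q j x\<bar> \<le> C * (real j + 1)"
proof -
  obtain C where C: "0 \<le> C" "\<And>n x. x \<in> S \<Longrightarrow> \<bar>qh q n x\<bar> \<le> C * (real n + 1)"
    using qh_linear_growth[OF q] by blast
  show ?thesis
  proof (rule that[OF C(1) _ C(2)])
    fix f :: "real \<Rightarrow> real" and j assume f: "integrable N f"
    have le: "\<bar>f x * qh q j x\<bar> \<le> \<bar>f x\<bar> * (C * (real j + 1))" if "x \<in> S" for x
      unfolding abs_mult using that by (intro mult_left_mono C) auto
    have int: "integrable N (\<lambda>x. \<bar>f x\<bar> * (C * (real j + 1)))" using f by simp
    have int': "integrable N (\<lambda>x. f x * qh q j x)"
      using le C(1)
      by (intro Bochner_Integration.integrable_bound[OF int] AE_I2)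
        (auto intro!: borel_measurable_times borel_measurable_integrable[OF f] e_measurable intro: order_trans)
    have "norm (coeff f j) \<le> (\<integral>x. \<bar>f x\<bar> * (C * (real j + 1)) \<partial>N)"
      unfolding coeff_def using int int' le
      by (intro order_trans[OF integral_norm_bound integral_mono]) auto
    then show "\<bar>coeff f j\<bar> \<le> C * (real j + 1) * (\<integral>x. \<bar>f x\<bar> \<partial>N)"
      by (simp add: mult_ac)
  qed
qed

text \<open>On a probability space the L2 distance is at most the uniform distance.\<close>

lemma uniform_imp_expansion:
  assumes b: "summable (\<lambda>j. (b j)\<^sup>2)" and u: "uniform_limit S (\<lambda>n. psum b n) f sequentially"
    and f: "continuous_on S f"
  shows "expansion f b"
  unfolding expansion_def L2_tendsto_def
proof (intro conjI b)
  have fm: "f \<in> borel_measurable N" by (rule borel_measurable_continuous_qN_measure[OF f])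
  obtain K where "\<forall>x\<in>S. \<bar>f x\<bar> \<le> K" using state_space_bounded_by_continuous[OF f] by blast
  then show f2: "f \<in> L2_space N" using fm by (intro bounded_imp_L2_space) auto
  show "\<forall>\<^sub>F n in sequentially. psum b n \<in> L2_space N" using psum_L2 by simp
  show "(\<lambda>n. sqrt (\<integral>x. (psum b n x - f x)\<^sup>2 \<partial>N)) \<longlonglongrightarrow> 0"
  proof (rule tendstoI)
    fix \<epsilon> :: real assume \<epsilon>: "0 < \<epsilon>"
    have "\<forall>\<^sub>F n in sequentially. \<forall>x\<in>S. dist (psum b n x) (f x) < \<epsilon> / 2"
      using uniform_limitD[OF u, of "\<epsilon> / 2"] \<epsilon> by simp
    then show "\<forall>\<^sub>F n in sequentially. dist (sqrt (\<integral>x. (psum b n x - f x)\<^sup>2 \<partial>N)) 0 < \<epsilon>"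
    proof eventually_elim
      case (elim n)
      have "(\<integral>x. (psum b n x - f x)\<^sup>2 \<partial>N) \<le> (\<integral>x. (\<epsilon> / 2)\<^sup>2 \<partial>N)"
      proof (rule integral_mono)
        show "integrable N (\<lambda>x. (psum b n x - f x)\<^sup>2)"
          by (rule L2_spaceD(2)[OF L2_space_diff[OF psum_L2 f2]])
        show "(psum b n x - f x)\<^sup>2 \<le> (\<epsilon> / 2)\<^sup>2" if "x \<in> space N" for x
          using elim that power_mono[of "\<bar>psum b n x - f x\<bar>" "\<epsilon> / 2" 2] by (auto simp: dist_real_def)
      qed simp
      also have "\<dots> = (\<epsilon> / 2)\<^sup>2" using prob_space by simp
      finally have "sqrt (\<integral>x. (psum b n x - f x)\<^sup>2 \<partial>N) \<le> sqrt ((\<epsilon> / 2)\<^sup>2)"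
        by (rule real_sqrt_le_mono)
      then show ?case using \<epsilon> by (simp add: dist_real_def)
    qed
  qed
qed

end

locale q_ou_semigroup = q_hermite +
  fixes \<alpha> :: real
  assumes \<alpha>: "0 < \<alpha>"
begin

abbreviation P :: "real \<Rightarrow> (real \<Rightarrow> real) \<Rightarrow> real \<Rightarrow> real" where "P \<equiv> transition_op \<alpha> q"
definition rho :: "real \<Rightarrow> real" where "rho \<tau> = exp (- \<alpha> * \<tau>)"

lemma rho_pos [simp]: "0 < rho \<tau>" "0 \<le> rho \<tau>"
  by (simp_all add: rho_def)

lemma rho_less_1: "0 < \<tau> \<Longrightarrow> \<bar>rho \<tau>\<bar> < 1"
  using \<alpha> by (simp add: rho_def)

lemma rho_add: "rho (\<sigma> + \<tau>) = rho \<sigma> * rho \<tau>"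
  by (simp add: rho_def exp_add[symmetric] algebra_simps)

lemma rho_power: "rho \<tau> ^ j = exp (- \<alpha> * \<tau> * real j)"
  by (simp add: rho_def exp_of_nat_mult[symmetric] mult_ac)

lemma P_mehler:
  assumes \<tau>: "0 < \<tau>" and f: "f \<in> borel_measurable N" and y: "y \<in> S"
  shows "P \<tau> f y = (\<integral>x. f x * mehler q (rho \<tau>) x y \<partial>N)"
proof -
  have m: "(\<lambda>x. f x * mehler q (rho \<tau>) x y) \<in> borel_measurable N"
    by (intro borel_measurable_times f borel_measurable_continuous_qN_measure
        continuous_on_mehler rho_less_1 \<tau> y)
  have "P \<tau> f y = (LINT x:S|lborel. f x * mehler q (rho \<tau>) x y * f_N x q)"
    unfolding transition_op_def rho_def[symmetric]
    by (intro set_lebesgue_integral_cong) (auto simp: f_CN_eq_f_N_mehler[OF q rho_less_1[OF \<tau>] _ y])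
  then show ?thesis by (simp add: integral_N[OF m])
qed

lemma set_integrable_f_CN:
  assumes \<tau>: "0 < \<tau>" and f: "integrable N f" and y: "y \<in> S"
  shows "set_integrable lborel S (\<lambda>x. f x * f_CN x y (exp (- \<alpha> * \<tau>)) q)"
proof -
  have m: "(\<lambda>x. f x * mehler q (rho \<tau>) x y) \<in> borel_measurable N"
    by (intro borel_measurable_times borel_measurable_integrable[OF f] borel_measurable_continuous_qN_measure
        continuous_on_mehler rho_less_1 \<tau> y)
  have "set_integrable lborel S (\<lambda>x. f x * mehler q (rho \<tau>) x y * f_N x q)"
    using mehler_integral_sums(1)[OF rho_less_1[OF \<tau>] f y] by (simp only: integrable_N[OF m])
  then show ?thesis
    unfolding set_integrable_def rho_def[symmetric]
    by (rule Bochner_Integration.integrable_cong[THEN iffD1, rotated 2])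
      (auto simp: f_CN_eq_f_N_mehler[OF q rho_less_1[OF \<tau>] _ y] indicator_def)
qed

lemma P_sums:
  assumes \<tau>: "0 < \<tau>" and f: "integrable N f" and y: "y \<in> S"
  shows "(\<lambda>j. rho \<tau> ^ j * coeff f j * qh q j y) sums P \<tau> f y"
  using mehler_integral_sums(2)[OF rho_less_1[OF \<tau>] f y]
  by (simp add: coeff_def P_mehler[OF \<tau> borel_measurable_integrable[OF f] y])

lemma uniform_limit_P:
  assumes \<tau>: "0 < \<tau>" and f: "integrable N f"
  shows "uniform_limit S (psum (\<lambda>j. rho \<tau> ^ j * coeff f j)) (P \<tau> f) sequentially"
proof -
  obtain C where C: "0 \<le> C" "\<And>f j. integrable N f \<Longrightarrow> \<bar>coeff f j\<bar> \<le> C * (real j + 1) * (\<integral>x. \<bar>f x\<bar> \<partial>N)"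
    "\<And>j x. x \<in> S \<Longrightarrow> \<bar>qh q j x\<bar> \<le> C * (real j + 1)"
    using coeff_bound by blast
  define F where "F = (\<integral>x. \<bar>f x\<bar> \<partial>N)"
  have "uniform_limit S (\<lambda>n x. \<Sum>j<n. rho \<tau> ^ j * coeff f j * qh q j x) (\<lambda>x. \<Sum>j. rho \<tau> ^ j * coeff f j * qh q j x) sequentially"
  proof (rule Weierstrass_m_test)
    show "summable (\<lambda>j. C * C * F * ((real j + 1)\<^sup>2 * \<bar>rho \<tau>\<bar> ^ j))"
      using rho_less_1[OF \<tau>] by (intro summable_mult summable_quadratic_geometric) auto
    fix j x assume "x \<in> S"
    have "\<bar>rho \<tau> ^ j * coeff f j * qh q j x\<bar> \<le> \<bar>rho \<tau>\<bar> ^ j * (C * (real j + 1) * F) * (C * (real j + 1))"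
      unfolding abs_mult power_abs F_def
      using C \<open>x \<in> S\<close> f by (intro mult_mono mult_left_mono mult_nonneg_nonneg) (auto intro: order_trans[OF abs_ge_zero])
    then show "norm (rho \<tau> ^ j * coeff f j * qh q j x) \<le> C * C * F * ((real j + 1)\<^sup>2 * \<bar>rho \<tau>\<bar> ^ j)"
      by (simp add: power2_eq_square mult_ac)
  qed
  then show ?thesis
    by (rule uniform_limit_cong'[THEN iffD1, rotated 2])
      (use P_sums[OF \<tau> f] in \<open>auto simp: sums_iff\<close>)
qed

text \<open>Integrable f suffice, which is more than the Feller property demands. Thus
  \<open>P \<tau> g\<close> is continuous for bounded Borel g as well, and its composition with a
  state is measurable.\<close>

lemma continuous_on_P:
  assumes \<tau>: "0 < \<tau>" and f: "integrable N f"
  shows "continuous_on S (P \<tau> f)"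
  by (rule uniform_limit_theorem[OF _ uniform_limit_P[OF \<tau> f]])
    (auto intro!: always_eventually continuous_intros continuous_on_qh)

lemma expansion_P:
  assumes \<tau>: "0 < \<tau>" and f: "f \<in> L2_space N"
  shows "expansion (P \<tau> f) (\<lambda>j. rho \<tau> ^ j * coeff f j)"
proof (rule uniform_imp_expansion)
  have int: "integrable N f" by (rule L2_space_integrable[OF f])
  show "continuous_on S (P \<tau> f)" by (rule continuous_on_P[OF \<tau> int])
  show "uniform_limit S (psum (\<lambda>j. rho \<tau> ^ j * coeff f j)) (P \<tau> f) sequentially"
    by (rule uniform_limit_P[OF \<tau> int])
  show "summable (\<lambda>j. (rho \<tau> ^ j * coeff f j)\<^sup>2)"
  proof (rule summable_comparison_test'[OF bessel[OF f]])
    fix j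
    have "(rho \<tau> ^ j)\<^sup>2 \<le> 1"
      using rho_less_1[OF \<tau>] by (intro power_le_one) auto
    then show "norm ((rho \<tau> ^ j * coeff f j)\<^sup>2) \<le> (coeff f j)\<^sup>2"
      by (simp add: power_mult_distrib mult_left_le_one_le)
  qed
qed

lemma P_L2:
  assumes "0 < \<tau>" "f \<in> L2_space N"
  shows "P \<tau> f \<in> L2_space N" "coeff (P \<tau> f) = (\<lambda>j. rho \<tau> ^ j * coeff f j)"
  using expansion_imp_coeff[OF expansion_P[OF assms]] by auto

lemma continuous_L2:
  assumes "continuous_on S f" shows "f \<in> L2_space N"
proof -
  obtain K where "\<forall>x\<in>S. \<bar>f x\<bar> \<le> K" using state_space_bounded_by_continuous[OF assms] by blast
  then show ?thesis
    using borel_measurable_continuous_qN_measure[OF assms] by (intro bounded_imp_L2_space[of _ K]) auto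
qed

lemma coeff_qh: "coeff (qh q n) j = (if n = j then 1 else 0)"
  by (simp add: coeff_def orthonormal)

lemma P_qh:
  assumes \<tau>: "0 < \<tau>" and y: "y \<in> S"
  shows "P \<tau> (qh q n) y = rho \<tau> ^ n * qh q n y"
proof -
  have "(\<lambda>j. rho \<tau> ^ j * coeff (qh q n) j * qh q j y) sums (\<Sum>j\<in>{n}. rho \<tau> ^ j * coeff (qh q n) j * qh q j y)"
    by (rule sums_finite) (auto simp: coeff_qh)
  then have "(\<lambda>j. rho \<tau> ^ j * coeff (qh q n) j * qh q j y) sums (rho \<tau> ^ n * qh q n y)"
    by (simp add: coeff_qh)
  with P_sums[OF \<tau> L2_space_integrable[OF e_L2] y, of n] show ?thesis
    by (rule sums_unique2)
qed

lemma P_one: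
  assumes "0 < \<tau>" "y \<in> S" shows "P \<tau> (\<lambda>_. 1) y = 1"
proof -
  have "qh q 0 = (\<lambda>_. 1)" by (simp add: fun_eq_iff)
  with P_qh[OF assms, of 0] show ?thesis by simp
qed

lemma P_linear:
  assumes \<tau>: "0 < \<tau>" and f: "integrable N f" and g: "integrable N g" and y: "y \<in> S"
  shows "P \<tau> (\<lambda>z. a * f z + b * g z) y = a * P \<tau> f y + b * P \<tau> g y"
proof -
  have "P \<tau> (\<lambda>z. a * f z + b * g z) y = (\<integral>x. a * (f x * mehler q (rho \<tau>) x y) + b * (g x * mehler q (rho \<tau>) x y) \<partial>N)"
    using f g by (subst P_mehler[OF \<tau> _ y]) (auto simp: algebra_simps)
  also have "\<dots> = a * P \<tau> f y + b * P \<tau> g y"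
    using mehler_integral_sums(1)[OF rho_less_1[OF \<tau>] f y] mehler_integral_sums(1)[OF rho_less_1[OF \<tau>] g y] f g
    by (simp add: P_mehler[OF \<tau> _ y])
  finally show ?thesis .
qed

lemma P_mono:
  assumes \<tau>: "0 < \<tau>" and f: "integrable N f" and g: "integrable N g" and le: "\<And>x. x \<in> S \<Longrightarrow> f x \<le> g x" and y: "y \<in> S"
  shows "P \<tau> f y \<le> P \<tau> g y"
  using f g unfolding P_mehler[OF \<tau> borel_measurable_integrable[OF f] y] P_mehler[OF \<tau> borel_measurable_integrable[OF g] y]
  by (intro integral_mono mehler_integral_sums(1) rho_less_1 \<tau> y mult_right_mono mehler_nonneg q) (auto simp: le y)

text \<open>Contraction in the uniform norm, from positivity and \<open>P_one\<close>.\<close>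

lemma P_bounded:
  assumes \<tau>: "0 < \<tau>" and f: "f \<in> borel_measurable N" and K: "\<And>x. x \<in> S \<Longrightarrow> \<bar>f x\<bar> \<le> K" and y: "y \<in> S"
  shows "\<bar>P \<tau> f y\<bar> \<le> K"
proof -
  have int: "integrable N f" by (rule integrable_bounded_N[OF f K])
  have const: "P \<tau> (\<lambda>_. c) y = c" for c
    using P_linear[OF \<tau>, of "\<lambda>_. 1" "\<lambda>_. 1" y c 0] y P_one[OF \<tau> y] by simp
  have "P \<tau> f y \<le> P \<tau> (\<lambda>_. K) y" "P \<tau> (\<lambda>_. - K) y \<le> P \<tau> f y"
    using K by (auto intro!: P_mono[OF \<tau>] int y simp: abs_le_iff minus_le_iff)
  then show ?thesis unfolding const by linarith
qed

text \<open>Both sides have the same pointwise series because \<open>rho\<close> turns sums of times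
  into products.\<close>

lemma P_semigroup:
  assumes \<sigma>: "0 < \<sigma>" and \<tau>: "0 < \<tau>" and f: "f \<in> L2_space N" and y: "y \<in> S"
  shows "P \<sigma> (P \<tau> f) y = P (\<sigma> + \<tau>) f y"
proof -
  have "(\<lambda>j. rho \<sigma> ^ j * coeff (P \<tau> f) j * qh q j y) sums P \<sigma> (P \<tau> f) y"
    by (intro P_sums \<sigma> y L2_space_integrable P_L2 \<tau> f)
  then have "(\<lambda>j. rho (\<sigma> + \<tau>) ^ j * coeff f j * qh q j y) sums P \<sigma> (P \<tau> f) y"
    by (simp add: P_L2(2)[OF \<tau> f] rho_add power_mult_distrib mult_ac)
  moreover have "(\<lambda>j. rho (\<sigma> + \<tau>) ^ j * coeff f j * qh q j y) sums P (\<sigma> + \<tau>) f y"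
    using \<sigma> \<tau> by (intro P_sums y L2_space_integrable f) auto
  ultimately show ?thesis by (rule sums_unique2)
qed

lemma feller_continuous_P: "feller_continuous S P"
  unfolding feller_continuous_def by (auto intro!: continuous_on_P integrable_continuous_N)

lemma P_qspan_tendsto:
  assumes "qspan q p" "0 < \<epsilon>"
  shows "\<forall>\<^sub>F \<tau> in at_right 0. \<forall>x\<in>S. \<bar>p x - P \<tau> p x\<bar> < \<epsilon>"
  using assms
proof (induction arbitrary: \<epsilon> rule: qspan.induct)
  case zero
  have "P \<tau> (\<lambda>_. 0) x = 0" for \<tau> x by (simp add: transition_op_def)
  then show ?case using zero by simp
next
  case (add f c n)
  obtain K where K: "\<And>x. x \<in> S \<Longrightarrow> \<bar>qh q n x\<bar> \<le> K" using qh_bounded_state_space by blast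
  have "((\<lambda>\<tau>. \<bar>c\<bar> * \<bar>1 - rho \<tau> ^ n\<bar> * K) \<longlongrightarrow> \<bar>c\<bar> * \<bar>1 - exp (- \<alpha> * 0) ^ n\<bar> * K) (at_right 0)"
    unfolding rho_def by (intro tendsto_intros)
  then have "((\<lambda>\<tau>. \<bar>c\<bar> * \<bar>1 - rho \<tau> ^ n\<bar> * K) \<longlongrightarrow> 0) (at_right 0)" by simp
  then have 1: "\<forall>\<^sub>F \<tau> in at_right 0. \<bar>c\<bar> * \<bar>1 - rho \<tau> ^ n\<bar> * K < \<epsilon> / 2"
    using add.prems by (intro order_tendstoD(2)) auto
  have 2: "\<forall>\<^sub>F \<tau> in at_right 0. \<forall>x\<in>S. \<bar>f x - P \<tau> f x\<bar> < \<epsilon> / 2"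
    using add.IH[of "\<epsilon> / 2"] add.prems by simp
  have 3: "\<forall>\<^sub>F \<tau>::real in at_right 0. 0 < \<tau>" by (auto simp: eventually_at_filter)
  show ?case
    using 1 2 3
  proof eventually_elim
    case (elim \<tau>)
    show ?case
    proof
      fix x assume x: "x \<in> S"
      have fi: "integrable N f" by (rule integrable_continuous_N[OF continuous_on_qspan[OF add.hyps]])
      have "P \<tau> (\<lambda>x. f x + c * qh q n x) x = P \<tau> f x + c * (rho \<tau> ^ n * qh q n x)"
        using P_linear[OF elim(3) fi L2_space_integrable[OF e_L2] x, of 1 c n] P_qh[OF elim(3) x, of n] by simp
      then have "f x + c * qh q n x - P \<tau> (\<lambda>x. f x + c * qh q n x) x = (f x - P \<tau> f x) + c * (1 - rho \<tau> ^ n) * qh q n x"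
        by (simp add: algebra_simps)
      moreover have "\<bar>c * (1 - rho \<tau> ^ n) * qh q n x\<bar> \<le> \<bar>c\<bar> * \<bar>1 - rho \<tau> ^ n\<bar> * K"
        unfolding abs_mult using K[OF x] by (intro mult_left_mono) auto
      ultimately show "\<bar>f x + c * qh q n x - P \<tau> (\<lambda>x. f x + c * qh q n x) x\<bar> < \<epsilon>"
        using elim(1) elim(2)[rule_format, OF x] by linarith
    qed
  qed
qed

text \<open>For finite combinations of eigenfunctions this is convergence of the eigenvalues to 1;
  approximation with the contraction bound of \<open>P_bounded\<close> extends it, one third of
  \<epsilon> for each error.\<close>

lemma P_continuous_tendsto:
  assumes f: "continuous_on S f" and \<epsilon>: "0 < \<epsilon>"
  shows "\<forall>\<^sub>F \<tau> in at_right 0. \<forall>x\<in>S. \<bar>f x - P \<tau> f x\<bar> < \<epsilon>"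
proof -
  obtain p where p: "qspan q p" "\<And>x. x \<in> S \<Longrightarrow> \<bar>f x - p x\<bar> < \<epsilon> / 3"
    using qspan_approx[OF q f, of "\<epsilon> / 3"] \<epsilon> by auto
  have fi: "integrable N f" and pi: "integrable N p"
    by (auto intro!: integrable_continuous_N f continuous_on_qspan p)
  have 1: "\<forall>\<^sub>F \<tau> in at_right 0. \<forall>x\<in>S. \<bar>p x - P \<tau> p x\<bar> < \<epsilon> / 3"
    using P_qspan_tendsto[OF p(1), of "\<epsilon> / 3"] \<epsilon> by simp
  have 2: "\<forall>\<^sub>F \<tau>::real in at_right 0. 0 < \<tau>" by (auto simp: eventually_at_filter)
  show ?thesis
    using 1 2
  proof eventually_elim
    case (elim \<tau>)
    show ?case
    proof
      fix x assume x: "x \<in> S"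
      have "\<bar>P \<tau> (\<lambda>z. 1 * f z + (- 1) * p z) x\<bar> \<le> \<epsilon> / 3"
        using p(2) fi pi by (intro P_bounded elim x) (auto intro: less_imp_le)
      then have "\<bar>P \<tau> f x - P \<tau> p x\<bar> \<le> \<epsilon> / 3"
        using P_linear[OF elim(2) fi pi x, of 1 "-1"] by simp
      then show "\<bar>f x - P \<tau> f x\<bar> < \<epsilon>"
        using elim(1)[rule_format, OF x] p(2)[OF x] by linarith
    qed
  qed
qed

lemma right_continuous_family_P: "right_continuous_family S P"
  unfolding right_continuous_family_def
proof (intro allI impI tendstoI)
  fix f :: "real \<Rightarrow> real" and \<epsilon> :: real assume f: "continuous_on S f" and \<epsilon>: "0 < \<epsilon>"
  have "\<forall>\<^sub>F \<tau> in at_right 0. \<forall>x\<in>S. \<bar>f x - P \<tau> f x\<bar> < \<epsilon> / 2"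
    using P_continuous_tendsto[OF f, of "\<epsilon> / 2"] \<epsilon> by simp
  then show "\<forall>\<^sub>F \<tau> in at_right 0. dist (SUP x\<in>S. \<bar>f x - P \<tau> f x\<bar>) 0 < \<epsilon>"
  proof eventually_elim
    case (elim \<tau>)
    have ne: "S \<noteq> {}" using state_space_nonempty[OF q] by blast
    have "(SUP x\<in>S. \<bar>f x - P \<tau> f x\<bar>) \<le> \<epsilon> / 2"
      using elim by (intro cSUP_least ne) (auto intro: less_imp_le)
    moreover have "0 \<le> (SUP x\<in>S. \<bar>f x - P \<tau> f x\<bar>)"
    proof (rule cSUP_upper2[OF _ state_space_nonempty[OF q]])
      show "bdd_above ((\<lambda>x. \<bar>f x - P \<tau> f x\<bar>) ` S)"
        using elim by (intro bdd_aboveI2[of _ _ "\<epsilon> / 2"]) (auto intro: less_imp_le)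
    qed simp
    ultimately show ?case using \<epsilon> by (simp add: dist_real_def)
  qed
qed

lemma feller_semigroup_P: "feller_semigroup S P"
  unfolding feller_semigroup_def
proof (intro conjI feller_continuous_P right_continuous_family_P allI impI ballI; (elim conjE)?)
  show "P \<tau> (\<lambda>z. a * f z + b * g z) x = a * P \<tau> f x + b * P \<tau> g x"
    if "0 < \<tau>" "continuous_on S f" "continuous_on S g" "x \<in> S" for \<tau> f g a b x
    using that by (intro P_linear integrable_continuous_N)
  show "0 \<le> P \<tau> f x" if "0 < \<tau>" "continuous_on S f" "\<forall>x\<in>S. 0 \<le> f x" "x \<in> S" for \<tau> f x
  proof -
    have "P \<tau> (\<lambda>_. 0) x \<le> P \<tau> f x"
      using that by (intro P_mono integrable_continuous_N) auto
    then show ?thesis by (simp add: transition_op_def)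
  qed
  show "P \<tau> (\<lambda>_. 1) x = 1" if "0 < \<tau>" "x \<in> S" for \<tau> x using that by (rule P_one)
  show "P \<sigma> (P \<tau> f) x = P (\<sigma> + \<tau>) f x" if "0 < \<sigma>" "0 < \<tau>" "continuous_on S f" "x \<in> S" for \<sigma> \<tau> f x
    using that by (intro P_semigroup continuous_L2)
qed

section \<open>The infinitesimal operator and its domain\<close>

lemma difference_quotient_tendsto: "((\<lambda>h. 1 / h * (rho h ^ j - 1)) \<longlongrightarrow> - \<alpha> * real j) (at_right 0)"
proof -
  have "((\<lambda>h. exp (- \<alpha> * h * real j)) has_real_derivative (- \<alpha> * real j)) (at 0)"
    by (auto intro!: derivative_eq_intros)
  then have "((\<lambda>h. (exp (- \<alpha> * h * real j) - 1) / h) \<longlongrightarrow> - \<alpha> * real j) (at 0)"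
    by (simp add: has_field_derivative_iff)
  then have "((\<lambda>h. (exp (- \<alpha> * h * real j) - 1) / h) \<longlongrightarrow> - \<alpha> * real j) (at_right 0)"
    by (rule tendsto_within_subset) simp
  then show ?thesis unfolding rho_power by simp
qed

lemma difference_quotient_L2:
  assumes h: "0 < h" and f: "f \<in> L2_space N"
  shows "(\<lambda>x. 1 / h * (P h f x - f x)) \<in> L2_space N"
    and "coeff (\<lambda>x. 1 / h * (P h f x - f x)) j = 1 / h * (rho h ^ j - 1) * coeff f j"
proof -
  show "(\<lambda>x. 1 / h * (P h f x - f x)) \<in> L2_space N"
    by (intro L2_space_scale L2_space_diff P_L2 h f)
  show "coeff (\<lambda>x. 1 / h * (P h f x - f x)) j = 1 / h * (rho h ^ j - 1) * coeff f j"
    unfolding coeff_scale coeff_diff[OF P_L2(1)[OF h f] f] P_L2(2)[OF h f] by (simp add: algebra_simps)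
qed

text \<open>Coefficients are continuous under L2 limits, so those of g are limits of the
  coefficients of the difference quotients, that is, derivatives of exponentials at 0.\<close>

lemma generator_coeff:
  assumes "(f, g) \<in> infinitesimal_operator N P"
  shows "f \<in> L2_space N" "g \<in> L2_space N" "coeff g = (\<lambda>j. - \<alpha> * real j * coeff f j)"
proof -
  show f: "f \<in> L2_space N" using assms by (simp add: infinitesimal_operator_def)
  have lim: "L2_tendsto N (\<lambda>h x. 1 / h * (P h f x - f x)) g (at_right 0)"
    using assms by (simp add: infinitesimal_operator_def)
  then show "g \<in> L2_space N" by (simp add: L2_tendsto_def)
  have "coeff g j = - \<alpha> * real j * coeff f j" for j
  proof (rule tendsto_unique)
    show "((\<lambda>h. coeff (\<lambda>x. 1 / h * (P h f x - f x)) j) \<longlongrightarrow> coeff g j) (at_right 0)"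
      by (rule coeff_tendsto[OF lim])
    have "((\<lambda>h. 1 / h * (rho h ^ j - 1) * coeff f j) \<longlongrightarrow> - \<alpha> * real j * coeff f j) (at_right 0)"
      by (intro tendsto_mult difference_quotient_tendsto tendsto_const)
    then show "((\<lambda>h. coeff (\<lambda>x. 1 / h * (P h f x - f x)) j) \<longlongrightarrow> - \<alpha> * real j * coeff f j) (at_right 0)"
    proof (rule Lim_transform_eventually)
      have "\<forall>\<^sub>F h::real in at_right 0. 0 < h" by (auto simp: eventually_at_filter)
      then show "\<forall>\<^sub>F h in at_right 0. 1 / h * (rho h ^ j - 1) * coeff f j = coeff (\<lambda>x. 1 / h * (P h f x - f x)) j"
        by eventually_elim (simp only: difference_quotient_L2(2)[OF _ f])
    qed
  qed simp
  then show "coeff g = (\<lambda>j. - \<alpha> * real j * coeff f j)" by blast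
qed

text \<open>\<open>riesz_fischer\<close> provides the candidate g. By Parseval the squared distance
  from the difference quotient to g is a series whose terms tend to 0, and Tannery's theorem
  exchanges limit and sum.\<close>

lemma generator_exists:
  assumes f: "f \<in> L2_space N" and sum: "summable (\<lambda>j. (real j)\<^sup>2 * (coeff f j)\<^sup>2)"
  shows "\<exists>g. (f, g) \<in> infinitesimal_operator N P"
proof -
  have sum': "summable (\<lambda>j. (- \<alpha> * real j * coeff f j)\<^sup>2)"
    using summable_mult[OF sum, of "\<alpha>\<^sup>2"] by (simp add: power_mult_distrib mult_ac)
  obtain g where g: "g \<in> L2_space N" "coeff g = (\<lambda>j. - \<alpha> * real j * coeff f j)"
    using riesz_fischer[OF sum'] by blast
  define a where "a j h = ((1 / h * (rho h ^ j - 1) + \<alpha> * real j) * coeff f j)\<^sup>2" for j h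
  have pos: "\<forall>\<^sub>F h::real in at_right 0. 0 < h" by (auto simp: eventually_at_filter)
  have a_eq: "suminf (\<lambda>j. a j h) = (\<integral>x. (1 / h * (P h f x - f x) - g x)\<^sup>2 \<partial>N)" if h: "0 < h" for h
  proof -
    note D = difference_quotient_L2[OF h f]
    have "coeff (\<lambda>x. 1 / h * (P h f x - f x) - g x) j = (1 / h * (rho h ^ j - 1) + \<alpha> * real j) * coeff f j" for j
      unfolding coeff_diff[OF D(1) g(1)] D(2) g(2) by (simp add: algebra_simps)
    with parseval[OF L2_space_diff[OF D(1) g(1)]] show ?thesis
      by (simp add: a_def sums_iff)
  qed
  \<comment> \<open>The majorant for Tannery's theorem: by 1 - t \<le> exp (- t) \<le> 1 the
    quotient lies between - \<alpha> j and 0, so its distance to the limit - \<alpha> j is at most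
    \<alpha> j.\<close>
  have a_le: "norm (a j h) \<le> (- \<alpha> * real j * coeff f j)\<^sup>2" if h: "0 < h" for j h
  proof -
    have "1 - \<alpha> * h * real j \<le> rho h ^ j"
      unfolding rho_power using exp_ge_add_one_self[of "- \<alpha> * h * real j"] by simp
    then have "- (\<alpha> * real j) \<le> 1 / h * (rho h ^ j - 1)"
      using h by (simp add: field_simps)
    moreover have "rho h ^ j \<le> 1"
      using rho_less_1[OF h] by (intro power_le_one) auto
    then have "1 / h * (rho h ^ j - 1) \<le> 0"
      using h by (intro mult_nonneg_nonpos) auto
    ultimately have "\<bar>1 / h * (rho h ^ j - 1) + \<alpha> * real j\<bar> \<le> \<bar>- \<alpha> * real j\<bar>" by linarith
    then have "\<bar>(1 / h * (rho h ^ j - 1) + \<alpha> * real j) * coeff f j\<bar> \<le> \<bar>- \<alpha> * real j * coeff f j\<bar>"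
      unfolding abs_mult[of _ "coeff f j"] by (intro mult_right_mono) auto
    then show ?thesis unfolding a_def by (simp only: real_norm_def abs_power2 abs_le_square_iff)
  qed
  have "eventually (\<lambda>h. summable (\<lambda>j. norm (a j h))) (at_right 0) \<and> summable (\<lambda>j. norm (0::real)) \<and>
      ((\<lambda>h. suminf (\<lambda>j. a j h)) \<longlongrightarrow> suminf (\<lambda>j. 0)) (at_right 0)"
  proof (rule tannerys_theorem[OF _ _ sum'])
    fix j
    have "(a j \<longlongrightarrow> ((- \<alpha> * real j + \<alpha> * real j) * coeff f j)\<^sup>2) (at_right 0)"
      unfolding a_def by (intro tendsto_intros difference_quotient_tendsto)
    then show "(a j \<longlongrightarrow> 0) (at_right 0)" by simp
  next
    have "\<forall>\<^sub>F p in (at_top :: nat filter) \<times>\<^sub>F at_right (0::real). 0 < snd p"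
      using eventually_prodI[OF eventually_True pos, of "at_top :: nat filter"] by simp
    then show "\<forall>\<^sub>F (j, h) in at_top \<times>\<^sub>F at_right 0. norm (a j h) \<le> (- \<alpha> * real j * coeff f j)\<^sup>2"
    proof eventually_elim
      case (elim p)
      then show ?case using a_le[of "snd p" "fst p"] by (cases p) (simp only: prod.case fst_conv snd_conv)
    qed
  qed simp
  then have "((\<lambda>h. suminf (\<lambda>j. a j h)) \<longlongrightarrow> 0) (at_right 0)" by simp
  then have "((\<lambda>h. \<integral>x. (1 / h * (P h f x - f x) - g x)\<^sup>2 \<partial>N) \<longlongrightarrow> 0) (at_right 0)"
    by (rule Lim_transform_eventually) (use pos a_eq in \<open>auto elim: eventually_mono\<close>)
  from tendsto_real_sqrt[OF this]
  have "L2_tendsto N (\<lambda>h x. 1 / h * (P h f x - f x)) g (at_right 0)"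
    unfolding L2_tendsto_def using g(1) pos difference_quotient_L2(1)[OF _ f]
    by (auto elim!: eventually_mono)
  then show ?thesis using f by (auto simp: infinitesimal_operator_def)
qed

text \<open>If the limit exists, Bessel's inequality for it is exactly the summability condition in
  \<open>B0_space\<close>; conversely that condition lets \<open>generator_exists\<close>
  apply.\<close>

lemma Domain_generator: "Domain (infinitesimal_operator N P) = B0_space q"
proof (intro equalityI subsetI)
  fix f assume "f \<in> Domain (infinitesimal_operator N P)"
  then obtain g where fg: "(f, g) \<in> infinitesimal_operator N P" by blast
  note g = generator_coeff[OF fg]
  have "summable (\<lambda>j. (1 / \<alpha>\<^sup>2) * (coeff g j)\<^sup>2)"
    by (intro summable_mult bessel g)
  then have "summable (\<lambda>j. (real j)\<^sup>2 * (coeff f j)\<^sup>2)"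
    using \<alpha> by (simp add: g(3) power_mult_distrib)
  then show "f \<in> B0_space q"
    unfolding B0_space_def B_space_eq hermite_expansion_eq using g(1) expansion_coeff[OF g(1)] by auto
next
  fix f assume "f \<in> B0_space q"
  then show "f \<in> Domain (infinitesimal_operator N P)"
    unfolding B0_space_def B_space_eq hermite_expansion_eq
    using generator_exists[of f] by (auto simp: expansion_iff)
qed

end


section \<open>Orthogonality from the transition densities\<close>

text \<open>Identity theorem along a null sequence: once the lower coefficients vanish, dividing by
  the power of index j and letting \<open>r k\<close> tend to 0 isolates \<open>a j\<close>.\<close>

lemma power_series_eq_0:
  fixes a :: "nat \<Rightarrow> real"
  assumes summable: "\<And>r. \<bar>r\<bar> < 1 \<Longrightarrow> summable (\<lambda>j. a j * r ^ j)"
    and r: "r \<longlonglongrightarrow> 0" "\<And>k. r k \<noteq> 0" "\<And>k. \<bar>r k\<bar> < 1"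
    and zero: "\<And>k. (\<Sum>j. a j * r k ^ j) = 0"
  shows "a j = 0"
proof (induction j rule: less_induct)
  case (less j)
  define b where "b i = a (i + j)" for i
  have sb: "summable (\<lambda>i. b i * x ^ i)" if "\<bar>x\<bar> < 1" "x \<noteq> 0" for x
  proof -
    have "summable (\<lambda>i. inverse (x ^ j) * (a (i + j) * x ^ (i + j)))"
      by (intro summable_mult summable_ignore_initial_segment summable that)
    moreover have "inverse (x ^ j) * (a (i + j) * x ^ (i + j)) = b i * x ^ i" for i
      using that by (simp add: b_def power_add field_simps)
    ultimately show ?thesis by simp
  qed
  have "isCont (\<lambda>x. \<Sum>i. b i * x ^ i) 0"
    by (rule isCont_powser[OF sb[of "1/2"]]) auto
  then have "(\<lambda>k. \<Sum>i. b i * r k ^ i) \<longlonglongrightarrow> (\<Sum>i. b i * 0 ^ i)"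
    by (rule isCont_tendsto_compose[OF _ r(1)])
  moreover have "(\<Sum>i. b i * r k ^ i) = 0" for k
  proof -
    have "0 = (\<Sum>i. a (i + j) * r k ^ (i + j))"
      using zero[of k] suminf_split_initial_segment[OF summable[OF r(3)[of k]], of j] less by simp
    also have "\<dots> = (\<Sum>i. r k ^ j * (b i * r k ^ i))"
      by (simp add: b_def power_add mult_ac)
    also have "\<dots> = r k ^ j * (\<Sum>i. b i * r k ^ i)"
      by (rule suminf_mult[OF sb[OF r(3) r(2)]])
    finally show ?thesis using r(2)[of k] by simp
  qed
  ultimately have "(\<Sum>i. b i * 0 ^ i) = 0"
    by (simp add: LIMSEQ_const_iff)
  then show ?case by (simp add: b_def)
qed

text \<open>Being monic, the polynomial is nonzero and has finitely many zeros; the degree is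
  carried along to control the leading coefficient.\<close>

lemma qHermite_poly:
  "\<exists>p :: real poly. degree p = n \<and> lead_coeff p = 1 \<and> (\<forall>x. poly p x = qHermite q n x)"
proof (induction n rule: less_induct)
  case (less n)
  consider "n = 0" | "n = 1" | m where "n = Suc (Suc m)"
    by (cases n; cases "n - 1") auto
  then show ?case
  proof cases
    case 1
    then show ?thesis by (intro exI[of _ 1]) auto
  next
    case 2
    then show ?thesis by (intro exI[of _ "[:0, 1:]"]) auto
  next
    case (3 m)
    obtain p r where p: "degree p = Suc m" "lead_coeff p = 1" "\<And>x. poly p x = qHermite q (Suc m) x"
      and r: "degree r = m" "\<And>x. poly r x = qHermite q m x"
      using less[of "Suc m"] less[of m] 3 by auto
    have p0: "p \<noteq> 0" using p(2) by auto
    have deg: "degree (smult (- qint q (Suc m)) r) < degree (pCons 0 p)"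
      using p p0 r degree_smult_le[of "- qint q (Suc m)" r] by simp
    show ?thesis
    proof (intro exI[of _ "pCons 0 p + smult (- qint q (Suc m)) r"] conjI allI)
      show "degree (pCons 0 p + smult (- qint q (Suc m)) r) = n"
        using degree_add_eq_left[OF deg] p p0 3 by simp
      show "lead_coeff (pCons 0 p + smult (- qint q (Suc m)) r) = 1"
        using lead_coeff_add_le[OF deg] p p0 by simp
      show "poly (pCons 0 p + smult (- qint q (Suc m)) r) x = qHermite q n x" for x
        using p r 3 by simp
    qed
  qed
qed

lemma finite_qh_zeros:
  assumes "\<bar>q\<bar> < 1" shows "finite {x. qh q n x = 0}"
proof -
  obtain p :: "real poly" where p: "lead_coeff p = 1" "\<And>x. poly p x = qHermite q n x"
    using qHermite_poly[of n q] by blast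
  then have "p \<noteq> 0" by auto
  then have "finite {x. poly p x = 0}" by (rule poly_roots_finite)
  then show ?thesis using p qfact_pos[OF assms, of n] by (simp add: qh_def)
qed

lemma sets_generated_algebra:
  "sets (generated_algebra M X) = {X -` C \<inter> space M | C. C \<in> sets borel}"
  unfolding generated_algebra_def by (rule sets_vimage_algebra2) simp

lemma space_generated_algebra [simp]: "space (generated_algebra M X) = space M"
  by (simp add: generated_algebra_def)

lemma subalgebra_generated_algebra:
  "X \<in> borel_measurable M \<Longrightarrow> subalgebra M (generated_algebra M X)"
  unfolding subalgebra_def sets_generated_algebra by (auto intro: measurable_sets)

lemma (in prob_space) sigma_finite_subalgebraI: "subalgebra M F \<Longrightarrow> sigma_finite_subalgebra M F"
  by (intro finite_measure_subalgebra_is_sigma_finite)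
    (simp add: finite_measure_subalgebra_def finite_measure_subalgebra_axioms_def finite_measure_axioms)

lemma OU_process_q_density:
  assumes q: "\<bar>q\<bar> < 1" and OU: "OU_process M \<alpha> q Y"
  shows "q_density q"
proof (rule q_density.intro)
  have D: "distributed M lborel (Y 0) (\<lambda>x. ennreal (f_N x q))" and "prob_space M"
    using OU by (auto simp: OU_process_def)
  interpret prob_space M by fact
  show "\<bar>q\<bar> < 1" by (rule q)
  have m: "(\<lambda>x. ennreal (f_N x q)) \<in> borel_measurable borel"
    using distributed_borel_measurable[OF D] by simp
  \<comment> \<open>\<open>distributed\<close> yields measurability of the extended-valued density;
    as \<open>f_N\<close> is nonnegative, \<open>enn2real\<close> gives back the real one.\<close>
  then have "(\<lambda>x. enn2real (ennreal (f_N x q))) \<in> borel_measurable borel" by measurable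
  then show "(\<lambda>x. f_N x q) \<in> borel_measurable borel"
    by (simp add: f_N_nonneg[OF q])
  show "prob_space (qN_measure q)"
  proof (rule prob_spaceI)
    have "1 = emeasure M (Y 0 -` UNIV \<inter> space M)" using emeasure_space_1 by simp
    also have "\<dots> = (\<integral>\<^sup>+x. ennreal (f_N x q) * indicator UNIV x \<partial>lborel)"
      by (rule distributed_emeasure[OF D]) simp
    also have "\<dots> = (\<integral>\<^sup>+x. ennreal (f_N x q) * indicator (state_space q) x \<partial>lborel)"
      by (intro nn_integral_cong) (auto simp: indicator_def f_N_def)
    also have "\<dots> = (\<integral>\<^sup>+x. ennreal (f_N x q) \<partial>restrict_space lborel (state_space q))"
      by (subst nn_integral_restrict_space) auto
    also have "\<dots> = emeasure (qN_measure q) (space (qN_measure q))"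
      unfolding qN_measure_def using m
      by (subst emeasure_density) (auto intro!: nn_integral_cong measurable_restrict_space1 simp: indicator_def sets_restrict_space_iff)
    finally show "emeasure (qN_measure q) (space (qN_measure q)) = 1" by (rule sym)
  qed
qed

lemma set_integral_f_CN:
  "(LINT x:C|lborel. f_CN x y \<rho> q) = (LINT x:state_space q|lborel. indicator C x * f_CN x y \<rho> q)"
  unfolding set_lebesgue_integral_def
  by (intro Bochner_Integration.integral_cong) (auto simp: indicator_def f_CN_def)

text \<open>Each conditional density has total mass 1. By Mehler's formula this mass is a power series in
  \<open>\<rho>\<close>, whose coefficients of positive order must therefore vanish.\<close>

lemma OU_process_q_hermite:
  assumes q: "\<bar>q\<bar> < 1" and \<alpha>: "0 < \<alpha>" and OU: "OU_process M \<alpha> q Y"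
  shows "q_hermite q"
proof -
  interpret q_density q by (rule OU_process_q_density[OF q OU])
  have D: "distributed M lborel (Y 0) (\<lambda>x. ennreal (f_N x q))" and "prob_space M"
    and dens': "\<forall>t s. t < s \<longrightarrow> has_cond_density M (Y s) (Y t) (\<lambda>y x. f_CN x y (exp (- \<alpha> * (s - t))) q)"
    and Y: "Y t \<in> borel_measurable M" "\<And>\<omega>. \<omega> \<in> space M \<Longrightarrow> Y t \<omega> \<in> S" for t
    using OU by (auto simp: OU_process_def process_in_def)
  have dens: "has_cond_density M (Y s) (Y 0) (\<lambda>y x. f_CN x y (exp (- \<alpha> * s)) q)" if "0 < s" for s
    using dens'[rule_format, OF that] by simp
  interpret M: prob_space M by fact
  interpret N: prob_space N by (rule prob_qN)
  define m where "m j = (\<integral>x. qh q j x \<partial>N)" for j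
  \<comment> \<open>The correlations over the times 1, 2, and so on: nonzero, tending to 0, and
    countably many, so that the exceptional null sets add up to a null set.\<close>
  define r where "r k = exp (- \<alpha> * real (Suc k))" for k
  have r: "\<bar>r k\<bar> < 1" "r k \<noteq> 0" for k using \<alpha> by (auto simp: r_def mult_less_0_iff)
  have r_lim: "r \<longlonglongrightarrow> 0"
  proof -
    have "(\<lambda>k. exp (- \<alpha>) ^ Suc k) \<longlonglongrightarrow> 0"
      using \<alpha> by (intro LIMSEQ_Suc LIMSEQ_power_zero) auto
    moreover have "r = (\<lambda>k. exp (- \<alpha>) ^ Suc k)"
      unfolding r_def[abs_def] exp_of_nat_mult[symmetric] by (simp only: mult.commute)
    ultimately show ?thesis by (simp only:)
  qed
  have "AE \<omega> in M. (LINT x:UNIV|lborel. f_CN x (Y 0 \<omega>) (r k) q) = 1" for k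
  proof -
    interpret G: sigma_finite_subalgebra M "generated_algebra M (Y 0)"
      by (intro M.sigma_finite_subalgebraI subalgebra_generated_algebra Y)
    have "AE \<omega> in M. real_cond_exp M (generated_algebra M (Y 0)) (\<lambda>\<omega>. indicator UNIV (Y (real (Suc k)) \<omega>)) \<omega> =
        (LINT x:UNIV|lborel. f_CN x (Y 0 \<omega>) (r k) q)"
      using dens[of "real (Suc k)", unfolded has_cond_density_def, THEN bspec, of UNIV]
      unfolding r_def by (simp del: of_nat_Suc)
    moreover have "AE \<omega> in M. real_cond_exp M (generated_algebra M (Y 0)) (\<lambda>\<omega>. 1) \<omega> = 1"
      by (rule G.real_cond_exp_F_meas) auto
    ultimately show ?thesis by eventually_elim simp
  qed
  then have "AE \<omega> in M. \<forall>k. (LINT x:UNIV|lborel. f_CN x (Y 0 \<omega>) (r k) q) = 1"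
    unfolding AE_all_countable by (rule allI)
  then have zero: "AE \<omega> in M. \<forall>j>0. m j * qh q j (Y 0 \<omega>) = 0"
    using AE_space
  proof eventually_elim
    case (elim \<omega>)
    define y where "y = Y 0 \<omega>"
    have y: "y \<in> S" unfolding y_def using elim Y by blast
    \<comment> \<open>Subtracting 1 at index 0 turns total mass 1 into a power series that vanishes
      at each \<open>r k\<close>.\<close>
    define a where "a j = m j * qh q j y - (if j = 0 then 1 else 0)" for j
    have sums: "(\<lambda>j. (m j * qh q j y) * \<rho> ^ j) sums (\<integral>x. mehler q \<rho> x y \<partial>N)" if "\<bar>\<rho>\<bar> < 1" for \<rho>
      using mehler_integral_sums(2)[OF that _ y, of "\<lambda>_. 1"] by (simp add: m_def mult_ac)
    have sums_a: "(\<lambda>j. a j * \<rho> ^ j) sums ((\<integral>x. mehler q \<rho> x y \<partial>N) - 1)" if "\<bar>\<rho>\<bar> < 1" for \<rho>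
    proof -
      have "(\<lambda>j. (if j = 0 then 1 else 0 :: real)) sums 1"
        using sums_single[of 0 "\<lambda>_. 1 :: real"] by simp
      from sums_diff[OF sums[OF that] this] show ?thesis
        by (rule sums_cong[THEN iffD1, rotated]) (simp add: a_def algebra_simps)
    qed
    have "(\<integral>x. mehler q (r k) x y \<partial>N) = 1" for k
    proof -
      have "(\<integral>x. mehler q (r k) x y \<partial>N) = (LINT x:S|lborel. mehler q (r k) x y * f_N x q)"
        by (intro integral_N borel_measurable_continuous_qN_measure continuous_on_mehler r y)
      also have "\<dots> = (LINT x:S|lborel. indicator UNIV x * f_CN x y (r k) q)"
        by (intro set_lebesgue_integral_cong) (auto simp: f_CN_eq_f_N_mehler[OF q r(1) _ y])
      also have "\<dots> = 1" using elim unfolding set_integral_f_CN y_def by blast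
      finally show ?thesis .
    qed
    then have "(\<Sum>j. a j * r k ^ j) = 0" for k
      using sums_a[OF r(1)] by (simp add: sums_iff)
    note zero_a = this
    have a0: "a j = 0" for j
    proof (rule power_series_eq_0[OF _ r_lim r(2) r(1) zero_a])
      show "summable (\<lambda>j. a j * \<rho> ^ j)" if "\<bar>\<rho>\<bar> < 1" for \<rho>
        by (rule sums_summable[OF sums_a[OF that]])
    qed
    show ?case
    proof (intro allI impI)
      fix j :: nat assume "0 < j"
      then show "m j * qh q j (Y 0 \<omega>) = 0" using a0[of j] by (simp only: a_def y_def) simp
    qed
  qed
  have "m n = 0" if n: "0 < n" for n
  proof (rule ccontr)
    assume mn: "m n \<noteq> 0"
    \<comment> \<open>If \<open>m n\<close> were nonzero, \<open>Y 0\<close> would almost surely be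
      a zero of \<open>qh q n\<close>. These zeros are finite in number, and a variable with a
      density avoids finite sets.\<close>
    define Z where "Z = {x. qh q n x = 0}"
    have "finite Z" unfolding Z_def by (rule finite_qh_zeros[OF q])
    then have Z: "Z \<in> null_sets lborel" by (rule finite_imp_null_set_lborel)
    have "AE \<omega> in M. Y 0 \<omega> \<in> Z"
      using zero by eventually_elim (use n mn in \<open>auto simp: Z_def\<close>)
    moreover have "AE \<omega> in M. Y 0 \<omega> \<notin> Z"
    proof -
      have "AE x in density lborel (\<lambda>x. ennreal (f_N x q)). x \<notin> Z"
        using AE_not_in[OF Z] f_N_measurable by (subst AE_density) auto
      then have "AE x in distr M lborel (Y 0). x \<notin> Z"
        unfolding distributed_distr_eq_density[OF D] .
      then show ?thesis
        using Z Y by (subst (asm) AE_distr_iff) (auto simp: null_sets_def)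
    qed
    ultimately have "AE \<omega> in M. False" by eventually_elim simp
    then show False by simp
  qed
  then show ?thesis
    by (intro q_hermite.intro q_hermite_axioms.intro q_density_axioms) (simp add: m_def)
qed


section \<open>The Markov property\<close>

lemma space_natural_filtration [simp]: "space (natural_filtration M Y t) = space M"
  by (simp add: natural_filtration_def space_measure_of_conv)

lemma sets_natural_filtration:
  "sets (natural_filtration M Y t) =
    sigma_sets (space M) {Y u -` C \<inter> space M | u C. ereal u \<le> t \<and> C \<in> sets borel}"
  unfolding natural_filtration_def by (rule sets_measure_of) auto

lemma sets_natural_filtration_mono:
  "s \<le> t \<Longrightarrow> sets (natural_filtration M Y s) \<subseteq> sets (natural_filtration M Y t)"
  unfolding sets_natural_filtration by (rule sigma_sets_mono') (blast intro: order_trans)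

lemma measurable_natural_filtration:
  assumes "ereal u \<le> t" shows "Y u \<in> borel_measurable (natural_filtration M Y t)"
  using assms by (intro measurableI) (auto simp: sets_natural_filtration intro!: sigma_sets.Basic)

lemma subalgebra_natural_filtration:
  assumes "\<And>u. Y u \<in> borel_measurable M"
  shows "subalgebra M (natural_filtration M Y t)"
  unfolding subalgebra_def sets_natural_filtration
proof (intro conjI)
  show "sigma_sets (space M) {Y u -` C \<inter> space M |u C. ereal u \<le> t \<and> C \<in> sets borel} \<subseteq> sets M"
    by (rule sets.sigma_sets_subset) (auto intro!: measurable_sets[OF assms])
qed simp

lemma filtration_natural_filtration: "filtration (space M) (natural_filtration M Y)"
  by unfold_locales (auto dest: sets_natural_filtration_mono)

lemma generated_algebra_subset_natural_filtration:
  "sets (generated_algebra M (Y t)) \<subseteq> sets (natural_filtration M Y (ereal t))"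
  unfolding sets_generated_algebra sets_natural_filtration by (auto intro!: sigma_sets.Basic)

text \<open>Past events of a modification agree with past events of the original process up to null
  sets. This holds for the generators and is preserved by the operations of a sigma-algebra, the
  union using countability.\<close>

lemma natural_filtration_modification:
  assumes A: "A \<in> sets (natural_filtration M Z t)"
    and mod: "\<And>u. AE \<omega> in M. Z u \<omega> = Y u \<omega>"
  shows "\<exists>B\<in>sets (natural_filtration M Y t). AE \<omega> in M. \<omega> \<in> A \<longleftrightarrow> \<omega> \<in> B"
  using A unfolding sets_natural_filtration[of M Z]
proof (induction rule: sigma_sets.induct)
  case (Basic A)
  then obtain u C where A: "A = Z u -` C \<inter> space M" "ereal u \<le> t" "C \<in> sets borel" by blast
  have "Y u -` C \<inter> space (natural_filtration M Y t) \<in> sets (natural_filtration M Y t)"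
    by (rule measurable_sets[OF measurable_natural_filtration[OF A(2)] A(3)])
  moreover have "AE \<omega> in M. \<omega> \<in> A \<longleftrightarrow> \<omega> \<in> Y u -` C \<inter> space M"
    using mod[of u] by eventually_elim (simp add: A)
  ultimately show ?case by (intro bexI[of _ "Y u -` C \<inter> space M"]) simp_all
next
  case Empty
  then show ?case by (intro bexI[of _ "{}"]) auto
next
  case (Compl A)
  then obtain B where B: "B \<in> sets (natural_filtration M Y t)" "AE \<omega> in M. \<omega> \<in> A \<longleftrightarrow> \<omega> \<in> B" by blast
  have "space (natural_filtration M Y t) - B \<in> sets (natural_filtration M Y t)"
    using B(1) by (rule sets.compl_sets)
  moreover have "AE \<omega> in M. \<omega> \<in> space M - A \<longleftrightarrow> \<omega> \<in> space M - B"
    using B(2) by eventually_elim simp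
  ultimately show ?case by (intro bexI[of _ "space M - B"]) simp_all
next
  case (Union A)
  then have "\<exists>B. \<forall>i. B i \<in> sets (natural_filtration M Y t) \<and> (AE \<omega> in M. \<omega> \<in> A i \<longleftrightarrow> \<omega> \<in> B i)"
    by (intro choice) blast
  then obtain B where B: "\<And>i. B i \<in> sets (natural_filtration M Y t)" "\<And>i::nat. AE \<omega> in M. \<omega> \<in> A i \<longleftrightarrow> \<omega> \<in> B i"
    by blast
  have "AE \<omega> in M. \<forall>i. \<omega> \<in> A i \<longleftrightarrow> \<omega> \<in> B i"
    unfolding AE_all_countable using B(2) by blast
  then have "AE \<omega> in M. \<omega> \<in> (\<Union>i. A i) \<longleftrightarrow> \<omega> \<in> (\<Union>i. B i)"
    by eventually_elim simp
  moreover have "(\<Union>i. B i) \<in> sets (natural_filtration M Y t)" using B(1) by auto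
  ultimately show ?case by blast
qed

context q_ou_semigroup
begin

lemma measurable_continuous_state:
  assumes h: "continuous_on S h" and Z: "Z \<in> borel_measurable M" "\<forall>\<omega>\<in>space M. Z \<omega> \<in> S"
  shows "(\<lambda>\<omega>. h (Z \<omega>)) \<in> borel_measurable M"
proof (rule measurable_compose[where f=Z and g=h])
  show "Z \<in> measurable M (restrict_space borel S)"
    using Z by (intro measurable_restrict_space2) auto
  show "h \<in> borel_measurable (restrict_space borel S)"
    by (rule borel_measurable_continuous_on_restrict[OF h])
qed

lemma integrable_bounded_borel:
  assumes "bounded_borel g" shows "integrable N g"
proof -
  obtain K where "g \<in> borel_measurable borel" "\<And>x. \<bar>g x\<bar> \<le> K" using assms by (elim bounded_borelE) blast
  then show ?thesis by (intro integrable_bounded_N[of _ K] borel_measurable_qN_measureI)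
qed

lemma P_dominated:
  assumes \<tau>: "0 < \<tau>" and u: "\<And>n. bounded_borel (u n)" "\<And>n x. \<bar>u n x\<bar> \<le> K" and f: "bounded_borel f"
    and lim: "\<And>x. (\<lambda>n. u n x) \<longlonglongrightarrow> f x" and y: "y \<in> S"
  shows "(\<lambda>n. P \<tau> (u n) y) \<longlonglongrightarrow> P \<tau> f y"
proof -
  note int = integrable_bounded_borel
  have m: "integrable N (\<lambda>x. mehler q (rho \<tau>) x y)"
    using mehler_integral_sums(1)[OF rho_less_1[OF \<tau>] _ y, of "\<lambda>_. 1"] by simp
  show ?thesis
    unfolding P_mehler[OF \<tau> borel_measurable_integrable[OF int[OF u(1)]] y] P_mehler[OF \<tau> borel_measurable_integrable[OF int[OF f]] y]
  proof (rule integral_dominated_convergence[where w="\<lambda>x. K * \<bar>mehler q (rho \<tau>) x y\<bar>"])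
    show "integrable N (\<lambda>x. K * \<bar>mehler q (rho \<tau>) x y\<bar>)" using m by simp
    show "AE x in N. (\<lambda>n. u n x * mehler q (rho \<tau>) x y) \<longlonglongrightarrow> f x * mehler q (rho \<tau>) x y"
      by (intro AE_I2 tendsto_intros lim)
    show "AE x in N. norm (u n x * mehler q (rho \<tau>) x y) \<le> K * \<bar>mehler q (rho \<tau>) x y\<bar>" for n
      by (intro AE_I2) (auto simp: abs_mult intro!: mult_right_mono u)
    show "(\<lambda>x. f x * mehler q (rho \<tau>) x y) \<in> borel_measurable N"
      by (rule borel_measurable_integrable[OF mehler_integral_sums(1)[OF rho_less_1[OF \<tau>] int[OF f] y]])
    show "(\<lambda>x. u n x * mehler q (rho \<tau>) x y) \<in> borel_measurable N" for n
      by (rule borel_measurable_integrable[OF mehler_integral_sums(1)[OF rho_less_1[OF \<tau>] int[OF u(1)] y]])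
  qed
qed

lemma P_bounded_borel_bound:
  assumes "0 < \<tau>" "bounded_borel g" "\<And>x. \<bar>g x\<bar> \<le> K" "y \<in> S"
  shows "\<bar>P \<tau> g y\<bar> \<le> K"
  using assms by (intro P_bounded borel_measurable_integrable integrable_bounded_borel) auto

lemma integrable_transition:
  assumes "prob_space M" and A: "A \<in> sets M"
    and X: "X \<in> borel_measurable M" and Z: "Z \<in> borel_measurable M" "\<forall>\<omega>\<in>space M. Z \<omega> \<in> S"
    and \<tau>: "0 < \<tau>" and g: "bounded_borel g"
  shows "integrable M (\<lambda>\<omega>. indicator A \<omega> * g (X \<omega>))"
    and "integrable M (\<lambda>\<omega>. indicator A \<omega> * P \<tau> g (Z \<omega>))"
proof -
  interpret M: prob_space M by fact
  obtain K where K: "g \<in> borel_measurable borel" "\<And>x. \<bar>g x\<bar> \<le> K" using g by (elim bounded_borelE) blast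
  have "0 \<le> K" using K(2)[of 0] by linarith
  have [measurable]: "(\<lambda>\<omega>. g (X \<omega>)) \<in> borel_measurable M"
    by (rule measurable_compose[OF X K(1)])
  have [measurable]: "(\<lambda>\<omega>. P \<tau> g (Z \<omega>)) \<in> borel_measurable M"
    by (rule measurable_continuous_state[OF continuous_on_P[OF \<tau> integrable_bounded_borel[OF g]] Z])
  note A [measurable]
  show "integrable M (\<lambda>\<omega>. indicator A \<omega> * g (X \<omega>))"
    using K(2) \<open>0 \<le> K\<close> by (intro M.integrable_const_bound[where B=K] AE_I2) (auto simp: indicator_def)
  have "\<bar>P \<tau> g (Z \<omega>)\<bar> \<le> K" if "\<omega> \<in> space M" for \<omega>
    using P_bounded_borel_bound[OF \<tau> g K(2)] bspec[OF Z(2) that] by blast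
  then show "integrable M (\<lambda>\<omega>. indicator A \<omega> * P \<tau> g (Z \<omega>))"
    using \<open>0 \<le> K\<close> by (intro M.integrable_const_bound[where B=K] AE_I2) (auto simp: indicator_def)
qed

text \<open>X stands for the future and Z for the present value. Leaving both arbitrary lets the
  lemma serve fixed times as well as stopping times.\<close>

lemma bounded_functional_transition:
  assumes "prob_space M" and A: "A \<in> sets M"
    and X: "X \<in> borel_measurable M" and Z: "Z \<in> borel_measurable M" "\<forall>\<omega>\<in>space M. Z \<omega> \<in> S"
    and \<tau>: "0 < \<tau>"
  shows "bounded_functional (\<lambda>g. (\<integral>\<omega>. indicator A \<omega> * g (X \<omega>) \<partial>M) - (\<integral>\<omega>. indicator A \<omega> * P \<tau> g (Z \<omega>) \<partial>M))"
proof -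
  interpret M: prob_space M by fact
  note int = integrable_transition[OF assms]
  show ?thesis
  proof
    fix f g assume fg: "bounded_borel f" "bounded_borel g"
    have 1: "(\<integral>\<omega>. indicator A \<omega> * (f (X \<omega>) + g (X \<omega>)) \<partial>M)
        = (\<integral>\<omega>. indicator A \<omega> * f (X \<omega>) \<partial>M) + (\<integral>\<omega>. indicator A \<omega> * g (X \<omega>) \<partial>M)"
      unfolding distrib_left by (intro Bochner_Integration.integral_add int fg)
    have "(\<integral>\<omega>. indicator A \<omega> * P \<tau> (\<lambda>x. f x + g x) (Z \<omega>) \<partial>M)
        = (\<integral>\<omega>. indicator A \<omega> * P \<tau> f (Z \<omega>) + indicator A \<omega> * P \<tau> g (Z \<omega>) \<partial>M)"
    proof (rule Bochner_Integration.integral_cong[OF refl])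
      fix \<omega> assume "\<omega> \<in> space M"
      then show "indicator A \<omega> * P \<tau> (\<lambda>x. f x + g x) (Z \<omega>) = indicator A \<omega> * P \<tau> f (Z \<omega>) + indicator A \<omega> * P \<tau> g (Z \<omega>)"
        using P_linear[OF \<tau> integrable_bounded_borel[OF fg(1)] integrable_bounded_borel[OF fg(2)] bspec[OF Z(2)], of \<omega> 1 1]
        by (simp add: distrib_left)
    qed
    also have "\<dots> = (\<integral>\<omega>. indicator A \<omega> * P \<tau> f (Z \<omega>) \<partial>M) + (\<integral>\<omega>. indicator A \<omega> * P \<tau> g (Z \<omega>) \<partial>M)"
      by (intro Bochner_Integration.integral_add int fg)
    finally show "(\<integral>\<omega>. indicator A \<omega> * (f (X \<omega>) + g (X \<omega>)) \<partial>M) - (\<integral>\<omega>. indicator A \<omega> * P \<tau> (\<lambda>x. f x + g x) (Z \<omega>) \<partial>M)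
        = (\<integral>\<omega>. indicator A \<omega> * f (X \<omega>) \<partial>M) - (\<integral>\<omega>. indicator A \<omega> * P \<tau> f (Z \<omega>) \<partial>M)
        + ((\<integral>\<omega>. indicator A \<omega> * g (X \<omega>) \<partial>M) - (\<integral>\<omega>. indicator A \<omega> * P \<tau> g (Z \<omega>) \<partial>M))"
      using 1 by simp
  next
    fix f :: "real \<Rightarrow> real" and c assume f: "bounded_borel f"
    have "P \<tau> (\<lambda>x. c * f x) y = c * P \<tau> f y" for y
      unfolding transition_op_def by (simp add: mult.assoc)
    then have "(\<integral>\<omega>. indicator A \<omega> * P \<tau> (\<lambda>x. c * f x) (Z \<omega>) \<partial>M) = c * (\<integral>\<omega>. indicator A \<omega> * P \<tau> f (Z \<omega>) \<partial>M)"
      by (simp add: mult.left_commute)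
    then show "(\<integral>\<omega>. indicator A \<omega> * (c * f (X \<omega>)) \<partial>M) - (\<integral>\<omega>. indicator A \<omega> * P \<tau> (\<lambda>x. c * f x) (Z \<omega>) \<partial>M)
        = c * ((\<integral>\<omega>. indicator A \<omega> * f (X \<omega>) \<partial>M) - (\<integral>\<omega>. indicator A \<omega> * P \<tau> f (Z \<omega>) \<partial>M))"
      by (simp add: mult.left_commute right_diff_distrib)
  next
    fix u K f
    assume u: "\<And>n. bounded_borel (u n)" "\<And>n x. \<bar>u n x\<bar> \<le> K" and f: "bounded_borel f"
      and lim: "\<And>x. (\<lambda>n. u n x) \<longlonglongrightarrow> f x"
    have "0 \<le> K" using u(2)[of 0 0] by linarith
    have PK: "\<bar>P \<tau> (u n) (Z \<omega>)\<bar> \<le> K" if "\<omega> \<in> space M" for n \<omega>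
      by (rule P_bounded_borel_bound[OF \<tau> u(1) u(2) bspec[OF Z(2) that]])
    show "(\<lambda>n. (\<integral>\<omega>. indicator A \<omega> * u n (X \<omega>) \<partial>M) - (\<integral>\<omega>. indicator A \<omega> * P \<tau> (u n) (Z \<omega>) \<partial>M))
      \<longlonglongrightarrow> (\<integral>\<omega>. indicator A \<omega> * f (X \<omega>) \<partial>M) - (\<integral>\<omega>. indicator A \<omega> * P \<tau> f (Z \<omega>) \<partial>M)"
    proof (rule tendsto_diff)
      show "(\<lambda>n. \<integral>\<omega>. indicator A \<omega> * u n (X \<omega>) \<partial>M) \<longlonglongrightarrow> (\<integral>\<omega>. indicator A \<omega> * f (X \<omega>) \<partial>M)"
      proof (rule integral_dominated_convergence[where w="\<lambda>_. K"])
        show "AE \<omega> in M. (\<lambda>n. indicator A \<omega> * u n (X \<omega>)) \<longlonglongrightarrow> indicator A \<omega> * f (X \<omega>)"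
          by (intro AE_I2 tendsto_intros lim)
        show "AE \<omega> in M. norm (indicator A \<omega> * u n (X \<omega>)) \<le> K" for n
          using u(2) \<open>0 \<le> K\<close> by (intro AE_I2) (auto simp: indicator_def)
        show "(\<lambda>\<omega>. indicator A \<omega> * f (X \<omega>)) \<in> borel_measurable M"
          by (rule borel_measurable_integrable[OF int(1)[OF f]])
        show "(\<lambda>\<omega>. indicator A \<omega> * u n (X \<omega>)) \<in> borel_measurable M" for n
          by (rule borel_measurable_integrable[OF int(1)[OF u(1)]])
      qed simp
      show "(\<lambda>n. \<integral>\<omega>. indicator A \<omega> * P \<tau> (u n) (Z \<omega>) \<partial>M) \<longlonglongrightarrow> (\<integral>\<omega>. indicator A \<omega> * P \<tau> f (Z \<omega>) \<partial>M)"
      proof (rule integral_dominated_convergence[where w="\<lambda>_. K"])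
        show "AE \<omega> in M. (\<lambda>n. indicator A \<omega> * P \<tau> (u n) (Z \<omega>)) \<longlonglongrightarrow> indicator A \<omega> * P \<tau> f (Z \<omega>)"
          by (intro AE_I2 tendsto_intros P_dominated[OF \<tau> u f lim] bspec[OF Z(2)])
        show "AE \<omega> in M. norm (indicator A \<omega> * P \<tau> (u n) (Z \<omega>)) \<le> K" for n
          using PK \<open>0 \<le> K\<close> by (intro AE_I2) (auto simp: indicator_def)
        show "(\<lambda>\<omega>. indicator A \<omega> * P \<tau> f (Z \<omega>)) \<in> borel_measurable M"
          by (rule borel_measurable_integrable[OF int(2)[OF f]])
        show "(\<lambda>\<omega>. indicator A \<omega> * P \<tau> (u n) (Z \<omega>)) \<in> borel_measurable M" for n
          by (rule borel_measurable_integrable[OF int(2)[OF u(1)]])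
      qed simp
    qed
  qed
qed

end

text \<open>The Markov property in integrated form, without conditional expectations: only integrals
  over past events occur, so replacing events and variables by almost surely equal ones does no
  harm.\<close>

locale q_ou_markov = q_ou_semigroup + M: prob_space M for M :: "'a measure" +
  fixes Y :: "real \<Rightarrow> 'a \<Rightarrow> real"
  assumes Y_measurable: "Y t \<in> borel_measurable M"
    and Y_state: "\<omega> \<in> space M \<Longrightarrow> Y t \<omega> \<in> S"
    and markov_indicator: "0 < \<tau> \<Longrightarrow> A \<in> sets (natural_filtration M Y (ereal t)) \<Longrightarrow> C \<in> sets borel \<Longrightarrow>
      (\<integral>\<omega>. indicator A \<omega> * indicator C (Y (t + \<tau>) \<omega>) \<partial>M) = (\<integral>\<omega>. indicator A \<omega> * P \<tau> (indicator C) (Y t \<omega>) \<partial>M)"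
begin

abbreviation F :: "real \<Rightarrow> 'a measure" where "F t \<equiv> natural_filtration M Y (ereal t)"

lemma F_sub: "subalgebra M (natural_filtration M Y t)"
  by (rule subalgebra_natural_filtration[OF Y_measurable])

lemma F_sets: "A \<in> sets (natural_filtration M Y t) \<Longrightarrow> A \<in> sets M"
  using F_sub[of t] by (auto simp: subalgebra_def)

lemma integrable_markov:
  assumes "0 < \<tau>" "A \<in> sets M" "bounded_borel g"
  shows "integrable M (\<lambda>\<omega>. indicator A \<omega> * g (Y s \<omega>))"
    and "integrable M (\<lambda>\<omega>. indicator A \<omega> * P \<tau> g (Y t \<omega>))"
  using integrable_transition[OF M.prob_space_axioms assms(2) Y_measurable[of s] Y_measurable[of t] _ assms(1,3)] Y_state
  by auto

lemma markov_bounded: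
  assumes \<tau>: "0 < \<tau>" and A: "A \<in> sets (F t)" and g: "bounded_borel g"
  shows "(\<integral>\<omega>. indicator A \<omega> * g (Y (t + \<tau>) \<omega>) \<partial>M) = (\<integral>\<omega>. indicator A \<omega> * P \<tau> g (Y t \<omega>) \<partial>M)"
proof -
  interpret bounded_functional "\<lambda>g. (\<integral>\<omega>. indicator A \<omega> * g (Y (t + \<tau>) \<omega>) \<partial>M) - (\<integral>\<omega>. indicator A \<omega> * P \<tau> g (Y t \<omega>) \<partial>M)"
    by (intro bounded_functional_transition M.prob_space_axioms F_sets[OF A] Y_measurable ballI Y_state \<tau>)
  show ?thesis
    using eq_0_if_indicator[OF _ g] markov_indicator[OF \<tau> A] by simp
qed

text \<open>Any G between the algebra of the present and that of the past is allowed. Both extremes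
  are used: the past for the transition property and the present for the conditional
  variance.\<close>

lemma markov_real_cond_exp:
  assumes \<tau>: "0 < \<tau>" and g: "bounded_borel g"
    and G: "subalgebra M G" "sets G \<subseteq> sets (F t)" "Y t \<in> borel_measurable G"
  shows "AE \<omega> in M. real_cond_exp M G (\<lambda>\<omega>. g (Y (t + \<tau>) \<omega>)) \<omega> = P \<tau> g (Y t \<omega>)"
proof -
  interpret G: sigma_finite_subalgebra M G by (rule M.sigma_finite_subalgebraI[OF G(1)])
  have sp: "space G = space M" using G(1) by (simp add: subalgebra_def)
  show ?thesis
  proof (rule G.real_cond_exp_charact)
    show "set_lebesgue_integral M A (\<lambda>\<omega>. g (Y (t + \<tau>) \<omega>)) = set_lebesgue_integral M A (\<lambda>\<omega>. P \<tau> g (Y t \<omega>))"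
      if "A \<in> sets G" for A
      using markov_bounded[OF \<tau> _ g, of A t] G(2) that by (auto simp: set_lebesgue_integral_def)
    show "integrable M (\<lambda>\<omega>. g (Y (t + \<tau>) \<omega>))"
      by (rule Bochner_Integration.integrable_cong[THEN iffD1, OF refl _ integrable_markov(1)[OF \<tau> sets.top g]]) simp
    show "integrable M (\<lambda>\<omega>. P \<tau> g (Y t \<omega>))"
      by (rule Bochner_Integration.integrable_cong[THEN iffD1, OF refl _ integrable_markov(2)[OF \<tau> sets.top g]]) simp
    show "(\<lambda>\<omega>. P \<tau> g (Y t \<omega>)) \<in> borel_measurable G"
      by (rule measurable_continuous_state[OF continuous_on_P[OF \<tau> integrable_bounded_borel[OF g]] G(3)])
        (simp add: sp Y_state)
  qed
qed

lemma markov_with_transition_Y: "markov_with_transition M Y P"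
  unfolding markov_with_transition_def
  by (auto intro!: markov_real_cond_exp F_sub measurable_natural_filtration simp: bounded_borel_def)

text \<open>The strong Markov property concerns a cadlag modification together with its own natural
  filtration, so the Markov property has to be carried over to that filtration.\<close>

lemma q_ou_markov_modification:
  assumes Z: "\<And>t. Z t \<in> borel_measurable M" "\<And>t. \<forall>\<omega>\<in>space M. Z t \<omega> \<in> S"
    and mod: "\<And>t. AE \<omega> in M. Z t \<omega> = Y t \<omega>"
  shows "q_ou_markov q \<alpha> M Z"
proof (intro q_ou_markov.intro q_ou_markov_axioms.intro q_ou_semigroup_axioms M.prob_space_axioms Z bspec[OF Z(2)])
  fix \<tau> t :: real and A C
  assume \<tau>: "0 < \<tau>" and A: "A \<in> sets (natural_filtration M Z (ereal t))" and C: "C \<in> sets (borel :: real measure)"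
  note g = bounded_borel_indicator[OF C]
  obtain B where B: "B \<in> sets (F t)" "AE \<omega> in M. \<omega> \<in> A \<longleftrightarrow> \<omega> \<in> B"
    using natural_filtration_modification[OF A mod] by blast
  have AM: "A \<in> sets M"
    using A subalgebra_natural_filtration[of Z M, OF Z(1)] by (auto simp: subalgebra_def)
  note int = integrable_transition[OF M.prob_space_axioms AM Z(1) Z(1) Z(2) \<tau> g]
  have "(\<integral>\<omega>. indicator A \<omega> * indicator C (Z (t + \<tau>) \<omega>) \<partial>M) = (\<integral>\<omega>. (indicator B \<omega> * indicator C (Y (t + \<tau>) \<omega>) :: real) \<partial>M)"
  proof (rule integral_cong_AE)
    show "AE \<omega> in M. indicator A \<omega> * indicator C (Z (t + \<tau>) \<omega>) = (indicator B \<omega> * indicator C (Y (t + \<tau>) \<omega>) :: real)"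
      using B(2) mod[of "t + \<tau>"] by eventually_elim (simp add: indicator_def)
  qed (intro borel_measurable_integrable int integrable_markov[OF \<tau> F_sets[OF B(1)] g])+
  also have "\<dots> = (\<integral>\<omega>. indicator B \<omega> * P \<tau> (indicator C) (Y t \<omega>) \<partial>M)"
    by (rule markov_indicator[OF \<tau> B(1) C])
  also have "\<dots> = (\<integral>\<omega>. indicator A \<omega> * P \<tau> (indicator C) (Z t \<omega>) \<partial>M)"
  proof (rule integral_cong_AE)
    show "AE \<omega> in M. indicator B \<omega> * P \<tau> (indicator C) (Y t \<omega>) = indicator A \<omega> * P \<tau> (indicator C) (Z t \<omega>)"
      using B(2) mod[of t] by eventually_elim (simp add: indicator_def)
  qed (intro borel_measurable_integrable int integrable_markov[OF \<tau> F_sets[OF B(1)] g])+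
  finally show "(\<integral>\<omega>. indicator A \<omega> * indicator C (Z (t + \<tau>) \<omega>) \<partial>M) = (\<integral>\<omega>. indicator A \<omega> * P \<tau> (indicator C) (Z t \<omega>) \<partial>M)" .
qed

end

text \<open>Conditioning an indicator on the past reduces to conditioning on the present, where the
  conditional density gives \<open>P \<tau>\<close>. Integrating over a past event removes the
  conditional expectation.\<close>

lemma OU_process_markov:
  assumes q: "\<bar>q\<bar> < 1" and \<alpha>: "0 < \<alpha>" and OU: "OU_process M \<alpha> q Y"
  shows "q_ou_markov q \<alpha> M Y"
proof -
  interpret q_hermite q by (rule OU_process_q_hermite[OF q \<alpha> OU])
  interpret q_ou_semigroup q \<alpha> by unfold_locales (rule \<alpha>)
  have "prob_space M" and dens: "\<forall>t s. t < s \<longrightarrow> has_cond_density M (Y s) (Y t) (\<lambda>y x. f_CN x y (exp (- \<alpha> * (s - t))) q)"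
    and markov: "markov_process M Y"
    and Y: "Y t \<in> borel_measurable M" "\<forall>\<omega>\<in>space M. Y t \<omega> \<in> S" for t
    using OU by (auto simp: OU_process_def process_in_def)
  interpret M: prob_space M by fact
  show ?thesis
  proof (intro q_ou_markov.intro q_ou_markov_axioms.intro q_ou_semigroup_axioms M.prob_space_axioms Y bspec[OF Y(2)])
    fix \<tau> t :: real and A C
    assume \<tau>: "0 < \<tau>" and A: "A \<in> sets (natural_filtration M Y (ereal t))" and C: "C \<in> sets (borel :: real measure)"
    let ?F = "natural_filtration M Y (ereal t)"
    interpret F: sigma_finite_subalgebra M ?F
      by (intro M.sigma_finite_subalgebraI subalgebra_natural_filtration Y)
    have AM: "A \<in> sets M"
      using A subalgebra_natural_filtration[of Y M, OF Y(1)] by (auto simp: subalgebra_def)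
    note int = integrable_transition[OF M.prob_space_axioms _ Y(1) Y(1) Y(2) \<tau> bounded_borel_indicator[OF C]]
    have "AE \<omega> in M. real_cond_exp M ?F (\<lambda>\<omega>. indicator C (Y (t + \<tau>) \<omega>)) \<omega> =
        real_cond_exp M (generated_algebra M (Y t)) (\<lambda>\<omega>. indicator C (Y (t + \<tau>) \<omega>)) \<omega>"
      using markov C \<tau> unfolding markov_process_def by simp
    moreover have "AE \<omega> in M. real_cond_exp M (generated_algebra M (Y t)) (\<lambda>\<omega>. indicator C (Y (t + \<tau>) \<omega>)) \<omega> =
        (LINT x:C|lborel. f_CN x (Y t \<omega>) (exp (- \<alpha> * (t + \<tau> - t))) q)"
    proof -
      have "t < t + \<tau>" using \<tau> by simp
      from dens[rule_format, OF this, unfolded has_cond_density_def, THEN bspec, OF C] show ?thesis .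
    qed
    ultimately have eq: "AE \<omega> in M. real_cond_exp M ?F (\<lambda>\<omega>. indicator C (Y (t + \<tau>) \<omega>)) \<omega> = P \<tau> (indicator C) (Y t \<omega>)"
      by eventually_elim (simp add: set_integral_f_CN transition_op_def)
    have "(\<integral>\<omega>. (indicator A \<omega> * indicator C (Y (t + \<tau>) \<omega>) :: real) \<partial>M)
        = (\<integral>\<omega>. indicator A \<omega> * real_cond_exp M ?F (\<lambda>\<omega>. indicator C (Y (t + \<tau>) \<omega>)) \<omega> \<partial>M)"
      by (rule F.real_cond_exp_intg(2)[symmetric, OF int(1)[OF AM] borel_measurable_indicator[OF A]])
        (intro measurable_compose[OF Y(1)] borel_measurable_indicator C)
    also have "\<dots> = (\<integral>\<omega>. indicator A \<omega> * P \<tau> (indicator C) (Y t \<omega>) \<partial>M)"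
    proof (rule integral_cong_AE)
      show "AE \<omega> in M. indicator A \<omega> * real_cond_exp M ?F (\<lambda>\<omega>. indicator C (Y (t + \<tau>) \<omega>)) \<omega>
          = indicator A \<omega> * P \<tau> (indicator C) (Y t \<omega>)"
        using eq by eventually_elim simp
      show "(\<lambda>\<omega>. indicator A \<omega> * real_cond_exp M ?F (\<lambda>\<omega>. indicator C (Y (t + \<tau>) \<omega>)) \<omega>) \<in> borel_measurable M"
        using AM by measurable
      show "(\<lambda>\<omega>. indicator A \<omega> * P \<tau> (indicator C) (Y t \<omega>)) \<in> borel_measurable M"
        by (rule borel_measurable_integrable[OF int(2)[OF AM]])
    qed
    finally show "(\<integral>\<omega>. indicator A \<omega> * indicator C (Y (t + \<tau>) \<omega>) \<partial>M) = (\<integral>\<omega>. indicator A \<omega> * P \<tau> (indicator C) (Y t \<omega>) \<partial>M)" .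
  qed
qed


section \<open>Moments and regular modifications\<close>

locale q_ou_process = q_ou_markov +
  assumes marginal: "(g :: real \<Rightarrow> real) \<in> borel_measurable borel \<Longrightarrow> (\<integral>\<omega>. g (Y t \<omega>) \<partial>M) = (\<integral>x. g x \<partial>N)"
begin

definition bnd :: real where "bnd = 2 / sqrt (1 - q)"

lemma state_abs_le: "x \<in> S \<Longrightarrow> \<bar>x\<bar> \<le> bnd"
  by (auto simp: state_space_def bnd_def abs_le_iff)

lemma Y_bounded: "\<omega> \<in> space M \<Longrightarrow> \<bar>Y t \<omega>\<bar> \<le> bnd"
  using Y_state state_abs_le by blast

lemma bnd_nonneg: "0 \<le> bnd"
  using q by (simp add: bnd_def)

lemma integrable_Y_bounded:
  fixes f :: "_ \<Rightarrow> real"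
  assumes "f \<in> borel_measurable M" "\<And>\<omega>. \<omega> \<in> space M \<Longrightarrow> \<bar>f \<omega>\<bar> \<le> K"
  shows "integrable M f"
  using assms by (intro M.integrable_const_bound[where B=K]) auto

lemma integrable_Y: "integrable M (Y t)"
  by (rule integrable_Y_bounded[OF Y_measurable Y_bounded])

lemma integrable_YY: "integrable M (\<lambda>\<omega>. Y s \<omega> * Y t \<omega>)"
proof (rule integrable_Y_bounded)
  show "(\<lambda>\<omega>. Y s \<omega> * Y t \<omega>) \<in> borel_measurable M"
    by (intro borel_measurable_times Y_measurable)
  show "\<bar>Y s \<omega> * Y t \<omega>\<bar> \<le> bnd * bnd" if "\<omega> \<in> space M" for \<omega>
    unfolding abs_mult by (intro mult_mono Y_bounded that bnd_nonneg) auto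
qed

lemma qh_1: "qh q (Suc 0) x = x"
  by (simp add: qh_def qfact_Suc qint_def)

text \<open>Decomposition of the square into eigenfunctions, from which the conditional second
  moment is computed.\<close>

lemma x_square: "x\<^sup>2 = sqrt (qint q 2) * qh q 2 x + 1"
  using qh_times_x[OF q, of x "Suc 0"] by (simp add: qh_1 power2_eq_square numeral_2_eq_2) (simp add: qint_def)

lemma P_identity:
  assumes "0 < \<tau>" "y \<in> S" shows "P \<tau> (\<lambda>x. x) y = rho \<tau> * y"
proof -
  have "qh q (Suc 0) = (\<lambda>x. x)" by (simp add: qh_1 fun_eq_iff)
  with P_qh[OF assms, of "Suc 0"] show ?thesis by simp
qed

lemma P_square:
  assumes \<tau>: "0 < \<tau>" and y: "y \<in> S" shows "P \<tau> (\<lambda>x. x\<^sup>2) y = (rho \<tau>)\<^sup>2 * (y\<^sup>2 - 1) + 1"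
proof -
  have "P \<tau> (\<lambda>x. x\<^sup>2) y = P \<tau> (\<lambda>x. sqrt (qint q 2) * qh q 2 x + 1 * 1) y"
    by (simp add: x_square)
  also have "\<dots> = sqrt (qint q 2) * ((rho \<tau>)\<^sup>2 * qh q 2 y) + 1"
    using P_linear[OF \<tau> L2_space_integrable[OF e_L2], of "\<lambda>_. 1" y "sqrt (qint q 2)" 2 1] y P_one[OF \<tau> y] P_qh[OF \<tau> y, of 2]
    by simp
  finally show ?thesis using x_square[of y] by (simp add: algebra_simps)
qed

lemma expectation_Y: "(\<integral>\<omega>. Y t \<omega> \<partial>M) = 0"
  using marginal[of "\<lambda>x. x" t] qh_mean[of "Suc 0"] by (simp add: qh_1)

lemma expectation_Y_square: "(\<integral>\<omega>. (Y t \<omega>)\<^sup>2 \<partial>M) = 1"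
  using marginal[of "\<lambda>x. x\<^sup>2" t] qh_orthonormal[of "Suc 0" "Suc 0"] by (simp add: qh_1 power2_eq_square)

lemma variance_Y: "M.variance (Y t) = 1"
  by (simp add: expectation_Y expectation_Y_square)

lemma bounded_borel_extend:
  assumes "continuous_on S g" shows "bounded_borel (\<lambda>x. if x \<in> S then g x else 0)"
proof -
  obtain K where K: "\<And>x. x \<in> S \<Longrightarrow> \<bar>g x\<bar> \<le> K" using state_space_bounded_by_continuous[OF assms] by blast
  show ?thesis
  proof (rule bounded_borelI[of _ "\<bar>K\<bar>"])
    show "(\<lambda>x. if x \<in> S then g x else 0) \<in> borel_measurable borel"
      by (rule borel_measurable_extend_0[OF borel_measurable_continuous_qN_measure[OF assms]])
    show "\<bar>if x \<in> S then g x else 0\<bar> \<le> \<bar>K\<bar>" for x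
      using K[of x] by auto
  qed
qed

text \<open>The functions needed, x and its square, are unbounded on the line. They are set to 0 off
  the state space, which the process never leaves.\<close>

lemma cond_exp_continuous:
  assumes \<tau>: "0 < \<tau>" and g: "continuous_on S g"
    and G: "subalgebra M G" "sets G \<subseteq> sets (F t)" "Y t \<in> borel_measurable G"
  shows "AE \<omega> in M. real_cond_exp M G (\<lambda>\<omega>. g (Y (t + \<tau>) \<omega>)) \<omega> = P \<tau> g (Y t \<omega>)"
proof -
  interpret G: sigma_finite_subalgebra M G by (rule M.sigma_finite_subalgebraI[OF G(1)])
  let ?g = "\<lambda>x. if x \<in> S then g x else 0"
  have b: "bounded_borel ?g" by (rule bounded_borel_extend[OF g])
  have m: "(\<lambda>\<omega>. g (Y (t + \<tau>) \<omega>)) \<in> borel_measurable M"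
    using Y_state by (intro measurable_continuous_state[OF g Y_measurable]) blast
  have m': "(\<lambda>\<omega>. ?g (Y (t + \<tau>) \<omega>)) \<in> borel_measurable M"
    using b by (intro measurable_compose[where f="Y (t + \<tau>)" and g="?g", OF Y_measurable]) (simp add: bounded_borel_def)
  have "AE \<omega> in M. real_cond_exp M G (\<lambda>\<omega>. g (Y (t + \<tau>) \<omega>)) \<omega> = real_cond_exp M G (\<lambda>\<omega>. ?g (Y (t + \<tau>) \<omega>)) \<omega>"
    using m m' Y_state by (intro G.real_cond_exp_cong) auto
  moreover have "AE \<omega> in M. real_cond_exp M G (\<lambda>\<omega>. ?g (Y (t + \<tau>) \<omega>)) \<omega> = P \<tau> ?g (Y t \<omega>)"
    by (rule markov_real_cond_exp[OF \<tau> b G])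
  ultimately show ?thesis
  proof eventually_elim
    case (elim \<omega>)
    have "P \<tau> ?g (Y t \<omega>) = P \<tau> g (Y t \<omega>)" by (rule transition_op_cong) simp
    then show ?case using elim by simp
  qed
qed

lemma cond_exp_Y:
  assumes \<tau>: "0 < \<tau>" and G: "subalgebra M G" "sets G \<subseteq> sets (F t)" "Y t \<in> borel_measurable G"
  shows "AE \<omega> in M. real_cond_exp M G (Y (t + \<tau>)) \<omega> = rho \<tau> * Y t \<omega>"
    and "AE \<omega> in M. real_cond_exp M G (\<lambda>\<omega>. (Y (t + \<tau>) \<omega>)\<^sup>2) \<omega> = (rho \<tau>)\<^sup>2 * ((Y t \<omega>)\<^sup>2 - 1) + 1"
proof -
  show "AE \<omega> in M. real_cond_exp M G (Y (t + \<tau>)) \<omega> = rho \<tau> * Y t \<omega>"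
    using cond_exp_continuous[OF \<tau> continuous_on_id G] AE_space
    by eventually_elim (simp add: P_identity[OF \<tau>] Y_state)
  have "continuous_on S (\<lambda>x. x\<^sup>2)" by (intro continuous_intros)
  from cond_exp_continuous[OF \<tau> this G] AE_space
  show "AE \<omega> in M. real_cond_exp M G (\<lambda>\<omega>. (Y (t + \<tau>) \<omega>)\<^sup>2) \<omega> = (rho \<tau>)\<^sup>2 * ((Y t \<omega>)\<^sup>2 - 1) + 1"
    by eventually_elim (simp add: P_square[OF \<tau>] Y_state)
qed

lemma cond_variance_Y:
  assumes s: "0 \<le> s"
  shows "AE \<omega> in M. cond_variance M (generated_algebra M (Y t)) (Y (t + s)) \<omega> = 1 - exp (- 2 * \<alpha> * s)"
proof -
  let ?G = "generated_algebra M (Y t)"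
  have G: "subalgebra M ?G" by (rule subalgebra_generated_algebra[OF Y_measurable])
  interpret G: sigma_finite_subalgebra M ?G by (rule M.sigma_finite_subalgebraI[OF G])
  have Y_G: "Y t \<in> borel_measurable ?G"
    unfolding generated_algebra_def by (rule measurable_vimage_algebra1) simp
  note [measurable] = Y_measurable
  show ?thesis
  \<comment> \<open>The transition facts require a positive time, so s = 0 is settled separately by
    measurability of \<open>Y t\<close>.\<close>
  proof (cases "s = 0")
    case True
    have "AE \<omega> in M. real_cond_exp M ?G (Y t) \<omega> = Y t \<omega>"
      by (rule G.real_cond_exp_F_meas[OF integrable_Y Y_G])
    then have "AE \<omega> in M. (Y (t + s) \<omega> - real_cond_exp M ?G (Y (t + s)) \<omega>)\<^sup>2 = 0"
      by eventually_elim (simp add: True)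
    then have "AE \<omega> in M. cond_variance M ?G (Y (t + s)) \<omega> = real_cond_exp M ?G (\<lambda>\<omega>. 0) \<omega>"
      unfolding cond_variance_def by (intro G.real_cond_exp_cong) measurable
    moreover have "AE \<omega> in M. real_cond_exp M ?G (\<lambda>\<omega>. 0) \<omega> = 0"
      by (rule G.real_cond_exp_F_meas) auto
    ultimately show ?thesis
      by eventually_elim (simp add: True)
  next
    case False
    with s have s: "0 < s" by simp
    note ce = cond_exp_Y[OF s G generated_algebra_subset_natural_filtration Y_G]
    let ?D = "\<lambda>\<omega>. (Y (t + s) \<omega> - rho s * Y t \<omega>)\<^sup>2"
    have "AE \<omega> in M. (Y (t + s) \<omega> - real_cond_exp M ?G (Y (t + s)) \<omega>)\<^sup>2 = ?D \<omega>"
      using ce(1) by eventually_elim simp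
    then have "AE \<omega> in M. cond_variance M ?G (Y (t + s)) \<omega> = real_cond_exp M ?G ?D \<omega>"
      unfolding cond_variance_def by (intro G.real_cond_exp_cong) measurable
    moreover have "AE \<omega> in M. real_cond_exp M ?G ?D \<omega> = 1 - (rho s)\<^sup>2"
    proof -
      have i1: "integrable M (\<lambda>\<omega>. (Y u \<omega>)\<^sup>2)" for u using integrable_YY[of u u] by (simp add: power2_eq_square)
      have i2: "integrable M (\<lambda>\<omega>. (- 2 * rho s) * (Y t \<omega> * Y (t + s) \<omega>))" using integrable_YY by simp
      have i3: "integrable M (\<lambda>\<omega>. (rho s)\<^sup>2 * (Y t \<omega>)\<^sup>2)" using i1 by simp
      have D: "?D = (\<lambda>\<omega>. ((Y (t + s) \<omega>)\<^sup>2 + (- 2 * rho s) * (Y t \<omega> * Y (t + s) \<omega>)) + (rho s)\<^sup>2 * (Y t \<omega>)\<^sup>2)"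
        by (simp add: fun_eq_iff power2_eq_square algebra_simps)
      have "AE \<omega> in M. real_cond_exp M ?G ?D \<omega>
          = real_cond_exp M ?G (\<lambda>\<omega>. (Y (t + s) \<omega>)\<^sup>2 + (- 2 * rho s) * (Y t \<omega> * Y (t + s) \<omega>)) \<omega>
            + real_cond_exp M ?G (\<lambda>\<omega>. (rho s)\<^sup>2 * (Y t \<omega>)\<^sup>2) \<omega>"
        unfolding D by (intro G.real_cond_exp_add Bochner_Integration.integrable_add i1 i2 i3)
      moreover have "AE \<omega> in M. real_cond_exp M ?G (\<lambda>\<omega>. (Y (t + s) \<omega>)\<^sup>2 + (- 2 * rho s) * (Y t \<omega> * Y (t + s) \<omega>)) \<omega>
          = real_cond_exp M ?G (\<lambda>\<omega>. (Y (t + s) \<omega>)\<^sup>2) \<omega> + real_cond_exp M ?G (\<lambda>\<omega>. (- 2 * rho s) * (Y t \<omega> * Y (t + s) \<omega>)) \<omega>"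
        by (intro G.real_cond_exp_add i1 i2)
      moreover have "AE \<omega> in M. real_cond_exp M ?G (\<lambda>\<omega>. (rho s)\<^sup>2 * (Y t \<omega>)\<^sup>2) \<omega> = (rho s)\<^sup>2 * (Y t \<omega>)\<^sup>2"
        by (intro G.real_cond_exp_F_meas i3 borel_measurable_times borel_measurable_const borel_measurable_power Y_G)
      moreover have "AE \<omega> in M. real_cond_exp M ?G (\<lambda>\<omega>. (- 2 * rho s) * (Y t \<omega> * Y (t + s) \<omega>)) \<omega>
          = (- 2 * rho s) * real_cond_exp M ?G (\<lambda>\<omega>. Y t \<omega> * Y (t + s) \<omega>) \<omega>"
        by (intro G.real_cond_exp_cmult integrable_YY)
      moreover have "AE \<omega> in M. real_cond_exp M ?G (\<lambda>\<omega>. Y t \<omega> * Y (t + s) \<omega>) \<omega> = Y t \<omega> * real_cond_exp M ?G (Y (t + s)) \<omega>"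
        by (intro G.real_cond_exp_mult Y_G Y_measurable integrable_YY)
      ultimately show ?thesis
        using ce by eventually_elim (simp add: power2_eq_square algebra_simps)
    qed
    ultimately show ?thesis
    proof eventually_elim
      case (elim \<omega>)
      have "(rho s)\<^sup>2 = exp (- 2 * \<alpha> * s)"
        by (simp add: rho_def power2_eq_square exp_add[symmetric])
      with elim show ?case by (simp only:)
    qed
  qed
qed

section \<open>Mean continuity and the cadlag modification\<close>

lemma covariance_Y:
  assumes \<tau>: "0 < \<tau>" shows "(\<integral>\<omega>. Y t \<omega> * Y (t + \<tau>) \<omega> \<partial>M) = rho \<tau>"
proof -
  interpret G: sigma_finite_subalgebra M "F t" by (rule M.sigma_finite_subalgebraI[OF F_sub])
  have Y_F: "Y t \<in> borel_measurable (F t)" by (rule measurable_natural_filtration) simp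
  note [measurable] = Y_measurable
  have "(\<integral>\<omega>. Y t \<omega> * Y (t + \<tau>) \<omega> \<partial>M) = (\<integral>\<omega>. Y t \<omega> * real_cond_exp M (F t) (Y (t + \<tau>)) \<omega> \<partial>M)"
    by (rule G.real_cond_exp_intg(2)[symmetric, OF integrable_YY Y_F Y_measurable])
  also have "\<dots> = (\<integral>\<omega>. rho \<tau> * (Y t \<omega>)\<^sup>2 \<partial>M)"
  proof (rule integral_cong_AE)
    show "AE \<omega> in M. Y t \<omega> * real_cond_exp M (F t) (Y (t + \<tau>)) \<omega> = rho \<tau> * (Y t \<omega>)\<^sup>2"
      using cond_exp_Y(1)[OF \<tau> F_sub order_refl Y_F] by eventually_elim (simp add: power2_eq_square)
  qed measurable
  finally show ?thesis by (simp add: expectation_Y_square)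
qed

text \<open>Variance 1 and covariance \<open>rho \<tau>\<close> give the second moment 2 - 2
  \<open>rho \<tau>\<close> of the increment. The resulting continuity in mean identifies right
  limits of the process with its values.\<close>

lemma L1_increment:
  assumes \<tau>: "0 < \<tau>" shows "(\<integral>\<omega>. \<bar>Y (t + \<tau>) \<omega> - Y t \<omega>\<bar> \<partial>M) \<le> sqrt (2 - 2 * rho \<tau>)"
proof -
  have L2: "Y u \<in> L2_space M" for u by (rule M.bounded_imp_L2_space[OF Y_measurable Y_bounded])
  have i1: "integrable M (\<lambda>\<omega>. (Y u \<omega>)\<^sup>2)" for u using integrable_YY[of u u] by (simp add: power2_eq_square)
  have "(\<integral>\<omega>. (Y (t + \<tau>) \<omega> - Y t \<omega>)\<^sup>2 \<partial>M)
      = (\<integral>\<omega>. (Y (t + \<tau>) \<omega>)\<^sup>2 + (Y t \<omega>)\<^sup>2 - 2 * (Y t \<omega> * Y (t + \<tau>) \<omega>) \<partial>M)"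
    by (simp add: power2_eq_square algebra_simps)
  also have "\<dots> = 2 - 2 * rho \<tau>"
    using i1 integrable_YY covariance_Y[OF \<tau>] expectation_Y_square by simp
  finally show ?thesis
    using M.integral_abs_le_L2[OF L2_space_diff[OF L2 L2], of "t + \<tau>" t] by simp
qed

text \<open>Since \<open>E (Y\<^sub>t | F\<^sub>s) = e\<^sup>-\<^sup>\<alpha>\<^sup>(\<^sup>t\<^sup>-\<^sup>s\<^sup>) Y\<^sub>s\<close>, the process \<open>e\<^sup>\<alpha>\<^sup>t Y\<^sub>t\<close> is a martingale.\<close>

lemma no_oscillation_Y: "AE \<omega> in M. no_oscillation (\<lambda>t. exp (\<alpha> * t) * Y t \<omega>) dyadics"
proof (rule M.martingale_no_oscillation[where F=F])
  show "subalgebra M (F t)" for t by (rule F_sub)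
  show "sets (F s) \<subseteq> sets (F t)" if "s \<le> t" for s t
    using that by (intro sets_natural_filtration_mono) simp
  show "(\<lambda>\<omega>. exp (\<alpha> * t) * Y t \<omega>) \<in> borel_measurable (F t)" for t
    by (intro borel_measurable_times borel_measurable_const measurable_natural_filtration) simp
  show "\<exists>K. \<forall>t \<omega>. \<bar>t\<bar> \<le> L \<longrightarrow> \<omega> \<in> space M \<longrightarrow> \<bar>exp (\<alpha> * t) * Y t \<omega>\<bar> \<le> K" for L
  proof (intro exI[of _ "exp (\<alpha> * L) * bnd"] allI impI)
    fix t \<omega> assume "\<bar>t\<bar> \<le> L" "\<omega> \<in> space M"
    then show "\<bar>exp (\<alpha> * t) * Y t \<omega>\<bar> \<le> exp (\<alpha> * L) * bnd"
      using \<alpha> unfolding abs_mult by (intro mult_mono Y_bounded) auto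
  qed
  fix s t :: real and A assume st: "s < t" and A: "A \<in> sets (F s)"
  define \<tau> where "\<tau> = t - s"
  have \<tau>: "0 < \<tau>" "t = s + \<tau>" using st by (auto simp: \<tau>_def)
  have AM [measurable]: "A \<in> sets M" by (rule F_sets[OF A])
  let ?g = "\<lambda>x. if x \<in> S then x else 0"
  have b: "bounded_borel ?g" by (rule bounded_borel_extend[OF continuous_on_id])
  have int: "integrable M (\<lambda>\<omega>. indicator A \<omega> * Y u \<omega>)" for u
    using integrable_mult_indicator[OF AM integrable_Y[of u]] by simp
  have "(\<integral>\<omega>. indicator A \<omega> * Y t \<omega> \<partial>M) = (\<integral>\<omega>. indicator A \<omega> * ?g (Y (s + \<tau>) \<omega>) \<partial>M)"
    by (intro Bochner_Integration.integral_cong) (auto simp: \<tau>(2) Y_state)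
  also have "\<dots> = (\<integral>\<omega>. indicator A \<omega> * P \<tau> ?g (Y s \<omega>) \<partial>M)"
    by (rule markov_bounded[OF \<tau>(1) A b])
  also have "\<dots> = (\<integral>\<omega>. rho \<tau> * (indicator A \<omega> * Y s \<omega>) \<partial>M)"
  proof (intro Bochner_Integration.integral_cong refl)
    fix \<omega> assume "\<omega> \<in> space M"
    then have "P \<tau> ?g (Y s \<omega>) = rho \<tau> * Y s \<omega>"
      using P_identity[OF \<tau>(1) Y_state] transition_op_cong[of q ?g "\<lambda>x. x"] by auto
    then show "indicator A \<omega> * P \<tau> ?g (Y s \<omega>) = rho \<tau> * (indicator A \<omega> * Y s \<omega>)" by simp
  qed
  finally have eq: "(\<integral>\<omega>. indicator A \<omega> * Y t \<omega> \<partial>M) = rho \<tau> * (\<integral>\<omega>. indicator A \<omega> * Y s \<omega> \<partial>M)" by simp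
  have "(\<integral>\<omega>. indicator A \<omega> * (exp (\<alpha> * t) * Y t \<omega> - exp (\<alpha> * s) * Y s \<omega>) \<partial>M)
      = (\<integral>\<omega>. exp (\<alpha> * t) * (indicator A \<omega> * Y t \<omega>) - exp (\<alpha> * s) * (indicator A \<omega> * Y s \<omega>) \<partial>M)"
    by (simp add: algebra_simps)
  also have "\<dots> = exp (\<alpha> * t) * (\<integral>\<omega>. indicator A \<omega> * Y t \<omega> \<partial>M) - exp (\<alpha> * s) * (\<integral>\<omega>. indicator A \<omega> * Y s \<omega> \<partial>M)"
    using int by simp
  also have "\<dots> = 0"
    unfolding eq by (simp add: \<tau>(2) rho_def exp_add[symmetric] mult.assoc[symmetric] algebra_simps)
  finally show "(\<integral>\<omega>. indicator A \<omega> * (exp (\<alpha> * t) * Y t \<omega> - exp (\<alpha> * s) * Y s \<omega>) \<partial>M) = 0" .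
qed

lemma one_sided_limits_Y:
  assumes \<omega>: "\<omega> \<in> space M" and osc: "no_oscillation (\<lambda>t. exp (\<alpha> * t) * Y t \<omega>) dyadics"
  shows "\<exists>l. ((\<lambda>t. Y t \<omega>) \<longlongrightarrow> l) (at t within (dyadics \<inter> {t<..}))"
    and "\<exists>l. ((\<lambda>t. Y t \<omega>) \<longlongrightarrow> l) (at t within (dyadics \<inter> {..<t}))"
proof -
  have bd: "\<exists>K. \<forall>x. \<bar>x\<bar> \<le> c \<longrightarrow> \<bar>exp (\<alpha> * x) * Y x \<omega>\<bar> \<le> K" for c
  proof (intro exI[of _ "exp (\<alpha> * c) * bnd"] allI impI)
    fix x assume "\<bar>x\<bar> \<le> c"
    then show "\<bar>exp (\<alpha> * x) * Y x \<omega>\<bar> \<le> exp (\<alpha> * c) * bnd"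
      using \<alpha> unfolding abs_mult by (intro mult_mono Y_bounded \<omega>) auto
  qed
  have scale: "\<exists>l. ((\<lambda>t. Y t \<omega>) \<longlongrightarrow> l) (at t within A)"
    if lim: "\<exists>l. ((\<lambda>t. exp (\<alpha> * t) * Y t \<omega>) \<longlongrightarrow> l) (at t within A)" for A
  proof -
    obtain l where "((\<lambda>t. exp (\<alpha> * t) * Y t \<omega>) \<longlongrightarrow> l) (at t within A)" using lim by blast
    then have "((\<lambda>t. exp (- (\<alpha> * t)) * (exp (\<alpha> * t) * Y t \<omega>)) \<longlongrightarrow> exp (- (\<alpha> * t)) * l) (at t within A)"
      by (intro tendsto_intros)
    then show ?thesis by (auto simp: mult.assoc[symmetric] exp_add[symmetric])
  qed
  show "\<exists>l. ((\<lambda>t. Y t \<omega>) \<longlongrightarrow> l) (at t within (dyadics \<inter> {t<..}))"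
    by (intro scale no_oscillation_one_sided_limits(1)[OF dyadics_dense osc bd])
  show "\<exists>l. ((\<lambda>t. Y t \<omega>) \<longlongrightarrow> l) (at t within (dyadics \<inter> {..<t}))"
    by (intro scale no_oscillation_one_sided_limits(2)[OF dyadics_dense osc bd])
qed

text \<open>Off a null set the paths have one-sided limits along the dyadics. The right limits form
  a cadlag path, and continuity in mean shows that at each fixed time they equal the process almost
  surely.\<close>

lemma cadlag_modification_exists: "\<exists>Z. cadlag_modification M S Y Z"
proof -
  obtain B where B: "\<And>\<omega>. \<omega> \<in> space M - B \<Longrightarrow> no_oscillation (\<lambda>t. exp (\<alpha> * t) * Y t \<omega>) dyadics" "B \<in> null_sets M"
    using AE_E3[OF no_oscillation_Y] by blast
  have good: "no_oscillation (\<lambda>t. exp (\<alpha> * t) * Y t \<omega>) dyadics" if "\<omega> \<in> space M" "\<omega> \<notin> B" for \<omega>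
    using B that by blast
  \<comment> \<open>On the null set the path is constantly 0, which lies in the state space and is
    cadlag; so every path qualifies, not just almost every one.\<close>
  define Z where "Z t \<omega> = (if \<omega> \<in> B then 0 else Lim (at t within (dyadics \<inter> {t<..})) (\<lambda>s. Y s \<omega>))" for t \<omega>
  have neb: "at t within (dyadics \<inter> {t<..}) \<noteq> bot" for t
    by (rule dense_at_right_neq_bot[OF dyadics_dense])
  have lim: "((\<lambda>s. Y s \<omega>) \<longlongrightarrow> Z t \<omega>) (at t within (dyadics \<inter> {t<..}))" if \<omega>: "\<omega> \<in> space M" "\<omega> \<notin> B" for \<omega> t
  proof -
    obtain l where l: "((\<lambda>s. Y s \<omega>) \<longlongrightarrow> l) (at t within (dyadics \<inter> {t<..}))"
      using one_sided_limits_Y(1)[OF \<omega>(1) good[OF \<omega>]] by blast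
    then show ?thesis using tendsto_Lim[OF neb l] \<omega> by (simp add: Z_def)
  qed
  have Z_S: "Z t \<omega> \<in> S" if \<omega>: "\<omega> \<in> space M" for t \<omega>
  proof (cases "\<omega> \<in> B")
    case True
    then show ?thesis using state_space_nonempty[OF q] by (simp add: Z_def)
  next
    case False
    have "closed S" by (simp add: state_space_def)
    then show ?thesis
      by (rule Lim_in_closed_set[OF _ _ neb lim[OF \<omega> False]]) (simp add: Y_state[OF \<omega>])
  qed
  have seq: "\<exists>\<sigma>. (\<forall>n. \<sigma> n \<in> dyadics \<and> t < \<sigma> n \<and> \<sigma> n < t + inverse (real (Suc n)))" for t
  proof (rule choice, rule allI)
    fix n
    have "t < t + inverse (real (Suc n))" by simp
    from dyadics_dense[OF this] show "\<exists>s. s \<in> dyadics \<and> t < s \<and> s < t + inverse (real (Suc n))" by blast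
  qed
  \<comment> \<open>One sequence of times serves all paths at once, which makes measurability of
    limits and dominated convergence available.\<close>
  have conv: "\<exists>\<sigma>. (\<forall>n. t < \<sigma> n) \<and> \<sigma> \<longlonglongrightarrow> t \<and> (\<forall>\<omega>\<in>space M - B. (\<lambda>n. Y (\<sigma> n) \<omega>) \<longlonglongrightarrow> Z t \<omega>)" for t
  proof -
    obtain \<sigma> where \<sigma>: "\<And>n. \<sigma> n \<in> dyadics" "\<And>n. t < \<sigma> n" "\<And>n. \<sigma> n < t + inverse (real (Suc n))"
      using seq[of t] by blast
    have "(\<lambda>n. t + inverse (real (Suc n))) \<longlonglongrightarrow> t + 0"
      by (intro tendsto_add tendsto_const LIMSEQ_inverse_real_of_nat)
    then have upper: "(\<lambda>n. t + inverse (real (Suc n))) \<longlonglongrightarrow> t" by simp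
    have \<sigma>_lim: "\<sigma> \<longlonglongrightarrow> t"
    proof (rule tendsto_sandwich[OF _ _ tendsto_const upper]; intro always_eventually allI less_imp_le)
      show "t < \<sigma> n" "\<sigma> n < t + inverse (real (Suc n))" for n by (rule \<sigma>)+
    qed
    then have "filterlim \<sigma> (at t within (dyadics \<inter> {t<..})) sequentially"
    proof (subst filterlim_at, intro conjI always_eventually allI)
      show "\<sigma> n \<in> dyadics \<inter> {t<..}" "\<sigma> n \<noteq> t" for n using \<sigma>(1,2)[of n] by auto
    qed
    note \<sigma>_filter = this
    have "(\<lambda>n. Y (\<sigma> n) \<omega>) \<longlonglongrightarrow> Z t \<omega>" if "\<omega> \<in> space M - B" for \<omega>
      using that by (intro filterlim_compose[OF lim \<sigma>_filter]) auto
    then show ?thesis using \<sigma>(2) \<sigma>_lim by blast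
  qed
  have B_sets [measurable]: "B \<in> sets M" using B(2) by auto
  note [measurable] = Y_measurable
  have Z_meas: "Z t \<in> borel_measurable M" for t
  proof -
    obtain \<sigma> where \<sigma>: "\<And>\<omega>. \<omega> \<in> space M - B \<Longrightarrow> (\<lambda>n. Y (\<sigma> n) \<omega>) \<longlonglongrightarrow> Z t \<omega>" using conv[of t] by blast
    show ?thesis
    proof (rule borel_measurable_LIMSEQ_real)
      show "(\<lambda>\<omega>. if \<omega> \<in> B then 0 else Y (\<sigma> n) \<omega>) \<in> borel_measurable M" for n by measurable
      show "(\<lambda>n. if \<omega> \<in> B then 0 else Y (\<sigma> n) \<omega>) \<longlonglongrightarrow> Z t \<omega>" if "\<omega> \<in> space M" for \<omega>
        using \<sigma>[of \<omega>] that by (auto simp: Z_def)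
    qed
  qed
  have Z_eq: "AE \<omega> in M. Z t \<omega> = Y t \<omega>" for t
  proof -
    obtain \<sigma> where \<sigma>: "\<And>n. t < \<sigma> n" "\<sigma> \<longlonglongrightarrow> t" "\<And>\<omega>. \<omega> \<in> space M - B \<Longrightarrow> (\<lambda>n. Y (\<sigma> n) \<omega>) \<longlonglongrightarrow> Z t \<omega>"
      using conv[of t] by blast
    have intZ: "integrable M (\<lambda>\<omega>. \<bar>Z t \<omega> - Y t \<omega>\<bar>)"
      by (intro integrable_abs Bochner_Integration.integrable_diff integrable_Y
          integrable_Y_bounded[OF Z_meas state_abs_le[OF Z_S]])
    have "(\<lambda>n. \<integral>\<omega>. \<bar>Y (\<sigma> n) \<omega> - Y t \<omega>\<bar> \<partial>M) \<longlonglongrightarrow> (\<integral>\<omega>. \<bar>Z t \<omega> - Y t \<omega>\<bar> \<partial>M)"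
    proof (rule integral_dominated_convergence[where w="\<lambda>_. 2 * bnd"])
      have "AE \<omega> in M. \<omega> \<notin> B" by (rule AE_not_in[OF B(2)])
      then show "AE \<omega> in M. (\<lambda>n. \<bar>Y (\<sigma> n) \<omega> - Y t \<omega>\<bar>) \<longlonglongrightarrow> \<bar>Z t \<omega> - Y t \<omega>\<bar>"
        using AE_space by eventually_elim (intro tendsto_intros \<sigma>(3), auto)
      show "AE \<omega> in M. norm \<bar>Y (\<sigma> n) \<omega> - Y t \<omega>\<bar> \<le> 2 * bnd" for n
      proof (rule AE_I2)
        fix \<omega> assume "\<omega> \<in> space M"
        then show "norm \<bar>Y (\<sigma> n) \<omega> - Y t \<omega>\<bar> \<le> 2 * bnd"
          using Y_bounded[of \<omega> "\<sigma> n"] Y_bounded[of \<omega> t] by auto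
      qed
    qed (use intZ in \<open>auto\<close>)
    moreover have "(\<lambda>n. \<integral>\<omega>. \<bar>Y (\<sigma> n) \<omega> - Y t \<omega>\<bar> \<partial>M) \<longlonglongrightarrow> 0"
    proof (rule tendsto_sandwich[OF _ _ tendsto_const])
      have "(\<lambda>n. sqrt (2 - 2 * rho (\<sigma> n - t))) \<longlonglongrightarrow> sqrt (2 - 2 * exp (- \<alpha> * (t - t)))"
        unfolding rho_def by (intro tendsto_intros \<sigma>)
      then show "(\<lambda>n. sqrt (2 - 2 * rho (\<sigma> n - t))) \<longlonglongrightarrow> 0" by simp
      show "\<forall>\<^sub>F n in sequentially. (\<integral>\<omega>. \<bar>Y (\<sigma> n) \<omega> - Y t \<omega>\<bar> \<partial>M) \<le> sqrt (2 - 2 * rho (\<sigma> n - t))"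
      proof (intro always_eventually allI)
        fix n
        show "(\<integral>\<omega>. \<bar>Y (\<sigma> n) \<omega> - Y t \<omega>\<bar> \<partial>M) \<le> sqrt (2 - 2 * rho (\<sigma> n - t))"
          using L1_increment[of "\<sigma> n - t" t] \<sigma>(1)[of n] by simp
      qed
    qed simp
    ultimately have "(\<integral>\<omega>. \<bar>Z t \<omega> - Y t \<omega>\<bar> \<partial>M) = 0" by (rule LIMSEQ_unique)
    then show ?thesis
      using intZ by (subst (asm) integral_nonneg_eq_0_iff_AE) auto
  qed
  have "cadlag (\<lambda>t. Z t \<omega>)" if \<omega>: "\<omega> \<in> space M" for \<omega>
  proof (cases "\<omega> \<in> B")
    case True
    then show ?thesis by (auto simp: Z_def cadlag_def)
  next
    case False
    show ?thesis
      by (rule right_limits_cadlag[OF dyadics_dense lim[OF \<omega> False] one_sided_limits_Y(2)[OF \<omega> good[OF \<omega> False]]])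
  qed
  then show ?thesis
    unfolding cadlag_modification_def process_in_def
    by (intro exI[of _ Z] conjI allI ballI Z_meas Z_S Z_eq)
qed

end


section \<open>The strong Markov property\<close>

text \<open>The sequence may take the value t itself, which the filter \<open>at_right t\<close>
  excludes.\<close>

lemma right_continuous_tendsto:
  fixes f :: "real \<Rightarrow> real"
  assumes f: "(f \<longlongrightarrow> f t) (at_right t)" and s: "\<And>n. t \<le> s n" "s \<longlonglongrightarrow> t"
  shows "(\<lambda>n. f (s n)) \<longlonglongrightarrow> f t"
proof (rule continuous_within_tendsto_compose[of t "{t..}" f s])
  have "at t within {t..} = at_right t"
    unfolding at_within_def by (rule arg_cong[of _ _ "\<lambda>S. inf (nhds t) (principal S)"]) auto
  then show "continuous (at t within {t..}) f"
    using f by (simp add: continuous_within)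
qed (use s in auto)

text \<open>The least multiple of 2^(-n) strictly greater than x.\<close>

definition dyadic_above :: "nat \<Rightarrow> real \<Rightarrow> real" where
  "dyadic_above n x = real_of_int (\<lfloor>2 ^ n * x\<rfloor> + 1) / 2 ^ n"

lemma dyadic_above_gt: "x < dyadic_above n x"
proof -
  have "2 ^ n * x < real_of_int (\<lfloor>2 ^ n * x\<rfloor> + 1)" by linarith
  then show ?thesis by (simp add: dyadic_above_def field_simps)
qed

lemma dyadic_above_tendsto: "(\<lambda>n. dyadic_above n x) \<longlonglongrightarrow> x"
proof (rule tendsto_sandwich[OF _ _ tendsto_const])
  have "(\<lambda>n. x + (1 / 2) ^ n) \<longlonglongrightarrow> x + 0"
    by (intro tendsto_add tendsto_const LIMSEQ_power_zero) simp
  then show "(\<lambda>n. x + (1 / 2) ^ n) \<longlonglongrightarrow> x" by simp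
  show "\<forall>\<^sub>F n in sequentially. x \<le> dyadic_above n x"
    by (intro always_eventually allI less_imp_le dyadic_above_gt)
  have "dyadic_above n x \<le> x + (1 / 2) ^ n" for n
  proof -
    have "real_of_int (\<lfloor>2 ^ n * x\<rfloor> + 1) \<le> 2 ^ n * x + 1" by linarith
    then have "dyadic_above n x \<le> (2 ^ n * x + 1) / 2 ^ n"
      unfolding dyadic_above_def by (intro divide_right_mono) auto
    also have "\<dots> = x + (1 / 2) ^ n" by (simp add: field_simps)
    finally show ?thesis .
  qed
  then show "\<forall>\<^sub>F n in sequentially. dyadic_above n x \<le> x + (1 / 2) ^ n" by simp
qed

text \<open>The random time takes countably many values, so no joint measurability of Y is required.
  The map \<open>\<phi>\<close> allows for shifting the time by a constant and for capping
  it.\<close>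

lemma measurable_dyadic_above_process:
  assumes V: "V \<in> borel_measurable G" and Y: "\<And>r::real. Y (\<phi> r) \<in> borel_measurable G"
  shows "(\<lambda>\<omega>. Y (\<phi> (dyadic_above n (V \<omega>))) \<omega>) \<in> borel_measurable G"
proof -
  have "(\<lambda>\<omega>. \<lfloor>2 ^ n * V \<omega>\<rfloor> + 1) \<in> measurable G (count_space UNIV)"
    using V by measurable
  from measurable_compose_countable[OF Y this, of "\<lambda>i. real_of_int i / 2 ^ n"]
  show ?thesis by (simp add: dyadic_above_def)
qed

locale q_ou_stopping = q_ou_markov +
  fixes T :: "_ \<Rightarrow> ereal"
  assumes right_continuous: "\<omega> \<in> space M \<Longrightarrow> ((\<lambda>s. Y s \<omega>) \<longlongrightarrow> Y t \<omega>) (at_right t)"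
    and stopping: "stopping_time (natural_filtration M Y) T"
    and T_not_minus: "\<omega> \<in> space M \<Longrightarrow> T \<omega> \<noteq> - \<infinity>"
begin

abbreviation \<F> :: "ereal \<Rightarrow> 'a measure" where "\<F> \<equiv> natural_filtration M Y"

sublocale \<F>: filtration "space M" \<F>
  by (rule filtration_natural_filtration)

abbreviation pre :: "'a measure" where "pre \<equiv> \<F>.pre_sigma T"

text \<open>Has the value 0 where T is infinite; the integral identities below mask these points by
  the event that T is finite.\<close>

definition Tr :: "'a \<Rightarrow> real" where "Tr \<omega> = real_of_ereal (T \<omega>)"

lemma T_eq: "\<omega> \<in> space M \<Longrightarrow> T \<omega> < \<infinity> \<Longrightarrow> T \<omega> = ereal (Tr \<omega>)"
  using T_not_minus[of \<omega>] by (cases "T \<omega>") (auto simp: Tr_def)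

lemma T_measurable: "T \<in> borel_measurable M"
  by (rule measurable_stopping_time[OF stopping]) (auto dest: F_sets)

lemma Tr_measurable: "Tr \<in> borel_measurable M"
  unfolding Tr_def[abs_def] using T_measurable by measurable

lemma pre_sub: "subalgebra M pre"
  unfolding subalgebra_def
proof (intro conjI subsetI)
  show "space pre = space M" by (rule \<F>.space_pre_sigma)
  fix A assume "A \<in> sets pre"
  from \<F>.sets_pre_sigmaD[OF stopping this, of \<infinity>] show "A \<in> sets M" by (auto dest: F_sets)
qed

lemma Y_dyadic_tendsto:
  assumes "\<omega> \<in> space M"
  shows "(\<lambda>n. Y (dyadic_above n (Tr \<omega>) + a) \<omega>) \<longlonglongrightarrow> Y (Tr \<omega> + a) \<omega>"
proof (rule right_continuous_tendsto[of "\<lambda>s. Y s \<omega>"])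
  show "Tr \<omega> + a \<le> dyadic_above n (Tr \<omega>) + a" for n
    using dyadic_above_gt[of "Tr \<omega>" n] by simp
qed (intro right_continuous assms tendsto_add tendsto_const dyadic_above_tendsto)+

lemma Y_dyadic_measurable: "(\<lambda>\<omega>. Y (dyadic_above n (Tr \<omega>) + a) \<omega>) \<in> borel_measurable M"
  by (rule measurable_dyadic_above_process[where \<phi>="\<lambda>r. r + a", OF Tr_measurable Y_measurable])

lemma Y_Tr_measurable: "(\<lambda>\<omega>. Y (Tr \<omega> + a) \<omega>) \<in> borel_measurable M"
  by (rule borel_measurable_LIMSEQ_real[OF Y_dyadic_tendsto Y_dyadic_measurable])

text \<open>Stopping times provide events with \<le>, whereas the dyadic cells below have strict
  upper ends; the strict event is a countable union of non-strict ones at earlier times.\<close>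

lemma less_in_F:
  assumes A: "A \<in> sets pre" shows "{\<omega> \<in> A. T \<omega> < ereal c} \<in> sets (F c)"
proof -
  have "{\<omega> \<in> A. T \<omega> \<le> ereal (c - inverse (real (Suc m)))} \<in> sets (F c)" for m
    using \<F>.sets_pre_sigmaD[OF stopping A] sets_natural_filtration_mono[of "ereal (c - inverse (real (Suc m)))" "ereal c" M Y]
    by auto
  then have "(\<Union>m. {\<omega> \<in> A. T \<omega> \<le> ereal (c - inverse (real (Suc m)))}) \<in> sets (F c)" by blast
  also have "(\<Union>m. {\<omega> \<in> A. T \<omega> \<le> ereal (c - inverse (real (Suc m)))}) = {\<omega> \<in> A. T \<omega> < ereal c}"
  proof (intro set_eqI iffI)
    fix \<omega> assume "\<omega> \<in> (\<Union>m. {\<omega> \<in> A. T \<omega> \<le> ereal (c - inverse (real (Suc m)))})"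
    then obtain m where m: "\<omega> \<in> A" "T \<omega> \<le> ereal (c - inverse (real (Suc m)))" by blast
    have "ereal (c - inverse (real (Suc m))) < ereal c" by simp
    with m show "\<omega> \<in> {\<omega> \<in> A. T \<omega> < ereal c}" by (auto intro: le_less_trans)
  next
    fix \<omega> assume \<omega>: "\<omega> \<in> {\<omega> \<in> A. T \<omega> < ereal c}"
    then have "\<omega> \<in> space M" using A pre_sub by (auto simp: subalgebra_def dest: sets.sets_into_space)
    then have eq: "T \<omega> = ereal (Tr \<omega>)" using \<omega> by (intro T_eq) (auto intro: less_trans)
    then have "0 < c - Tr \<omega>" using \<omega> by simp
    then obtain m where "inverse (real (Suc m)) < c - Tr \<omega>" using reals_Archimedean by blast
    then show "\<omega> \<in> (\<Union>m. {\<omega> \<in> A. T \<omega> \<le> ereal (c - inverse (real (Suc m)))})"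
      using \<omega> eq by (intro UN_I[of m]) auto
  qed
  finally show ?thesis .
qed

definition cell :: "'a set \<Rightarrow> nat \<Rightarrow> int \<Rightarrow> 'a set" where
  "cell A n j = {\<omega> \<in> A. T \<omega> < \<infinity> \<and> \<lfloor>2 ^ n * Tr \<omega>\<rfloor> + 1 = j}"

text \<open>On the cell T lies in the interval from (j - 1) / 2^n inclusive to j / 2^n exclusive, so
  membership is decided at time j / 2^n, which is the value of \<open>dyadic_above\<close>
  there.\<close>

lemma cell_in_F:
  assumes A: "A \<in> sets pre" shows "cell A n j \<in> sets (F (real_of_int j / 2 ^ n))"
proof -
  let ?c = "real_of_int j / 2 ^ n" and ?d = "real_of_int (j - 1) / 2 ^ n"
  have "?d \<le> ?c" by (intro divide_right_mono) auto
  then have "{\<omega> \<in> A. T \<omega> < ereal ?d} \<in> sets (F ?c)"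
    using less_in_F[OF A, of ?d] sets_natural_filtration_mono[of "ereal ?d" "ereal ?c" M Y] by auto
  then have "{\<omega> \<in> A. T \<omega> < ereal ?c} - {\<omega> \<in> A. T \<omega> < ereal ?d} \<in> sets (F ?c)"
    using less_in_F[OF A, of ?c] by blast
  also have "{\<omega> \<in> A. T \<omega> < ereal ?c} - {\<omega> \<in> A. T \<omega> < ereal ?d} = cell A n j"
  proof (intro set_eqI)
    fix \<omega>
    show "\<omega> \<in> {\<omega> \<in> A. T \<omega> < ereal ?c} - {\<omega> \<in> A. T \<omega> < ereal ?d} \<longleftrightarrow> \<omega> \<in> cell A n j"
    proof (cases "\<omega> \<in> A \<and> T \<omega> < \<infinity>")
      case True
      then have "\<omega> \<in> space M" using A pre_sub by (auto simp: subalgebra_def dest: sets.sets_into_space)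
      then have eq: "T \<omega> = ereal (Tr \<omega>)" using True by (intro T_eq) auto
      have "\<lfloor>2 ^ n * Tr \<omega>\<rfloor> + 1 = j \<longleftrightarrow> real_of_int (j - 1) \<le> 2 ^ n * Tr \<omega> \<and> 2 ^ n * Tr \<omega> < real_of_int j"
        by linarith
      also have "\<dots> \<longleftrightarrow> ?d \<le> Tr \<omega> \<and> Tr \<omega> < ?c"
        by (auto simp: field_simps)
      finally show ?thesis using True eq by (auto simp: cell_def)
    next
      case False
      then show ?thesis by (auto simp: cell_def intro: less_trans)
    qed
  qed
  finally show ?thesis .
qed

text \<open>On each cell the approximating time is a constant at which the cell belongs to the past,
  so the ordinary Markov property applies. The countably many cells are then summed.\<close>

lemma strong_markov_dyadic:
  assumes A: "A \<in> sets pre" and \<tau>: "0 < \<tau>" and h: "bounded_borel h"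
  defines "A' \<equiv> {\<omega> \<in> A. T \<omega> < \<infinity>}"
  shows "(\<integral>\<omega>. indicator A' \<omega> * (h (Y (dyadic_above n (Tr \<omega>) + \<tau>) \<omega>) - P \<tau> h (Y (dyadic_above n (Tr \<omega>)) \<omega>)) \<partial>M) = 0"
proof -
  let ?f = "\<lambda>\<omega>. h (Y (dyadic_above n (Tr \<omega>) + \<tau>) \<omega>) - P \<tau> h (Y (dyadic_above n (Tr \<omega>)) \<omega>)"
  obtain K where K: "h \<in> borel_measurable borel" "\<And>x. \<bar>h x\<bar> \<le> K" using h by (elim bounded_borelE) blast
  have PK: "\<bar>P \<tau> h y\<bar> \<le> K" if "y \<in> S" for y by (rule P_bounded_borel_bound[OF \<tau> h K(2) that])
  have f_meas [measurable]: "?f \<in> borel_measurable M"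
  proof (rule borel_measurable_diff)
    show "(\<lambda>\<omega>. h (Y (dyadic_above n (Tr \<omega>) + \<tau>) \<omega>)) \<in> borel_measurable M"
      by (rule measurable_compose[OF Y_dyadic_measurable K(1)])
    show "(\<lambda>\<omega>. P \<tau> h (Y (dyadic_above n (Tr \<omega>)) \<omega>)) \<in> borel_measurable M"
      using Y_dyadic_measurable[of n 0] Y_state
      by (intro measurable_continuous_state[OF continuous_on_P[OF \<tau> integrable_bounded_borel[OF h]]]) auto
  qed
  have f_bound: "\<bar>?f \<omega>\<bar> \<le> 2 * K" if "\<omega> \<in> space M" for \<omega>
    using K(2)[of "Y (dyadic_above n (Tr \<omega>) + \<tau>) \<omega>"] PK[OF Y_state[OF that, of "dyadic_above n (Tr \<omega>)"]] by linarith
  have f_int: "integrable M ?f"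
    using f_bound by (intro M.integrable_const_bound[where B="2 * K"] AE_I2) auto
  let ?B = "\<lambda>i. cell A n (int_decode i)"
  have B_sets: "?B i \<in> sets M" for i
    using cell_in_F[OF A] by (rule F_sets)
  have UN: "(\<Union>i. ?B i) = A'"
  proof (intro set_eqI iffI)
    fix \<omega> assume "\<omega> \<in> A'"
    then have "\<omega> \<in> ?B (int_encode (\<lfloor>2 ^ n * Tr \<omega>\<rfloor> + 1))" by (simp add: A'_def cell_def)
    then show "\<omega> \<in> (\<Union>i. ?B i)" by blast
  qed (auto simp: A'_def cell_def)
  have zero: "(LINT \<omega>:?B i|M. ?f \<omega>) = 0" for i
  proof -
    let ?r = "real_of_int (int_decode i) / 2 ^ n"
    note int = integrable_markov[OF \<tau> B_sets[of i] h]
    have "(LINT \<omega>:?B i|M. ?f \<omega>) = (\<integral>\<omega>. indicator (?B i) \<omega> * h (Y (?r + \<tau>) \<omega>) - indicator (?B i) \<omega> * P \<tau> h (Y ?r \<omega>) \<partial>M)"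
      unfolding set_lebesgue_integral_def
    proof (intro Bochner_Integration.integral_cong refl)
      fix \<omega>
      have "dyadic_above n (Tr \<omega>) = ?r" if "\<omega> \<in> ?B i"
        using that by (simp only: cell_def dyadic_above_def mem_Collect_eq)
      then show "indicator (?B i) \<omega> *\<^sub>R ?f \<omega> = indicator (?B i) \<omega> * h (Y (?r + \<tau>) \<omega>) - indicator (?B i) \<omega> * P \<tau> h (Y ?r \<omega>)"
        by (cases "\<omega> \<in> ?B i") simp_all
    qed
    also have "\<dots> = 0"
      using int markov_bounded[OF \<tau> cell_in_F[OF A] h, of n "int_decode i"] by simp
    finally show ?thesis .
  qed
  have "(LINT \<omega>:(\<Union>i. ?B i)|M. ?f \<omega>) = (\<Sum>i. (LINT \<omega>:?B i|M. ?f \<omega>))"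
  proof (rule lebesgue_integral_countable_add[OF B_sets])
    show "?B i \<inter> ?B j = {}" if "i \<noteq> j" for i j
      using that by (auto simp: cell_def dest: injD[OF inj_int_decode])
    show "set_integrable M (\<Union>i. ?B i) ?f"
      unfolding set_integrable_def using B_sets by (intro integrable_mult_indicator f_int) auto
  qed
  then show ?thesis unfolding zero UN by (simp add: set_lebesgue_integral_def)
qed

lemma pre_finite_sets:
  assumes A: "A \<in> sets pre" shows "{\<omega> \<in> A. T \<omega> < \<infinity>} \<in> sets M"
proof -
  have AM: "A \<in> sets M" using A pre_sub by (auto simp: subalgebra_def)
  have "{\<omega> \<in> space M. T \<omega> < \<infinity>} \<in> sets M" using T_measurable by measurable
  then have "A \<inter> {\<omega> \<in> space M. T \<omega> < \<infinity>} \<in> sets M" using AM by blast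
  also have "A \<inter> {\<omega> \<in> space M. T \<omega> < \<infinity>} = {\<omega> \<in> A. T \<omega> < \<infinity>}"
    using sets.sets_into_space[OF AM] by auto
  finally show ?thesis .
qed

text \<open>Right continuity of the paths and continuity of h and \<open>P \<tau> h\<close> let the
  dyadic identity pass to the limit; from continuous h it extends to bounded Borel g by
  \<open>eq_0_if_continuous\<close>.\<close>

lemma strong_markov_integral:
  assumes A: "A \<in> sets pre" and \<tau>: "0 < \<tau>" and g: "bounded_borel g"
  defines "A' \<equiv> {\<omega> \<in> A. T \<omega> < \<infinity>}"
  shows "(\<integral>\<omega>. indicator A' \<omega> * g (Y (Tr \<omega> + \<tau>) \<omega>) \<partial>M) = (\<integral>\<omega>. indicator A' \<omega> * P \<tau> g (Y (Tr \<omega>) \<omega>) \<partial>M)"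
proof -
  have A'M: "A' \<in> sets M" unfolding A'_def by (rule pre_finite_sets[OF A])
  have YT: "(\<lambda>\<omega>. Y (Tr \<omega>) \<omega>) \<in> borel_measurable M" using Y_Tr_measurable[of 0] by simp
  have YS: "\<forall>\<omega>\<in>space M. Y (Tr \<omega>) \<omega> \<in> S" using Y_state by blast
  interpret bounded_functional "\<lambda>g. (\<integral>\<omega>. indicator A' \<omega> * g (Y (Tr \<omega> + \<tau>) \<omega>) \<partial>M) - (\<integral>\<omega>. indicator A' \<omega> * P \<tau> g (Y (Tr \<omega>) \<omega>) \<partial>M)"
    by (rule bounded_functional_transition[OF M.prob_space_axioms A'M Y_Tr_measurable YT YS \<tau>])
  have "(\<integral>\<omega>. indicator A' \<omega> * h (Y (Tr \<omega> + \<tau>) \<omega>) \<partial>M) - (\<integral>\<omega>. indicator A' \<omega> * P \<tau> h (Y (Tr \<omega>) \<omega>) \<partial>M) = 0"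
    if h: "continuous_on UNIV h" "bounded_borel h" for h
  proof -
    note int = integrable_transition[OF M.prob_space_axioms A'M Y_Tr_measurable YT YS \<tau> h(2)]
    obtain K where K: "h \<in> borel_measurable borel" "\<And>x. \<bar>h x\<bar> \<le> K" using h(2) by (elim bounded_borelE) blast
    have K0: "0 \<le> K" using K(2)[of 0] by linarith
    have PK: "\<bar>P \<tau> h y\<bar> \<le> K" if "y \<in> S" for y by (rule P_bounded_borel_bound[OF \<tau> h(2) K(2) that])
    have Ph: "continuous_on S (P \<tau> h)" by (rule continuous_on_P[OF \<tau> integrable_bounded_borel[OF h(2)]])
    let ?f = "\<lambda>n \<omega>. indicator A' \<omega> * (h (Y (dyadic_above n (Tr \<omega>) + \<tau>) \<omega>) - P \<tau> h (Y (dyadic_above n (Tr \<omega>)) \<omega>))"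
    have "(\<lambda>n. \<integral>\<omega>. ?f n \<omega> \<partial>M) \<longlonglongrightarrow> (\<integral>\<omega>. indicator A' \<omega> * (h (Y (Tr \<omega> + \<tau>) \<omega>) - P \<tau> h (Y (Tr \<omega>) \<omega>)) \<partial>M)"
    proof (rule integral_dominated_convergence[where w="\<lambda>_. 2 * K"])
      show "(\<lambda>\<omega>. indicator A' \<omega> * (h (Y (Tr \<omega> + \<tau>) \<omega>) - P \<tau> h (Y (Tr \<omega>) \<omega>))) \<in> borel_measurable M"
        using borel_measurable_diff[OF borel_measurable_integrable[OF int(1)] borel_measurable_integrable[OF int(2)]]
        by (simp add: right_diff_distrib)
      show "?f n \<in> borel_measurable M" for n
      proof (intro borel_measurable_times borel_measurable_indicator A'M borel_measurable_diff)
        show "(\<lambda>\<omega>. h (Y (dyadic_above n (Tr \<omega>) + \<tau>) \<omega>)) \<in> borel_measurable M"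
          by (rule measurable_compose[OF Y_dyadic_measurable K(1)])
        show "(\<lambda>\<omega>. P \<tau> h (Y (dyadic_above n (Tr \<omega>)) \<omega>)) \<in> borel_measurable M"
          using Y_dyadic_measurable[of n 0] Y_state by (intro measurable_continuous_state[OF Ph]) auto
      qed
      show "AE \<omega> in M. (\<lambda>n. ?f n \<omega>) \<longlonglongrightarrow> indicator A' \<omega> * (h (Y (Tr \<omega> + \<tau>) \<omega>) - P \<tau> h (Y (Tr \<omega>) \<omega>))"
      proof (rule AE_I2)
        fix \<omega> assume \<omega>: "\<omega> \<in> space M"
        have "(\<lambda>n. h (Y (dyadic_above n (Tr \<omega>) + \<tau>) \<omega>)) \<longlonglongrightarrow> h (Y (Tr \<omega> + \<tau>) \<omega>)"
          by (rule continuous_on_tendsto_compose[OF h(1) Y_dyadic_tendsto[OF \<omega>]]) auto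
        moreover have "(\<lambda>n. P \<tau> h (Y (dyadic_above n (Tr \<omega>)) \<omega>)) \<longlonglongrightarrow> P \<tau> h (Y (Tr \<omega>) \<omega>)"
          using Y_dyadic_tendsto[OF \<omega>, of 0] Y_state[OF \<omega>]
          by (intro continuous_on_tendsto_compose[OF Ph]) auto
        ultimately show "(\<lambda>n. ?f n \<omega>) \<longlonglongrightarrow> indicator A' \<omega> * (h (Y (Tr \<omega> + \<tau>) \<omega>) - P \<tau> h (Y (Tr \<omega>) \<omega>))"
          by (intro tendsto_intros)
      qed
      show "AE \<omega> in M. norm (?f n \<omega>) \<le> 2 * K" for n
      proof (rule AE_I2)
        fix \<omega> assume \<omega>: "\<omega> \<in> space M"
        show "norm (?f n \<omega>) \<le> 2 * K"
          using K(2)[of "Y (dyadic_above n (Tr \<omega>) + \<tau>) \<omega>"] PK[OF Y_state[OF \<omega>, of "dyadic_above n (Tr \<omega>)"]] K0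
          by (auto simp: indicator_def)
      qed
    qed simp
    moreover have "(\<integral>\<omega>. ?f n \<omega> \<partial>M) = 0" for n
      unfolding A'_def by (rule strong_markov_dyadic[OF A \<tau> h(2)])
    ultimately have "(\<integral>\<omega>. indicator A' \<omega> * (h (Y (Tr \<omega> + \<tau>) \<omega>) - P \<tau> h (Y (Tr \<omega>) \<omega>)) \<partial>M) = 0"
      by (simp add: LIMSEQ_const_iff)
    then show ?thesis using int by (simp add: right_diff_distrib)
  qed
  from eq_0_if_continuous[OF this g] show ?thesis by simp
qed

text \<open>Progressive measurability: where T \<le> r, the value at T is a limit of values at the
  dyadic times above T capped at r, so nothing later than r is consulted.\<close>

lemma T_le_Y_le_in_F: "{\<omega> \<in> space M. T \<omega> \<le> ereal r \<and> Y (Tr \<omega>) \<omega> \<le> c} \<in> sets (F r)"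
proof -
  define V where "V \<omega> = real_of_ereal (min (T \<omega>) (ereal r))" for \<omega>
  have "(\<lambda>\<omega>. min (T \<omega>) (ereal r)) \<in> borel_measurable (F r)"
  proof (rule borel_measurableI_le)
    fix c
    show "{\<omega> \<in> space (F r). min (T \<omega>) (ereal r) \<le> c} \<in> sets (F r)"
    proof (cases "ereal r \<le> c")
      case True
      then have "{\<omega> \<in> space (F r). min (T \<omega>) (ereal r) \<le> c} = space (F r)" by (auto simp: min_le_iff_disj)
      then show ?thesis by (simp only: sets.top)
    next
      case False
      then have "{\<omega> \<in> space (F r). min (T \<omega>) (ereal r) \<le> c} = {\<omega> \<in> space (\<F> c). T \<omega> \<le> c}"
        by (auto simp: min_le_iff_disj)
      moreover have "\<dots> \<in> sets (\<F> c)" using stopping_timeD[OF stopping, of c] by (simp add: pred_def)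
      moreover have "sets (\<F> c) \<subseteq> sets (F r)" using False by (intro sets_natural_filtration_mono) auto
      ultimately show ?thesis by auto
    qed
  qed
  then have V: "V \<in> borel_measurable (F r)" unfolding V_def[abs_def] by measurable
  define U where "U n \<omega> = Y (min (dyadic_above n (V \<omega>)) r) \<omega>" for n \<omega>
  have U: "U n \<in> borel_measurable (F r)" for n
    unfolding U_def
    by (rule measurable_dyadic_above_process[where \<phi>="\<lambda>x. min x r", OF V]) (rule measurable_natural_filtration, simp)
  have T_set: "{\<omega> \<in> space (F r). T \<omega> \<le> ereal r} \<in> sets (F r)"
    using stopping_timeD[OF stopping, of "ereal r"] by (simp add: pred_def)
  have U_lim: "(\<lambda>n. U n \<omega>) \<longlonglongrightarrow> Y (Tr \<omega>) \<omega>" if \<omega>: "\<omega> \<in> space M" "T \<omega> \<le> ereal r" for \<omega>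
  proof -
    have "T \<omega> < \<infinity>" using \<omega>(2) by (auto intro: le_less_trans)
    then have eq: "T \<omega> = ereal (Tr \<omega>)" by (rule T_eq[OF \<omega>(1)])
    with \<omega> have V_eq: "V \<omega> = Tr \<omega>" and le: "Tr \<omega> \<le> r" by (auto simp: V_def min_def)
    show ?thesis
      unfolding U_def V_eq
    proof (rule right_continuous_tendsto[of "\<lambda>s. Y s \<omega>"])
      show "Tr \<omega> \<le> min (dyadic_above n (Tr \<omega>)) r" for n
        using le dyadic_above_gt[of "Tr \<omega>" n] by simp
      show "(\<lambda>n. min (dyadic_above n (Tr \<omega>)) r) \<longlonglongrightarrow> Tr \<omega>"
        using tendsto_min[OF dyadic_above_tendsto tendsto_const, of "Tr \<omega>" r] le by simp
    qed (rule right_continuous[OF \<omega>(1)])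
  qed
  have "(\<lambda>\<omega>. if T \<omega> \<le> ereal r then Y (Tr \<omega>) \<omega> else 0) \<in> borel_measurable (F r)"
  proof (rule borel_measurable_LIMSEQ_real)
    show "(\<lambda>n. if T \<omega> \<le> ereal r then U n \<omega> else 0) \<longlonglongrightarrow> (if T \<omega> \<le> ereal r then Y (Tr \<omega>) \<omega> else 0)"
      if "\<omega> \<in> space (F r)" for \<omega>
      using U_lim that by auto
    show "(\<lambda>\<omega>. if T \<omega> \<le> ereal r then U n \<omega> else 0) \<in> borel_measurable (F r)" for n
      by (rule measurable_If[OF U measurable_const T_set]) simp
  qed
  then have "{\<omega> \<in> space (F r). (if T \<omega> \<le> ereal r then Y (Tr \<omega>) \<omega> else 0) \<le> c} \<in> sets (F r)" by measurable
  then have "{\<omega> \<in> space (F r). T \<omega> \<le> ereal r} \<inter> {\<omega> \<in> space (F r). (if T \<omega> \<le> ereal r then Y (Tr \<omega>) \<omega> else 0) \<le> c} \<in> sets (F r)"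
    using T_set by blast
  also have "{\<omega> \<in> space (F r). T \<omega> \<le> ereal r} \<inter> {\<omega> \<in> space (F r). (if T \<omega> \<le> ereal r then Y (Tr \<omega>) \<omega> else 0) \<le> c}
      = {\<omega> \<in> space M. T \<omega> \<le> ereal r \<and> Y (Tr \<omega>) \<omega> \<le> c}" by auto
  finally show ?thesis .
qed

lemma Y_T_pre_measurable: "(\<lambda>\<omega>. if T \<omega> < \<infinity> then Y (Tr \<omega>) \<omega> else 0) \<in> borel_measurable pre"
proof (intro borel_measurableI_le \<F>.sets_pre_sigmaI[OF stopping])
  fix c :: real and t :: ereal
  let ?A = "\<lambda>r. {\<omega> \<in> space M. T \<omega> \<le> ereal r \<and> Y (Tr \<omega>) \<omega> \<le> c}"
  let ?W = "{\<omega> \<in> {\<omega> \<in> space pre. (if T \<omega> < \<infinity> then Y (Tr \<omega>) \<omega> else 0) \<le> c}. T \<omega> \<le> t}"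
  show "?W \<in> sets (\<F> t)"
  proof (cases t)
    case (real r)
    have "?W = ?A r"
      unfolding real \<F>.space_pre_sigma by (auto intro: le_less_trans)
    then show ?thesis using T_le_Y_le_in_F[of r c] real by simp
  next
    case PInf
    have A: "?A (real m) \<in> sets (\<F> \<infinity>)" for m :: nat
      using T_le_Y_le_in_F[of "real m" c] sets_natural_filtration_mono[of "ereal (real m)" \<infinity> M Y] by auto
    have "{\<omega> \<in> space (\<F> \<infinity>). T \<omega> < \<infinity>} \<in> sets (\<F> \<infinity>)"
      using \<F>.stopping_time_less_const[OF stopping, of \<infinity>] by (simp add: pred_def)
    then have "space (\<F> \<infinity>) - {\<omega> \<in> space (\<F> \<infinity>). T \<omega> < \<infinity>} \<in> sets (\<F> \<infinity>)" by (rule sets.compl_sets)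
    \<comment> \<open>Points with infinite T carry the default value 0, so they belong to the
      sublevel set exactly when 0 \<le> c.\<close>
    then have W': "(\<Union>m. ?A (real m)) \<union> (if 0 \<le> c then space (\<F> \<infinity>) - {\<omega> \<in> space (\<F> \<infinity>). T \<omega> < \<infinity>} else {}) \<in> sets (\<F> \<infinity>)"
      using A by auto
    have W_eq: "?W = (\<Union>m. ?A (real m)) \<union> (if 0 \<le> c then space (\<F> \<infinity>) - {\<omega> \<in> space (\<F> \<infinity>). T \<omega> < \<infinity>} else {})"
    proof (intro set_eqI)
      fix \<omega>
      show "\<omega> \<in> ?W \<longleftrightarrow> \<omega> \<in> (\<Union>m. ?A (real m)) \<union> (if 0 \<le> c then space (\<F> \<infinity>) - {\<omega> \<in> space (\<F> \<infinity>). T \<omega> < \<infinity>} else {})"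
      proof (cases "\<omega> \<in> space M \<and> T \<omega> < \<infinity>")
        case True
        obtain m :: nat where "Tr \<omega> \<le> real m" using real_arch_simple by blast
        then have "T \<omega> \<le> ereal (real m)" using T_eq[of \<omega>] True by simp
        then show ?thesis using True by (auto simp: \<F>.space_pre_sigma PInf)
      next
        case False
        then have "\<omega> \<notin> ?A (real m)" for m
          by (auto intro: le_less_trans)
        then show ?thesis using False by (auto simp: \<F>.space_pre_sigma PInf)
      qed
    qed
    show ?thesis using W' unfolding W_eq[symmetric] PInf .
  next
    case MInf
    have "?W = {}" using T_not_minus by (auto simp: MInf \<F>.space_pre_sigma)
    then show ?thesis by (simp only: sets.empty_sets)
  qed
qed

text \<open>The right-hand side, too, is set to 0 where T is infinite. This gives a
  \<open>pre\<close>-measurable function on the whole space, to which the characterisation of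
  conditional expectations applies.\<close>

lemma strong_markov_real_cond_exp:
  assumes \<tau>: "0 < \<tau>" and g: "bounded_borel g"
  shows "AE \<omega> in M. T \<omega> < \<infinity> \<longrightarrow>
    real_cond_exp M pre (\<lambda>\<omega>. if T \<omega> < \<infinity> then g (Y (real_of_ereal (T \<omega>) + \<tau>) \<omega>) else 0) \<omega>
      = P \<tau> g (Y (real_of_ereal (T \<omega>)) \<omega>)"
proof -
  interpret G: sigma_finite_subalgebra M pre by (rule M.sigma_finite_subalgebraI[OF pre_sub])
  have YT: "(\<lambda>\<omega>. Y (Tr \<omega>) \<omega>) \<in> borel_measurable M" using Y_Tr_measurable[of 0] by simp
  have YS: "\<forall>\<omega>\<in>space M. Y (Tr \<omega>) \<omega> \<in> S" using Y_state by blast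
  let ?f = "\<lambda>\<omega>. if T \<omega> < \<infinity> then g (Y (Tr \<omega> + \<tau>) \<omega>) else 0"
  let ?h = "\<lambda>\<omega>. if T \<omega> < \<infinity> then P \<tau> g (Y (Tr \<omega>) \<omega>) else 0"
  have fin: "{\<omega> \<in> space M. T \<omega> < \<infinity>} \<in> sets M" using T_measurable by measurable
  note int = integrable_transition[OF M.prob_space_axioms fin Y_Tr_measurable YT YS \<tau> g]
  have "AE \<omega> in M. real_cond_exp M pre ?f \<omega> = ?h \<omega>"
  proof (rule G.real_cond_exp_charact)
    fix A assume A: "A \<in> sets pre"
    let ?A' = "{\<omega> \<in> A. T \<omega> < \<infinity>}"
    have "(LINT \<omega>:A|M. ?f \<omega>) = (\<integral>\<omega>. indicator ?A' \<omega> * g (Y (Tr \<omega> + \<tau>) \<omega>) \<partial>M)"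
      unfolding set_lebesgue_integral_def
      by (intro Bochner_Integration.integral_cong refl) (auto simp: indicator_def)
    also have "\<dots> = (\<integral>\<omega>. indicator ?A' \<omega> * P \<tau> g (Y (Tr \<omega>) \<omega>) \<partial>M)"
      by (rule strong_markov_integral[OF A \<tau> g])
    also have "\<dots> = (LINT \<omega>:A|M. ?h \<omega>)"
      unfolding set_lebesgue_integral_def
      by (intro Bochner_Integration.integral_cong refl) (auto simp: indicator_def)
    finally show "(LINT \<omega>:A|M. ?f \<omega>) = (LINT \<omega>:A|M. ?h \<omega>)" .
  next
    show "integrable M ?f"
      by (rule Bochner_Integration.integrable_cong[THEN iffD1, OF refl _ int(1)]) (auto simp: indicator_def)
    show "integrable M ?h"
      by (rule Bochner_Integration.integrable_cong[THEN iffD1, OF refl _ int(2)]) (auto simp: indicator_def)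
    \<comment> \<open>\<open>P \<tau> g\<close> is known to be continuous only on the state space;
      extended by 0 it is a Borel function that can be composed with the stopped value.\<close>
    let ?k = "\<lambda>x. if x \<in> S then P \<tau> g x else 0"
    have "?k \<in> borel_measurable borel"
      by (intro borel_measurable_extend_0 borel_measurable_continuous_qN_measure continuous_on_P \<tau> integrable_bounded_borel g)
    from measurable_compose[OF Y_T_pre_measurable this]
    have k: "(\<lambda>\<omega>. ?k (if T \<omega> < \<infinity> then Y (Tr \<omega>) \<omega> else 0)) \<in> borel_measurable pre" .
    have T_pre: "{\<omega> \<in> space pre. T \<omega> < \<infinity>} \<in> sets pre"
      using \<F>.measurable_stopping_time_pre_sigma[OF stopping] by measurable
    have "(\<lambda>\<omega>. if T \<omega> < \<infinity> then ?k (if T \<omega> < \<infinity> then Y (Tr \<omega>) \<omega> else 0) else 0) \<in> borel_measurable pre"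
      by (rule measurable_If[OF k measurable_const T_pre]) simp
    then show "?h \<in> borel_measurable pre"
      by (rule measurable_cong[THEN iffD1, rotated]) (auto simp: \<F>.space_pre_sigma Y_state)
  qed
  then show ?thesis
    unfolding Tr_def by eventually_elim simp
qed

end

context q_ou_markov
begin

lemma strong_markov_cadlag:
  assumes "\<And>\<omega>. \<omega> \<in> space M \<Longrightarrow> cadlag (\<lambda>t. Y t \<omega>)"
  shows "strong_markov M Y P"
  unfolding strong_markov_def
proof (intro allI impI ballI; (elim conjE)?)
  fix T :: "'a \<Rightarrow> ereal" and \<tau> g
  assume T: "stopping_time (natural_filtration M Y) T" "\<forall>\<omega>\<in>space M. T \<omega> \<noteq> - \<infinity>"
    and \<tau>: "0 < (\<tau>::real)" and g: "g \<in> borel_measurable borel" "bounded (range (g :: real \<Rightarrow> real))"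
  interpret q_ou_stopping q \<alpha> M Y T
    using assms T by unfold_locales (auto simp: cadlag_def)
  show "AE \<omega> in M. T \<omega> < \<infinity> \<longrightarrow>
    real_cond_exp M (filtration.pre_sigma (space M) (natural_filtration M Y) T)
      (\<lambda>\<omega>. if T \<omega> < \<infinity> then g (Y (real_of_ereal (T \<omega>) + \<tau>) \<omega>) else 0) \<omega>
      = P \<tau> g (Y (real_of_ereal (T \<omega>)) \<omega>)"
    using g by (intro strong_markov_real_cond_exp \<tau>) (simp add: bounded_borel_def)
qed

end

section \<open>The theorem\<close>

lemma OU_process_q_ou_process:
  assumes q: "\<bar>q\<bar> < 1" and \<alpha>: "0 < \<alpha>" and OU: "OU_process M \<alpha> q Y"
  shows "q_ou_process q \<alpha> M Y"
proof -
  interpret q_ou_markov q \<alpha> M Y by (rule OU_process_markov[OF assms])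
  show ?thesis
  proof
    fix g :: "real \<Rightarrow> real" and t assume g: "g \<in> borel_measurable borel"
    have D: "distributed M lborel (Y t) (\<lambda>x. ennreal (f_N x q))"
      using OU by (auto simp: OU_process_def)
    have "(\<integral>\<omega>. g (Y t \<omega>) \<partial>M) = (\<integral>x. f_N x q * g x \<partial>lborel)"
      by (rule distributed_integral[OF D, symmetric]) (use g f_N_nonneg[OF q] in auto)
    also have "\<dots> = (LINT x:S|lborel. g x * f_N x q)"
      unfolding set_lebesgue_integral_def
      by (intro Bochner_Integration.integral_cong) (auto simp: indicator_def f_N_def)
    also have "\<dots> = (\<integral>x. g x \<partial>N)"
      by (rule integral_N[symmetric, OF borel_measurable_qN_measureI[OF g]])
    finally show "(\<integral>\<omega>. g (Y t \<omega>) \<partial>M) = (\<integral>x. g x \<partial>N)" .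
  qed
qed

theorem theorem3:
  fixes q \<alpha> :: real
    and M :: "'a measure"
    and Y :: "real \<Rightarrow> 'a \<Rightarrow> real"
    and P :: "real \<Rightarrow> (real \<Rightarrow> real) \<Rightarrow> real \<Rightarrow> real"
  assumes q: "\<bar>q\<bar> < 1"
    and \<alpha>: "0 < \<alpha>"
    and OU: "OU_process M \<alpha> q Y"
    and P: "P = transition_op \<alpha> q"
  shows
    "((\<forall>t. prob_space.variance M (Y t) = 1) \<and>
      (\<forall>t s. 0 \<le> s \<longrightarrow>
         (AE \<omega> in M. cond_variance M (generated_algebra M (Y t)) (Y (t + s)) \<omega>
                       = 1 - exp (- 2 * \<alpha> * s))) \<and>
      (\<exists>Z. cadlag_modification M (state_space q) Y Z))
     \<and>
     (\<forall>\<tau>>0. \<forall>f\<in>B_space q.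
        (\<forall>y\<in>state_space q. set_integrable lborel (state_space q) (\<lambda>x. f x * f_CN x y (exp (- \<alpha> * \<tau>)) q)) \<and>
        P \<tau> f \<in> B_space q \<and>
        (\<exists>b. hermite_expansion q f b) \<and>
        (\<forall>b. hermite_expansion q f b \<longrightarrow>
             hermite_expansion q (P \<tau> f) (\<lambda>j. exp (- \<alpha> * \<tau> * real j) * b j)))
     \<and>
     (feller_continuous (state_space q) P \<and>
      (\<forall>Z. cadlag_modification M (state_space q) Y Z \<longrightarrow> strong_markov M Z P))
     \<and>
     (right_continuous_family (state_space q) P \<and>
      feller_process M (state_space q) Y P \<and>
      Domain (infinitesimal_operator (qN_measure q) P) = B0_space q \<and>
      (\<forall>(f, g)\<in>infinitesimal_operator (qN_measure q) P. \<forall>b.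
         hermite_expansion q f b \<longrightarrow> hermite_expansion q g (\<lambda>j. - \<alpha> * real j * b j)))"
proof -
  interpret q_ou_process q \<alpha> M Y
    by (rule OU_process_q_ou_process[OF q \<alpha> OU])
  have exp_rho: "exp (- \<alpha> * \<tau> * real j) = rho \<tau> ^ j" for \<tau> j
    by (simp only: rho_power)
  have strong: "strong_markov M Z P" if Z: "cadlag_modification M (state_space q) Y Z" for Z
  proof -
    interpret Z: q_ou_markov q \<alpha> M Z
      using Z unfolding cadlag_modification_def process_in_def by (intro q_ou_markov_modification) blast+
    show ?thesis
      unfolding P using Z by (intro Z.strong_markov_cadlag) (simp add: cadlag_modification_def)
  qed
  have expansions: "set_integrable lborel (state_space q) (\<lambda>x. f x * f_CN x y (exp (- \<alpha> * \<tau>)) q)"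
    "P \<tau> f \<in> B_space q" "hermite_expansion q f (coeff f)"
    "hermite_expansion q f b \<Longrightarrow> hermite_expansion q (P \<tau> f) (\<lambda>j. exp (- \<alpha> * \<tau> * real j) * b j)"
    if "0 < \<tau>" "f \<in> B_space q" "y \<in> state_space q" for \<tau> f y b
  proof -
    have f: "f \<in> L2_space (qN_measure q)" using that by (simp add: B_space_eq)
    show "set_integrable lborel (state_space q) (\<lambda>x. f x * f_CN x y (exp (- \<alpha> * \<tau>)) q)"
      by (rule set_integrable_f_CN[OF that(1) L2_space_integrable[OF f] that(3)])
    show "P \<tau> f \<in> B_space q"
      unfolding P B_space_eq by (rule P_L2(1)[OF that(1) f])
    show "hermite_expansion q f (coeff f)"
      unfolding hermite_expansion_eq by (rule expansion_coeff[OF f])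
    show "hermite_expansion q (P \<tau> f) (\<lambda>j. exp (- \<alpha> * \<tau> * real j) * b j)" if "hermite_expansion q f b"
      using expansion_P[OF \<open>0 < \<tau>\<close> f] that unfolding hermite_expansion_eq P exp_rho by (simp add: expansion_iff)
  qed
  have generator: "hermite_expansion q g (\<lambda>j. - \<alpha> * real j * b j)"
    if "(f, g) \<in> infinitesimal_operator (qN_measure q) P" "hermite_expansion q f b" for f g b
    using generator_coeff[of f g] that unfolding hermite_expansion_eq P by (simp add: expansion_iff)
  have "process_in M (state_space q) Y"
    using OU by (simp add: OU_process_def)
  then have feller: "feller_process M (state_space q) Y P"
    unfolding feller_process_def P using markov_with_transition_Y feller_semigroup_P by blast
  show ?thesis
  proof (intro conjI allI impI ballI)
    show "M.variance (Y t) = 1" for t by (rule variance_Y)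
    show "AE \<omega> in M. cond_variance M (generated_algebra M (Y t)) (Y (t + s)) \<omega> = 1 - exp (- 2 * \<alpha> * s)"
      if "0 \<le> s" for t s using that by (rule cond_variance_Y)
    show "\<exists>Z. cadlag_modification M (state_space q) Y Z" by (rule cadlag_modification_exists)
    show "feller_continuous (state_space q) P" unfolding P by (rule feller_continuous_P)
    show "right_continuous_family (state_space q) P" unfolding P by (rule right_continuous_family_P)
    show "Domain (infinitesimal_operator (qN_measure q) P) = B0_space q" unfolding P by (rule Domain_generator)
    \<comment> \<open>The bundled facts mention a point of the state space; where the claim does
      not, 0 is supplied.\<close>
    show "\<exists>b. hermite_expansion q f b" if "0 < \<tau>" "f \<in> B_space q" for \<tau> :: real and f
      using expansions(3)[OF that state_space_nonempty[OF q]] by blast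
    show "case p of (f, g) \<Rightarrow> \<forall>b. hermite_expansion q f b \<longrightarrow> hermite_expansion q g (\<lambda>j. - \<alpha> * real j * b j)"
      if "p \<in> infinitesimal_operator (qN_measure q) P" for p
      using generator that by (cases p) auto
    show "strong_markov M Z P" if "cadlag_modification M (state_space q) Y Z" for Z
      by (rule strong[OF that])
    show "feller_process M (state_space q) Y P" by (rule feller)
    show "set_integrable lborel (state_space q) (\<lambda>x. f x * f_CN x y (exp (- \<alpha> * \<tau>)) q)"
      if "0 < \<tau>" "f \<in> B_space q" "y \<in> state_space q" for \<tau> f y
      by (rule expansions(1)[OF that])
    show "P \<tau> f \<in> B_space q" if "0 < \<tau>" "f \<in> B_space q" for \<tau> f
      by (rule expansions(2)[OF that state_space_nonempty[OF q]])
    show "hermite_expansion q (P \<tau> f) (\<lambda>j. exp (- \<alpha> * \<tau> * real j) * b j)"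
      if "0 < \<tau>" "f \<in> B_space q" "hermite_expansion q f b" for \<tau> f b
      by (rule expansions(4)[OF that(1,2) state_space_nonempty[OF q] that(3)])
  qed
qed

end
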